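(* Let $p$ be a prime. (a) For every $\alpha\in p\mathbb{Z}_p\setminus p^2\mathbb{Z}_p$, $x_1^{\alpha}$ is an almost primitive element of the procyclic group $F(x_1)$. (b) The commutator $[x_1,x_2]$ is an almost primitive element of $F(x_1,x_2)$. (c) Given $n,k\ge 0$ and $\alpha_i\in p\mathbb{Z}_p\setminus p^2\mathbb{Z}_p$ for $1\le i\le n$, the element $$x_1^{\alpha_1}\cdots x_n^{\alpha_n}[x_{n+1},x_{n+2}]\cdots[x_{n+2k-1},x_{n+2k}]$$ is an almost primitive element of $F(x_1,\ldots,x_n,x_{n+1},\ldots,x_{n+2k})$. (d) Given $n,k\ge 0$, $\alpha_i\in p\mathbb{Z}_p\setminus\{0\}$ for $1\le i\le n$, and $\beta_i\in\mathbb{Z}_p\setminus\{0\}$ for $1\le i\le 2k$, the element $$x_1^{\alpha_1}\cdots x_n^{\alpha_n}[x_{n+1}^{\beta_1},x_{n+2}^{\beta_2}]\cdots[x_{n+2k-1}^{\beta_{2k-1}},x_{n+2k}^{\beta_{2k}}]$$ is a test element of $F(x_1,\ldots,x_n,x_{n+1},\ldots,x_{n+2k})$.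
   Context: $\mathbb{Z}_p$ denotes the $p$-adic integers. $F(x_1,\ldots,x_m)$ denotes the free pro-$p$ group on $\{x_1,\ldots,x_m\}$. Subgroups of pro-$p$ groups are closed, generation is topological, and homomorphisms are continuous. $[a,b]$ is the commutator of $a$ and $b$. An element of a pro-$p$ group $G$ is primitive if it is a member of a minimal generating set for $G$; equivalently, it lies outside the Frattini subgroup $\Phi(G)$. An element $g\in G$ is almost primitive in $G$ if it is not primitive in $G$ but is a primitive element of every proper subgroup of $G$ that contains it. An element $g\in G$ is a test element of $G$ if every endomorphism $\varphi:G\to G$ with $\varphi(g)=g$ is an automorphism. *)

theory Defs
  imports
    "HOL-Analysis.Analysis"
    "HOL-Computational_Algebra.Primes"
    "HOL-Algebra.Ideal"
    "HOL-Algebra.Generated_Groups"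
begin

section \<open>The ring of p-adic integers\<close>

text \<open>
  The inverse limit of the rings \<open>\<int>/p\<^sup>n\<int>\<close>: an element is the coherent sequence of its
  reductions modulo \<open>p\<^sup>n\<close>, each represented by its least nonnegative residue.
\<close>

definition padic_ints :: "nat \<Rightarrow> (nat \<Rightarrow> int) ring" where
  "padic_ints p =
    \<lparr>carrier = {a. \<forall>n. a n \<in> {0..<int p ^ n} \<and> a (Suc n) mod int p ^ n = a n},
     mult = (\<lambda>a b n. a n * b n mod int p ^ n),
     one = (\<lambda>n. 1 mod int p ^ n),
     zero = (\<lambda>n. 0),
     add = (\<lambda>a b n. (a n + b n) mod int p ^ n)\<rparr>"

text \<open>The ideal generated by (the image of) the natural number \<open>m\<close>.\<close>

definition padic_multiples :: "nat \<Rightarrow> nat \<Rightarrow> (nat \<Rightarrow> int) set" where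
  "padic_multiples p m =
    PIdl\<^bsub>padic_ints p\<^esub> (add_pow (padic_ints p) m \<one>\<^bsub>padic_ints p\<^esub>)"


section \<open>Topological groups and pro-p groups\<close>

locale topological_group = group G for G (structure) +
  fixes T
  assumes topspace_eq: "topspace T = carrier G"
    and continuous_mult: "continuous_map (prod_topology T T) T (\<lambda>(a, b). a \<otimes> b)"
    and continuous_inv: "continuous_map T T (m_inv G)"

text \<open>
  A profinite group is a compact Hausdorff topological group whose open subgroups form a
  neighbourhood base of the identity; it is pro-\<open>p\<close> if every open normal subgroup has
  \<open>p\<close>-power index.  (The index is written with \<open>card\<close>, which is 0, hence not a power of \<open>p\<close>,
  when there are infinitely many cosets.)
\<close>

locale pro_p_group = topological_group G T for p :: nat and G (structure) and T +
  assumes prime_p: "prime p"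
    and compact: "compact_space T"
    and Hausdorff: "Hausdorff_space T"
    and open_subgroup_base:
      "\<And>U. openin T U \<Longrightarrow> \<one> \<in> U \<Longrightarrow> \<exists>H. subgroup H G \<and> openin T H \<and> H \<subseteq> U"
    and index_power:
      "\<And>N. N \<lhd> G \<Longrightarrow> openin T N \<Longrightarrow> \<exists>k. card (rcosets N) = p ^ k"

definition continuous_hom ::
  "('a, 'c) monoid_scheme \<Rightarrow> 'a topology \<Rightarrow> ('b, 'd) monoid_scheme \<Rightarrow> 'b topology \<Rightarrow> ('a \<Rightarrow> 'b) set"
  where "continuous_hom G T H S = {\<phi> \<in> hom G H. continuous_map T S \<phi>}"

definition topologically_generates ::
  "('a, 'c) monoid_scheme \<Rightarrow> 'a topology \<Rightarrow> 'a set \<Rightarrow> bool"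
  where "topologically_generates G T X \<longleftrightarrow>
    X \<subseteq> carrier G \<and> T closure_of (generate G X) = carrier G"

text \<open>
  The universal property of the free pro-\<open>p\<close> group on \<open>x 1, \<dots>, x m\<close>.  Quantification over all
  pro-\<open>p\<close> groups \<open>H\<close> is rendered by those with elements in \<open>nat set\<close>.  This loses nothing: that
  type has the cardinality of the continuum, every topologically finitely generated pro-\<open>p\<close>
  group has at most that many elements, and a map from \<open>{1..m}\<close> into an arbitrary pro-\<open>p\<close> group
  may be corestricted to the closed subgroup generated by its image.  (Uniqueness against
  these \<open>H\<close> already forces \<open>x 1, \<dots>, x m\<close> to generate \<open>G\<close> topologically.)
\<close>

definition free_pro_p_group ::
  "nat \<Rightarrow> ('a, 'c) monoid_scheme \<Rightarrow> 'a topology \<Rightarrow> nat \<Rightarrow> (nat \<Rightarrow> 'a) \<Rightarrow> bool"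
  where "free_pro_p_group p G T m x \<longleftrightarrow>
    pro_p_group p G T \<and> x \<in> {1..m} \<rightarrow> carrier G \<and>
    (\<forall>(H :: nat set monoid) S f. pro_p_group p H S \<and> f \<in> {1..m} \<rightarrow> carrier H \<longrightarrow>
      (\<exists>\<phi> \<in> continuous_hom G T H S. (\<forall>i\<in>{1..m}. \<phi> (x i) = f i) \<and>
        (\<forall>\<psi> \<in> continuous_hom G T H S. (\<forall>i\<in>{1..m}. \<psi> (x i) = f i) \<longrightarrow>
          (\<forall>g\<in>carrier G. \<psi> g = \<phi> g))))"


section \<open>Words with p-adic exponents\<close>

text \<open>
  For \<open>\<alpha>\<close> in the \<open>p\<close>-adic integers, \<open>g\<^sup>\<alpha>\<close> is the limit of \<open>g [^] a\<^sub>n\<close> for any integers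
  \<open>a\<^sub>n\<close> converging \<open>p\<close>-adically to \<open>\<alpha>\<close>, in particular for the residues \<open>\<alpha> n\<close>.
\<close>

definition padic_pow ::
  "('a, 'c) monoid_scheme \<Rightarrow> 'a topology \<Rightarrow> 'a \<Rightarrow> (nat \<Rightarrow> int) \<Rightarrow> 'a"
  where "padic_pow G T g \<alpha> = (THE l. limitin T (\<lambda>n. g [^]\<^bsub>G\<^esub> \<alpha> n) l sequentially)"

definition commutator :: "('a, 'c) monoid_scheme \<Rightarrow> 'a \<Rightarrow> 'a \<Rightarrow> 'a"
  where "commutator G a b = inv\<^bsub>G\<^esub> a \<otimes>\<^bsub>G\<^esub> inv\<^bsub>G\<^esub> b \<otimes>\<^bsub>G\<^esub> a \<otimes>\<^bsub>G\<^esub> b"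

definition list_mult :: "('a, 'c) monoid_scheme \<Rightarrow> 'a list \<Rightarrow> 'a"
  where "list_mult G gs = foldr (\<otimes>\<^bsub>G\<^esub>) gs \<one>\<^bsub>G\<^esub>"


section \<open>Primitive, almost primitive and test elements\<close>

definition primitive_element :: "('a, 'c) monoid_scheme \<Rightarrow> 'a topology \<Rightarrow> 'a \<Rightarrow> bool"
  where "primitive_element G T g \<longleftrightarrow>
    (\<exists>X. g \<in> X \<and> topologically_generates G T X \<and>
      (\<forall>Y. Y \<subset> X \<longrightarrow> \<not> topologically_generates G T Y))"

text \<open>Subgroups of a pro-\<open>p\<close> group are understood to be closed.\<close>

definition almost_primitive_element :: "('a, 'c) monoid_scheme \<Rightarrow> 'a topology \<Rightarrow> 'a \<Rightarrow> bool"
  where "almost_primitive_element G T g \<longleftrightarrow>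
    g \<in> carrier G \<and> \<not> primitive_element G T g \<and>
    (\<forall>H. subgroup H G \<and> closedin T H \<and> H \<noteq> carrier G \<and> g \<in> H \<longrightarrow>
      primitive_element (G\<lparr>carrier := H\<rparr>) (subtopology T H) g)"

definition test_element :: "('a, 'c) monoid_scheme \<Rightarrow> 'a topology \<Rightarrow> 'a \<Rightarrow> bool"
  where "test_element G T g \<longleftrightarrow>
    g \<in> carrier G \<and>
    (\<forall>\<phi> \<in> continuous_hom G T G T. \<phi> g = g \<longrightarrow> \<phi> \<in> iso G G \<and> homeomorphic_map T T \<phi>)"

end

theory Submission
  imports
    Defs
    "HOL-Algebra.Group_Action"
    "HOL-Algebra.Multiplicative_Group"
    "HOL-Number_Theory.Cong"
begin

text \<open>
  Everything is read off from homomorphisms to finite p-groups.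

  An element of a pro-p group is primitive iff some continuous homomorphism to \<open>\<int>/p\<close> does not kill
  it.  A proper closed subgroup \<open>H\<close> containing the word \<open>g\<close> lies in the kernel of some
  \<open>\<theta> \<noteq> 0\<close> from \<open>G\<close> to \<open>\<int>/p\<close>.  By freeness \<open>\<theta>\<close> lifts to the wreath product of \<open>\<int>/p\<close> with \<open>\<int>/p\<close>,
  with arbitrary base components at the generators; the lift maps \<open>H\<close> to the elementary abelian base,
  and the components can be chosen such that \<open>g\<close> is not mapped to 0.

  Suppose that an endomorphism \<open>\<phi>\<close> fixes the word \<open>g\<close> of part (d) and is not surjective.  Then, as far
  as homomorphisms to a given finite p-group can tell, \<open>g\<close> does not involve some member \<open>y\<^sub>0\<close> of a
  minimal generating set.  Changing the value at \<open>y\<^sub>0\<close> of a homomorphism to the wreath product of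
  \<open>\<int>/p\<^sup>M\<close> with \<open>\<int>/p\<^sup>M\<close> by an element of the base yields a derivation \<open>D\<close> with \<open>D g = 0\<close>, but with \<open>D x\<^sub>i\<close>
  outside the maximal ideal of the group ring for some \<open>i\<close> that does not depend on the action.  If
  the other \<open>x\<^sub>l\<close> with \<open>l \<le> n\<close> act with order \<open>p\<close>, \<open>x\<^sub>i\<close> acts trivially and its partner in a
  commutator, if there is one, with order \<open>p\<^sup>M\<close>, then the formula for \<open>D g\<close> forces \<open>D x\<^sub>i\<close> into the
  maximal ideal.
\<close>

section \<open>Finite p-groups\<close>

text \<open>A homomorphism into the wreath product that lifts a given G -> Z/q is the same thing as
  a derivation from G into the group ring (Z/r)[Z/q], so freeness supplies a Fox calculus at finite
  level: the values at the generators are arbitrary, and powers and commutators have explicit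
  derivatives. A derivation is additive on a subgroup that acts trivially, so its restriction to
  \<open>H\<close> gives characters of \<open>H\<close> although no basis of \<open>H\<close> is at
  hand.

  The maximal ideal consists of the elements whose coefficient sum is divisible by p. The obstacle
  in part (d) is that the exponents may be divisible by high powers of p. If p^N divides none of
  them, q = r = p^(N+1) leaves enough room. When x_l acts by h = q/p, the derivative of its power in
  the word is invariant under translation by h, so applying (translation by h) - 1 to D g = 0
  removes it and leaves an equation in D x_i alone. This equation makes D x_i invariant under h
  modulo p, and the sum of such a function over q = p h arguments is 0 modulo p.\<close>

text \<open>Normalizers grow in finite p-groups: Q acts on its right cosets by right translation,
  their number is divisible by p, and Q is one fixed coset, so there is another. If Q fixes the
  coset Q a, then a Q a^-1 lies in Q.\<close>

lemma (in group) p_subgroup_normalized: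
  assumes p: "prime p" and ord: "order G = p ^ k"
    and Q: "subgroup Q G" "Q \<noteq> carrier G"
  obtains a where "a \<in> carrier G" "a \<notin> Q" "\<And>q. q \<in> Q \<Longrightarrow> a \<otimes> q \<otimes> inv a \<in> Q"
proof -
  interpret Q: subgroup Q G by (rule Q)
  let ?Q = "G\<lparr>carrier := Q\<rparr>"
  interpret QG: group ?Q by (rule subgroup.subgroup_is_group[OF Q(1) is_group])
  define E where "E = rcosets Q"
  \<comment> \<open>The inverse turns right translation into a left action; the restriction to
    \<open>E\<close> makes the maps extensional, as \<open>Bij\<close> demands.\<close>
  define \<phi> where "\<phi> = (\<lambda>q. \<lambda>C\<in>E. C #> inv q)"
  have finG: "finite (carrier G)"
    using ord p by (metis order_gt_0_iff_finite prime_gt_0_nat zero_less_power)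
  have finE: "finite E"
    unfolding E_def using finG by (simp add: RCOSETS_def)
  have Esub: "C \<subseteq> carrier G" if "C \<in> E" for C
    using that Q.rcosets_carrier[OF is_group] unfolding E_def by blast
  have Eclosed: "C #> x \<in> E" if "C \<in> E" "x \<in> carrier G" for C x
  proof -
    from that obtain a where "a \<in> carrier G" "C = Q #> a" unfolding E_def RCOSETS_def by auto
    with that show ?thesis
      unfolding E_def by (auto simp: coset_mult_assoc Q.subset intro!: rcosetsI)
  qed
  have bij: "\<phi> q \<in> Bij E" if "q \<in> Q" for q
  proof -
    have qc: "q \<in> carrier G" using that by simp
    have "bij_betw (\<lambda>C. C #> inv q) E E"
      by (rule bij_betwI[where g = "\<lambda>C. C #> q"])
        (use qc Esub in \<open>auto simp: Eclosed coset_mult_assoc\<close>)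
    then show ?thesis unfolding Bij_def \<phi>_def by auto
  qed
  have "group_hom ?Q (BijGroup E) \<phi>"
  proof (intro group_hom.intro group_hom_axioms.intro homI)
    show "group ?Q" "group (BijGroup E)" by (auto intro: QG.is_group group_BijGroup)
    show "\<phi> q \<in> carrier (BijGroup E)" if "q \<in> carrier ?Q" for q
      using bij that by (simp add: BijGroup_def)
    show "\<phi> (q \<otimes>\<^bsub>?Q\<^esub> r) = \<phi> q \<otimes>\<^bsub>BijGroup E\<^esub> \<phi> r" if "q \<in> carrier ?Q" "r \<in> carrier ?Q" for q r
      using that bij[of q] bij[of r]
      by (auto simp: BijGroup_def compose_def \<phi>_def fun_eq_iff Eclosed coset_mult_assoc Esub inv_mult_group)
  qed
  then interpret act: group_action ?Q E \<phi> by (rule group_action.intro)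
  have QE: "Q \<in> E" unfolding E_def by (rule Q.subgroup_in_rcosets[OF is_group])
  have orbit1: "card (orbit ?Q \<phi> C) = 1 \<or> p dvd card (orbit ?Q \<phi> C)" if "C \<in> E" for C
  proof -
    have "card (orbit ?Q \<phi> C) dvd order ?Q"
      using act.orbit_stabilizer_theorem[OF that] by (metis dvd_triv_left)
    moreover have "order ?Q dvd p ^ k"
      using lagrange[OF Q(1)] unfolding ord[symmetric] by (simp add: order_def) (metis dvd_triv_right)
    ultimately obtain i where "card (orbit ?Q \<phi> C) = p ^ i"
      using p divides_primepow_nat[of p] dvd_trans by blast
    then show ?thesis by (cases i) auto
  qed
  have orbQ: "orbit ?Q \<phi> Q = {Q}"
  proof -
    have "\<phi> q Q = Q" if "q \<in> Q" for q
      using that QE by (simp add: \<phi>_def coset_join2 Q(1))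
    then show ?thesis unfolding orbit_def using Q.one_closed by (auto intro!: exI[of _ \<one>])
  qed
  have "\<exists>C\<in>E. C \<noteq> Q \<and> card (orbit ?Q \<phi> C) = 1"
  proof (rule ccontr)
    assume none: "\<not> ?thesis"
    then have *: "p dvd card B" if "B \<in> orbits ?Q E \<phi> - {{Q}}" for B
    proof -
      from that obtain C where C: "C \<in> E" "B = orbit ?Q \<phi> C" unfolding orbits_def by auto
      then have "C \<noteq> Q" using that orbQ by auto
      then show ?thesis using none orbit1[OF C(1)] C by auto
    qed
    have "card E = (\<Sum>B\<in>orbits ?Q E \<phi>. card B)"
      using act.disjoint_sum[OF finE, of "\<lambda>_. 1::nat"] by simp
    also have "\<dots> = card {Q} + (\<Sum>B\<in>orbits ?Q E \<phi> - {{Q}}. card B)"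
    proof (rule sum.remove)
      show "finite (orbits ?Q E \<phi>)" unfolding orbits_def using finE by simp
      show "{Q} \<in> orbits ?Q E \<phi>" unfolding orbits_def by (intro CollectI exI[of _ Q]) (simp add: orbQ QE)
    qed
    finally have cardE: "card E = 1 + (\<Sum>B\<in>orbits ?Q E \<phi> - {{Q}}. card B)" by simp
    have "p dvd (\<Sum>B\<in>orbits ?Q E \<phi> - {{Q}}. card B)" by (rule dvd_sum) (rule *)
    moreover have "p dvd card E"
    proof -
      have "card E dvd p ^ k"
        using lagrange[OF Q(1)] unfolding ord[symmetric] E_def by (metis dvd_triv_left)
      then obtain i where i: "card E = p ^ i" using p divides_primepow_nat[of p] by blast
      have "card E \<noteq> 1"
      proof
        assume "card E = 1"
        then have "card Q = card (carrier G)"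
          using lagrange[OF Q(1)] unfolding E_def order_def by simp
        then show False using card_subset_eq[OF finG Q.subset] Q(2) by simp
      qed
      then show ?thesis using i by (cases i) auto
    qed
    ultimately have "p dvd 1" unfolding cardE using dvd_add_left_iff by blast
    then show False using p by (simp add: not_prime_unit)
  qed
  then obtain C where C: "C \<in> E" "C \<noteq> Q" "card (orbit ?Q \<phi> C) = 1" by blast
  obtain a where a: "a \<in> carrier G" "C = Q #> a" using C(1) unfolding E_def RCOSETS_def by auto
  have fix1: "\<phi> q C = C" if "q \<in> Q" for q
  proof -
    have "\<phi> q C \<in> orbit ?Q \<phi> C" "C \<in> orbit ?Q \<phi> C"
      using that act.orbit_refl[OF C(1)] by (auto simp: orbit_def)
    then show ?thesis using C(3) by (metis card_1_singletonE singletonD)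
  qed
  show ?thesis
  proof
    show "a \<in> carrier G" by (rule a)
    show "a \<notin> Q" using C(2) a(2) coset_join2[OF a(1) Q(1)] by blast
    fix q assume q: "q \<in> Q"
    then have qc: "q \<in> carrier G" by simp
    have "C #> q = C" using fix1[OF Q.m_inv_closed[OF q]] C(1) qc by (simp add: \<phi>_def)
    then have "Q #> (a \<otimes> q) = Q #> a" using a qc by (simp add: coset_mult_assoc Q.subset)
    then have "a \<otimes> q \<in> Q #> a" using a(1) qc rcos_self[OF _ Q(1)] by (metis m_closed)
    then obtain h where "h \<in> Q" "a \<otimes> q = h \<otimes> a" unfolding r_coset_def by auto
    then show "a \<otimes> q \<otimes> inv a \<in> Q" using a(1) qc by (metis Q.mem_carrier inv_solve_right m_closed)
  qed
qed

text \<open>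
  A maximal proper subgroup \<open>M\<close> is normalized by some \<open>a \<notin> M\<close>, so every element has
  the form \<open>m a\<^sup>i\<close> with \<open>m \<in> M\<close>, and \<open>m a\<^sup>i \<mapsto> i mod p\<close> is well defined.
\<close>

lemma (in group) p_group_proper_subgroup_character:
  assumes p: "prime p" and ord: "order G = p ^ k"
    and Q: "subgroup Q G" "Q \<noteq> carrier G"
  obtains \<xi> a where "\<xi> \<in> hom G (integer_mod_group p)" "\<And>q. q \<in> Q \<Longrightarrow> \<xi> q = 0"
    "a \<in> carrier G" "\<xi> a \<noteq> 0"
proof -
  have finG: "finite (carrier G)"
    using ord p by (metis order_gt_0_iff_finite prime_gt_0_nat zero_less_power)
  define \<M> where "\<M> = {M. subgroup M G \<and> M \<noteq> carrier G \<and> Q \<subseteq> M}"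
  have "finite \<M>"
    by (rule finite_subset[of _ "Pow (carrier G)"]) (auto simp: \<M>_def finG dest: subgroup.subset)
  moreover have "Q \<in> \<M>" using Q by (simp add: \<M>_def)
  ultimately obtain M where M: "M \<in> \<M>" "\<And>M'. M' \<in> \<M> \<Longrightarrow> M \<subseteq> M' \<Longrightarrow> M = M'"
    using finite_has_maximal[of \<M>] by blast
  then have MG: "subgroup M G" "M \<noteq> carrier G" "Q \<subseteq> M" by (auto simp: \<M>_def)
  interpret M: subgroup M G by (rule MG)
  obtain a where a: "a \<in> carrier G" "a \<notin> M" and norm: "\<And>q. q \<in> M \<Longrightarrow> a \<otimes> q \<otimes> inv a \<in> M"
    using p_subgroup_normalized[OF p ord MG(1,2)] by blast
  have normi: "a [^] i \<otimes> q \<otimes> inv (a [^] i) \<in> M" if "q \<in> M" for q and i :: nat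
  proof (induction i)
    case (Suc i)
    have "a [^] Suc i \<otimes> q \<otimes> inv (a [^] Suc i) = a \<otimes> (a [^] i \<otimes> q \<otimes> inv (a [^] i)) \<otimes> inv a"
      using a that unfolding nat_pow_Suc2[OF a(1)] by (simp add: inv_mult_group m_assoc)
    then show ?case using norm[OF Suc] by simp
  qed (use that in simp)
  have apk: "a [^] (p ^ k) = \<one>" using pow_order_eq_1[OF a(1)] ord by simp
  \<comment> \<open>If p does not divide i, then i is invertible modulo p^k, which kills a; so a is
    a power of a^i and would lie in M.\<close>
  have pow_M: "p dvd i" if "a [^] i \<in> M" for i :: nat
  proof (rule ccontr)
    assume "\<not> p dvd i"
    then have "coprime i (p ^ k)" using p by (metis coprime_power_right_iff prime_imp_coprime coprime_commute)
    then obtain s where s: "[i * s = 1] (mod p ^ k)" using cong_solve_coprime_nat[of i "p ^ k"] by auto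
    have "a = a [^] (1::nat)" using a by simp
    also have "\<dots> = a [^] (i * s)"
    proof -
      have "a [^] n = a [^] (n mod p ^ k)" for n
      proof -
        have "a [^] n = a [^] (p ^ k * (n div p ^ k) + n mod p ^ k)" by simp
        also have "\<dots> = a [^] (n mod p ^ k)"
          using a(1) by (simp only: nat_pow_mult[symmetric] nat_pow_pow[symmetric] apk) simp
        finally show ?thesis .
      qed
      then show ?thesis using s unfolding cong_def by metis
    qed
    also have "\<dots> = (a [^] i) [^] s" using a(1) by (simp add: nat_pow_pow)
    also have "\<dots> \<in> M" using that by (induction s) auto
    finally show False using a by simp
  qed
  define N where "N = {m \<otimes> a [^] i | m (i::nat). m \<in> M}"
  have N_mult: "(m \<otimes> a [^] i) \<otimes> (n \<otimes> a [^] j) = (m \<otimes> (a [^] i \<otimes> n \<otimes> inv (a [^] i))) \<otimes> a [^] (i + j)"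
    if "m \<in> M" "n \<in> M" for m n and i j :: nat
    using that a(1) by (simp add: m_assoc nat_pow_mult[symmetric] inv_solve_left)
  have "subgroup N G"
  proof (rule subgroupI)
    show "N \<subseteq> carrier G" unfolding N_def using a by auto
    show "N \<noteq> {}" unfolding N_def using M.one_closed by blast
    show mult: "x \<otimes> y \<in> N" if "x \<in> N" "y \<in> N" for x y
    proof -
      from that obtain m i n j where "x = m \<otimes> a [^] (i::nat)" "y = n \<otimes> a [^] (j::nat)" "m \<in> M" "n \<in> M"
        unfolding N_def by blast
      then show ?thesis unfolding N_def using N_mult[of m n i j] normi[of n i] by blast
    qed
    show "inv x \<in> N" if "x \<in> N" for x
    proof -
      have xc: "x \<in> carrier G" using that a unfolding N_def by auto
      have pow: "x [^] i \<in> N" for i :: nat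
      proof (induction i)
        case 0
        show ?case unfolding N_def by (auto intro!: exI[of _ \<one>] exI[of _ "0::nat"])
      qed (simp add: mult that)
      have "x [^] (order G) = \<one>" "order G > 0" using pow_order_eq_1[OF xc] finG by (auto simp: order_gt_0_iff_finite)
      then have "x [^] (order G - 1) \<otimes> x = \<one>" using xc by (metis Suc_pred' nat_pow_Suc)
      then have "inv x = x [^] (order G - 1)" using xc by (metis inv_equality nat_pow_closed)
      then show ?thesis using pow by simp
    qed
  qed
  moreover have "M \<subseteq> N"
  proof
    fix m assume "m \<in> M"
    then show "m \<in> N" unfolding N_def by (auto intro!: exI[of _ m] exI[of _ "0::nat"])
  qed
  moreover have "a \<in> N" unfolding N_def using a by (auto intro!: exI[of _ \<one>] exI[of _ "1::nat"])
  ultimately have N: "N = carrier G" using M(2)[of N] a(2) MG(3) unfolding \<M>_def by blast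
  define \<xi> where "\<xi> = (\<lambda>x. int ((SOME i. \<exists>m\<in>M. x = m \<otimes> a [^] (i::nat)) mod p))"
  have cong_le: "[i = j] (mod p)" if eq: "m \<otimes> a [^] i = n \<otimes> a [^] j" "m \<in> M" "n \<in> M" "i \<le> j" for m n and i j :: nat
  proof -
    have "n \<otimes> a [^] j = (n \<otimes> a [^] (j - i)) \<otimes> a [^] i"
      using that a(1) by (simp add: m_assoc nat_pow_mult)
    then have "m = n \<otimes> a [^] (j - i)" using eq a(1) by (metis M.mem_carrier m_closed nat_pow_closed right_cancel)
    then have "a [^] (j - i) = inv n \<otimes> m" using eq a(1) by (simp add: inv_solve_left m_assoc[symmetric])
    then have "p dvd j - i" using pow_M eq by auto
    then show ?thesis using \<open>i \<le> j\<close> by (metis cong_def mod_eq_dvd_iff_nat)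
  qed
  have \<xi>: "\<xi> (m \<otimes> a [^] i) = int (i mod p)" if "m \<in> M" for m and i :: nat
  proof -
    define j where "j = (SOME j. \<exists>n\<in>M. m \<otimes> a [^] i = n \<otimes> a [^] (j::nat))"
    have "\<exists>n\<in>M. m \<otimes> a [^] i = n \<otimes> a [^] j"
      unfolding j_def by (rule someI[of _ i]) (use that in blast)
    then obtain n where "n \<in> M" "m \<otimes> a [^] i = n \<otimes> a [^] j" by blast
    then have "[i = j] (mod p)"
      using cong_le[of m i n j] cong_le[of n j m i] that by (metis cong_sym nle_le)
    then show ?thesis unfolding \<xi>_def j_def[symmetric] by (simp add: cong_def)
  qed
  show ?thesis
  proof
    show "\<xi> \<in> hom G (integer_mod_group p)"
    proof (rule homI)
      fix x assume "x \<in> carrier G"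
      then obtain m i where "x = m \<otimes> a [^] (i::nat)" "m \<in> M" unfolding N[symmetric] N_def by blast
      then show "\<xi> x \<in> carrier (integer_mod_group p)"
        using p by (auto simp: \<xi> carrier_integer_mod_group prime_gt_0_nat)
    next
      fix x y assume "x \<in> carrier G" "y \<in> carrier G"
      then obtain m i n j where "x = m \<otimes> a [^] (i::nat)" "m \<in> M" "y = n \<otimes> a [^] (j::nat)" "n \<in> M"
        unfolding N[symmetric] N_def by blast
      then show "\<xi> (x \<otimes> y) = \<xi> x \<otimes>\<^bsub>integer_mod_group p\<^esub> \<xi> y"
        using normi[of n i] by (simp add: \<xi> N_mult zmod_int mod_add_eq)
    qed
    show "\<xi> q = 0" if "q \<in> Q" for q
      using \<xi>[of q 0] that MG(3) by auto
    show "a \<in> carrier G" by (rule a)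
    show "\<xi> a \<noteq> 0" using \<xi>[of \<one> 1] a prime_gt_1_nat[OF p] by simp
  qed
qed

section \<open>Open subgroups and characters of pro-p groups\<close>

text \<open>Continuity into P as a discrete group, expressed through the kernel so that P carries no
  topology.\<close>

definition open_homs :: "('a, 'c) monoid_scheme \<Rightarrow> 'a topology \<Rightarrow> ('b, 'd) monoid_scheme \<Rightarrow> ('a \<Rightarrow> 'b) set"
  where "open_homs G T P = {\<rho> \<in> hom G P. openin T (kernel G P \<rho>)}"

lemma open_homsD:
  assumes "\<rho> \<in> open_homs G T P"
  shows "\<rho> \<in> hom G P" "openin T (kernel G P \<rho>)"
  using assms by (auto simp: open_homs_def)

context topological_group
begin

lemma continuous_map_left_translation:
  assumes "a \<in> carrier G" shows "continuous_map T T (\<lambda>x. a \<otimes> x)"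
proof -
  have "continuous_map T (prod_topology T T) (\<lambda>x. (a, x))"
    using assms by (simp add: continuous_map_pairwise o_def topspace_eq)
  from continuous_map_compose[OF this continuous_mult] show ?thesis by (simp add: o_def)
qed

lemma continuous_map_right_translation:
  assumes "a \<in> carrier G" shows "continuous_map T T (\<lambda>x. x \<otimes> a)"
proof -
  have "continuous_map T (prod_topology T T) (\<lambda>x. (x, a))"
    using assms by (simp add: continuous_map_pairwise o_def topspace_eq)
  from continuous_map_compose[OF this continuous_mult] show ?thesis by (simp add: o_def)
qed

lemma openin_left_translation:
  assumes "openin T U" "a \<in> carrier G" shows "openin T {x \<in> carrier G. a \<otimes> x \<in> U}"
  using openin_continuous_map_preimage[OF continuous_map_left_translation assms(1)] assms(2)
  by (simp add: topspace_eq)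

lemma openin_right_translation:
  assumes "openin T U" "a \<in> carrier G" shows "openin T {x \<in> carrier G. x \<otimes> a \<in> U}"
  using openin_continuous_map_preimage[OF continuous_map_right_translation assms(1)] assms(2)
  by (simp add: topspace_eq)

lemma openin_conjugate:
  assumes "openin T U" "a \<in> carrier G"
  shows "openin T {x \<in> carrier G. a \<otimes> x \<otimes> inv a \<in> U}"
proof -
  have "{x \<in> carrier G. a \<otimes> x \<in> {y \<in> carrier G. y \<otimes> inv a \<in> U}} = {x \<in> carrier G. a \<otimes> x \<otimes> inv a \<in> U}"
    using assms by auto
  then show ?thesis
    using openin_left_translation[OF openin_right_translation[OF assms(1)] assms(2), of "inv a"] assms(2)
    by simp
qed

text \<open>Each a in A has the open neighbourhood a K inside A.\<close>

lemma openin_invariant: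
  assumes K: "openin T K" "\<one> \<in> K" and A: "A \<subseteq> carrier G"
    and inv: "\<And>a k. a \<in> A \<Longrightarrow> k \<in> K \<Longrightarrow> a \<otimes> k \<in> A"
  shows "openin T A"
proof (subst openin_subopen, intro ballI)
  fix a assume a: "a \<in> A"
  then have ac: "a \<in> carrier G" using A by auto
  define U where "U = {x \<in> carrier G. inv a \<otimes> x \<in> K}"
  have "openin T U" unfolding U_def by (rule openin_left_translation) (use K ac in auto)
  moreover have "a \<in> U" unfolding U_def using ac K by simp
  moreover have "U \<subseteq> A"
  proof
    fix x assume x: "x \<in> U"
    then have "a \<otimes> (inv a \<otimes> x) \<in> A" using inv[OF a, of "inv a \<otimes> x"] by (simp add: U_def)
    then show "x \<in> A" using x ac by (simp add: U_def m_assoc[symmetric])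
  qed
  ultimately show "\<exists>U. openin T U \<and> a \<in> U \<and> U \<subseteq> A" by blast
qed

lemma open_subgroup_closed:
  assumes "subgroup H G" "openin T H" shows "closedin T H"
proof -
  interpret H: subgroup H G by fact
  have "openin T (carrier G - H)"
  proof (rule openin_invariant[OF assms(2)])
    fix a k assume "a \<in> carrier G - H" "k \<in> H"
    then show "a \<otimes> k \<in> carrier G - H"
      by (metis Diff_iff H.m_closed H.m_inv_closed H.mem_carrier inv_closed m_closed r_inv r_one m_assoc)
  qed auto
  then show ?thesis using H.subset by (simp add: closedin_def topspace_eq)
qed

lemma openin_r_coset:
  assumes "openin T U" "U \<subseteq> carrier G" "a \<in> carrier G" shows "openin T (U #> a)"
proof -
  have "U #> a = {x \<in> carrier G. x \<otimes> inv a \<in> U}"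
  proof
    show "U #> a \<subseteq> {x \<in> carrier G. x \<otimes> inv a \<in> U}"
      using assms by (auto simp: r_coset_def m_assoc)
    show "{x \<in> carrier G. x \<otimes> inv a \<in> U} \<subseteq> U #> a"
    proof
      fix x assume "x \<in> {x \<in> carrier G. x \<otimes> inv a \<in> U}"
      then have "x = (x \<otimes> inv a) \<otimes> a" "x \<otimes> inv a \<in> U" using assms by (auto simp: m_assoc)
      then show "x \<in> U #> a" unfolding r_coset_def by blast
    qed
  qed
  then show ?thesis using openin_right_translation[OF assms(1), of "inv a"] assms(3) by simp
qed

text \<open>The cosets form an open cover; being disjoint and nonempty, they admit no proper
  subcover.\<close>

lemma finite_rcosets:
  assumes "compact_space T" "subgroup U G" "openin T U"
  shows "finite (rcosets U)"
proof -
  interpret U: subgroup U G by fact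
  have "\<forall>C\<in>rcosets U. openin T C"
    unfolding RCOSETS_def using openin_r_coset[OF assms(3) U.subset] by auto
  moreover have "topspace T \<subseteq> \<Union>(rcosets U)"
    using rcosets_part_G[OF assms(2)] by (simp add: topspace_eq)
  ultimately obtain F where F: "finite F" "F \<subseteq> rcosets U" "carrier G \<subseteq> \<Union>F"
    using assms(1) unfolding compact_space_alt topspace_eq by meson
  have "rcosets U \<subseteq> F"
  proof
    fix C assume C: "C \<in> rcosets U"
    then obtain x where x: "x \<in> C" using U.rcosets_non_empty by blast
    then have "x \<in> carrier G" using C U.rcosets_carrier[OF is_group] by blast
    then obtain D where D: "D \<in> F" "x \<in> D" using F(3) by auto
    then have "C = D" using rcos_disjoint[OF assms(2)] C x F(2) by (auto simp: pairwise_def disjnt_def)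
    then show "C \<in> F" using D by simp
  qed
  then show ?thesis using F(1) finite_subset by blast
qed

text \<open>The witness is the intersection of all conjugates of U. The conjugate \<open>K a\<close>
  depends only on the coset U a, so finiteness of the index leaves finitely many conjugates and the
  intersection is open.\<close>

lemma open_normal_core:
  assumes "compact_space T" "subgroup U G" "openin T U"
  obtains N where "N \<lhd> G" "openin T N" "N \<subseteq> U"
proof -
  interpret U: subgroup U G by fact
  define K where "K = (\<lambda>a. {x \<in> carrier G. a \<otimes> x \<otimes> inv a \<in> U})"
  define N where "N = (\<Inter>a\<in>carrier G. K a)"
  have KU: "K (u \<otimes> a) = K a" if "u \<in> U" "a \<in> carrier G" for u a
  proof -
    have "u \<otimes> a \<otimes> x \<otimes> inv (u \<otimes> a) \<in> U \<longleftrightarrow> a \<otimes> x \<otimes> inv a \<in> U" if x: "x \<in> carrier G" for x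
    proof -
      have uc: "u \<in> carrier G" using \<open>u \<in> U\<close> by simp
      have e: "u \<otimes> a \<otimes> x \<otimes> inv (u \<otimes> a) = u \<otimes> (a \<otimes> x \<otimes> inv a) \<otimes> inv u"
        using that uc \<open>a \<in> carrier G\<close> by (simp add: inv_mult_group m_assoc)
      have e2: "a \<otimes> x \<otimes> inv a = inv u \<otimes> (u \<otimes> (a \<otimes> x \<otimes> inv a) \<otimes> inv u) \<otimes> u"
        using that uc \<open>a \<in> carrier G\<close> by (simp add: m_assoc[symmetric]) (simp add: m_assoc)
      show ?thesis using e e2 \<open>u \<in> U\<close> by (metis U.m_closed U.m_inv_closed)
    qed
    then show ?thesis unfolding K_def by blast
  qed
  have "\<exists>R. finite R \<and> R \<subseteq> carrier G \<and> R \<noteq> {} \<and> (\<forall>a\<in>carrier G. \<exists>r\<in>R. \<exists>u\<in>U. a = u \<otimes> r)"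
  proof -
    define R where "R = (\<lambda>C. SOME x. x \<in> C) ` (rcosets U)"
    have fin: "finite R" unfolding R_def using finite_rcosets[OF assms] by simp
    have some: "(SOME x. x \<in> C) \<in> C" if "C \<in> rcosets U" for C
      using U.rcosets_non_empty[OF that] by (simp add: some_in_eq)
    have "R \<subseteq> carrier G" using some U.rcosets_carrier[OF is_group] unfolding R_def by blast
    moreover have "\<exists>r\<in>R. \<exists>u\<in>U. a = u \<otimes> r" if a: "a \<in> carrier G" for a
    proof -
      have C: "U #> a \<in> rcosets U" by (rule rcosetsI) (use a U.subset in auto)
      define r where "r = (SOME x. x \<in> U #> a)"
      have "r \<in> R" "r \<in> U #> a" using some[OF C] C unfolding R_def r_def by auto
      then obtain u where "u \<in> U" "r = u \<otimes> a" unfolding r_coset_def by auto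
      then have "a = inv u \<otimes> r" "inv u \<in> U" using a by (auto simp: m_assoc[symmetric])
      then show ?thesis using \<open>r \<in> R\<close> by blast
    qed
    ultimately show ?thesis using fin one_closed by (intro exI[of _ R]) fastforce
  qed
  then obtain R where R: "finite R" "R \<subseteq> carrier G" "R \<noteq> {}"
    "\<And>a. a \<in> carrier G \<Longrightarrow> \<exists>r\<in>R. \<exists>u\<in>U. a = u \<otimes> r" by blast
  have "N = (\<Inter>a\<in>R. K a)"
  proof
    show "N \<subseteq> (\<Inter>a\<in>R. K a)" unfolding N_def using R(2) by blast
    show "(\<Inter>a\<in>R. K a) \<subseteq> N" unfolding N_def using R(2,4) KU by (smt (verit) INT_I INT_E subset_iff)
  qed
  moreover have "openin T (\<Inter>a\<in>R. K a)"
    by (rule openin_INT2) (use R openin_conjugate[OF assms(3)] in \<open>auto simp: K_def\<close>)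
  ultimately have "openin T N" by simp
  moreover have "N \<subseteq> U"
  proof
    fix x assume "x \<in> N"
    then have "x \<in> K \<one>" unfolding N_def by blast
    then show "x \<in> U" unfolding K_def by (metis (no_types, lifting) CollectD inv_one l_one r_one)
  qed
  moreover have "N \<lhd> G"
  proof (rule normal_invI)
    show "subgroup N G"
    proof (rule subgroupI)
      show "N \<subseteq> carrier G" unfolding N_def K_def by blast
      show "N \<noteq> {}" unfolding N_def K_def by (auto intro!: exI[of _ \<one>])
      show "inv x \<in> N" if "x \<in> N" for x
      proof -
        have "a \<otimes> inv x \<otimes> inv a = inv (a \<otimes> x \<otimes> inv a)" if "a \<in> carrier G" for a
          using that \<open>x \<in> N\<close> unfolding N_def K_def by (simp add: inv_mult_group m_assoc)
        then show ?thesis using that unfolding N_def K_def by auto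
      qed
      show "x \<otimes> y \<in> N" if "x \<in> N" "y \<in> N" for x y
      proof -
        have "a \<otimes> (x \<otimes> y) \<otimes> inv a = (a \<otimes> x \<otimes> inv a) \<otimes> (a \<otimes> y \<otimes> inv a)" if a: "a \<in> carrier G" for a
        proof -
          have c: "x \<in> carrier G" "y \<in> carrier G" using \<open>x \<in> N\<close> \<open>y \<in> N\<close> unfolding N_def K_def by auto
          have "inv a \<otimes> (a \<otimes> z) = z" if "z \<in> carrier G" for z
            using that a by (simp add: m_assoc[symmetric])
          then show ?thesis using a c by (simp add: m_assoc)
        qed
        then show ?thesis using that unfolding N_def K_def by auto
      qed
    qed
    show "g \<otimes> h \<otimes> inv g \<in> N" if g: "g \<in> carrier G" and h: "h \<in> N" for g h
    proof -
      have hc: "h \<in> carrier G" using h unfolding N_def K_def by auto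
      have "a \<otimes> (g \<otimes> h \<otimes> inv g) \<otimes> inv a \<in> U" if a: "a \<in> carrier G" for a
      proof -
        have "a \<otimes> (g \<otimes> h \<otimes> inv g) \<otimes> inv a = (a \<otimes> g) \<otimes> h \<otimes> inv (a \<otimes> g)"
          using a g hc by (simp add: inv_mult_group m_assoc)
        then show ?thesis using h a g unfolding N_def K_def by auto
      qed
      then show ?thesis using g hc unfolding N_def K_def by auto
    qed
  qed
  ultimately show ?thesis using that by blast
qed

lemma open_hom_openin:
  assumes \<rho>: "\<rho> \<in> open_homs G T P" and P: "group P"
  shows "openin T {x \<in> carrier G. \<rho> x \<in> A}"
proof -
  interpret group_hom G P \<rho> using open_homsD[OF \<rho>] P by (simp add: group_hom_def group_hom_axioms_def)
  show ?thesis
    by (rule openin_invariant[OF open_homsD(2)[OF \<rho>]]) (auto simp: kernel_def)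
qed

lemma open_hom_continuous:
  assumes \<rho>: "\<rho> \<in> open_homs G T P" and P: "group P"
  shows "continuous_map T (discrete_topology (carrier P)) \<rho>"
  using open_hom_openin[OF \<rho> P] open_homsD(1)[OF \<rho>]
  by (auto simp: continuous_map_def topspace_eq hom_def)

lemma open_homs_compose:
  assumes "\<rho> \<in> open_homs G T P" "f \<in> hom P Q" "group P" "group Q"
  shows "f \<circ> \<rho> \<in> open_homs G T Q"
proof -
  have "kernel G Q (f \<circ> \<rho>) = {x \<in> carrier G. \<rho> x \<in> {y. f y = \<one>\<^bsub>Q\<^esub>}}" by (auto simp: kernel_def)
  then have "openin T (kernel G Q (f \<circ> \<rho>))" using open_hom_openin[OF assms(1,3)] by metis
  then show ?thesis
    using assms(2) open_homsD(1)[OF assms(1)] by (auto simp: open_homs_def hom_def Pi_def)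
qed

lemma open_hom_closed_equalizer:
  assumes \<rho>: "\<rho> \<in> open_homs G T P" and \<sigma>: "\<sigma> \<in> open_homs G T P" and P: "group P"
  shows "subgroup {x \<in> carrier G. \<rho> x = \<sigma> x} G" "closedin T {x \<in> carrier G. \<rho> x = \<sigma> x}"
proof -
  interpret \<rho>: group_hom G P \<rho> using open_homsD[OF \<rho>] P by (simp add: group_hom_def group_hom_axioms_def)
  interpret \<sigma>: group_hom G P \<sigma> using open_homsD[OF \<sigma>] P by (simp add: group_hom_def group_hom_axioms_def)
  show sub: "subgroup {x \<in> carrier G. \<rho> x = \<sigma> x} G"
    by (rule subgroupI) (auto intro!: exI[of _ \<one>])
  have "openin T {x \<in> carrier G. \<rho> x = \<sigma> x}"
  proof (rule openin_invariant[of "kernel G P \<rho> \<inter> kernel G P \<sigma>"])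
    show "openin T (kernel G P \<rho> \<inter> kernel G P \<sigma>)"
      using open_homsD(2)[OF \<rho>] open_homsD(2)[OF \<sigma>] by blast
  qed (auto simp: kernel_def)
  then show "closedin T {x \<in> carrier G. \<rho> x = \<sigma> x}" using open_subgroup_closed sub by blast
qed

lemma closure_of_subgroup:
  assumes "subgroup S G" shows "subgroup (T closure_of S) G"
proof -
  interpret S: subgroup S G by fact
  have sub: "S \<subseteq> T closure_of S" using closure_of_subset[of S T] S.subset by (simp add: topspace_eq)
  show ?thesis
  proof (rule subgroupI)
    show "T closure_of S \<subseteq> carrier G" using closure_of_subset_topspace[of T S] by (simp add: topspace_eq)
    show "T closure_of S \<noteq> {}" using sub S.one_closed by blast
    show "inv x \<in> T closure_of S" if "x \<in> T closure_of S" for x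
    proof -
      have "inv x \<in> T closure_of ((\<lambda>x. inv x) ` S)"
        using continuous_map_image_closure_subset[OF continuous_inv, of S] that by blast
      moreover have "(\<lambda>x. inv x) ` S \<subseteq> S" by auto
      ultimately show ?thesis using closure_of_mono by blast
    qed
    show "x \<otimes> y \<in> T closure_of S" if "x \<in> T closure_of S" "y \<in> T closure_of S" for x y
    proof -
      have "x \<otimes> y \<in> T closure_of ((\<lambda>(a, b). a \<otimes> b) ` (S \<times> S))"
        using continuous_map_image_closure_subset[OF continuous_mult, of "S \<times> S"] that
        by (auto simp: closure_of_Times)
      moreover have "(\<lambda>(a, b). a \<otimes> b) ` (S \<times> S) \<subseteq> S" by auto
      ultimately show ?thesis using closure_of_mono by blast
    qed
  qed
qed

text \<open>The equalizer is a closed subgroup containing X, hence everything.\<close>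

lemma topologically_generates_eqI:
  assumes X: "topologically_generates G T X" and P: "group P"
    and \<rho>: "\<rho> \<in> open_homs G T P" and \<sigma>: "\<sigma> \<in> open_homs G T P"
    and eq: "\<And>x. x \<in> X \<Longrightarrow> \<rho> x = \<sigma> x" and g: "g \<in> carrier G"
  shows "\<rho> g = \<sigma> g"
proof -
  let ?E = "{x \<in> carrier G. \<rho> x = \<sigma> x}"
  have "generate G X \<subseteq> ?E"
    by (rule generate_subgroup_incl[OF _ open_hom_closed_equalizer(1)[OF \<rho> \<sigma> P]])
      (use X eq in \<open>auto simp: topologically_generates_def\<close>)
  then have "T closure_of (generate G X) \<subseteq> ?E"
    using open_hom_closed_equalizer(2)[OF \<rho> \<sigma> P] by (rule closure_of_minimal)
  then show ?thesis using g X by (auto simp: topologically_generates_def)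
qed

end


text \<open>Since N contains the kernel, its cosets correspond to the cosets of its image in the
  image of H. This carries the condition on indices from the finite quotients of a pro-p group to
  its closed subgroups.\<close>

lemma index_dvd_order:
  assumes \<pi>: "group_hom H P \<pi>" and N: "subgroup N H" and ker: "kernel H P \<pi> \<subseteq> N"
  shows "card (rcosets\<^bsub>H\<^esub> N) dvd order P"
proof -
  interpret \<pi>: group_hom H P \<pi> by (rule \<pi>)
  interpret N: subgroup N H by (rule N)
  define I where "I = \<pi> ` carrier H"
  let ?P = "P\<lparr>carrier := I\<rparr>"
  have I: "subgroup I P" unfolding I_def by (rule \<pi>.img_is_subgroup)
  interpret I: group ?P by (rule \<pi>.H.subgroup_imp_group[OF I])
  have N': "subgroup (\<pi> ` N) ?P"
    by (rule \<pi>.H.subgroup_incl[OF \<pi>.subgroup_img_is_subgroup[OF N] I]) (auto simp: I_def)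
  have coset: "\<pi> ` (N #>\<^bsub>H\<^esub> a) = \<pi> ` N #>\<^bsub>?P\<^esub> \<pi> a" if "a \<in> carrier H" for a
    using that by (force simp: r_coset_def)
  have "bij_betw (\<lambda>C. \<pi> ` C) (rcosets\<^bsub>H\<^esub> N) (rcosets\<^bsub>?P\<^esub> (\<pi> ` N))"
    unfolding bij_betw_def
  proof
    show "inj_on (\<lambda>C. \<pi> ` C) (rcosets\<^bsub>H\<^esub> N)"
    proof (rule inj_onI)
      fix C D assume CD: "C \<in> rcosets\<^bsub>H\<^esub> N" "D \<in> rcosets\<^bsub>H\<^esub> N" "\<pi> ` C = \<pi> ` D"
      then obtain a b where ab: "a \<in> carrier H" "b \<in> carrier H" "C = N #>\<^bsub>H\<^esub> a" "D = N #>\<^bsub>H\<^esub> b"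
        unfolding RCOSETS_def by auto
      have "\<pi> a \<in> \<pi> ` D" using ab \<pi>.G.rcos_self[OF ab(1) N] CD(3) by blast
      then obtain d where d: "d \<in> D" "\<pi> a = \<pi> d" by blast
      then obtain n where n: "n \<in> N" "\<pi> a = \<pi> (n \<otimes>\<^bsub>H\<^esub> b)" using ab by (auto simp: r_coset_def)
      then have "a \<otimes>\<^bsub>H\<^esub> inv\<^bsub>H\<^esub> (n \<otimes>\<^bsub>H\<^esub> b) \<in> N" using ab ker by (auto simp: kernel_def)
      then have "a \<otimes>\<^bsub>H\<^esub> inv\<^bsub>H\<^esub> (n \<otimes>\<^bsub>H\<^esub> b) \<otimes>\<^bsub>H\<^esub> n \<in> N" using n by simp
      then have "a \<otimes>\<^bsub>H\<^esub> inv\<^bsub>H\<^esub> b \<in> N" using ab n by (simp add: \<pi>.G.inv_mult_group \<pi>.G.m_assoc)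
      then have "(a \<otimes>\<^bsub>H\<^esub> inv\<^bsub>H\<^esub> b) \<otimes>\<^bsub>H\<^esub> b \<in> D" using ab by (auto simp: r_coset_def)
      then have "a \<in> D" using ab by (simp add: \<pi>.G.m_assoc)
      then show "C = D" using \<pi>.G.repr_independence[of a N b] N ab by simp
    qed
    show "(\<lambda>C. \<pi> ` C) ` (rcosets\<^bsub>H\<^esub> N) = rcosets\<^bsub>?P\<^esub> (\<pi> ` N)"
      unfolding RCOSETS_def using coset by (auto simp: I_def)
  qed
  then have "card (rcosets\<^bsub>H\<^esub> N) = card (rcosets\<^bsub>?P\<^esub> (\<pi> ` N))" by (rule bij_betw_same_card)
  also have "\<dots> dvd order ?P" using I.lagrange[OF N'] by (metis dvd_triv_left)
  also have "\<dots> dvd order P" using \<pi>.H.lagrange[OF I] by (simp add: order_def) (metis dvd_triv_right)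
  finally show ?thesis .
qed

section \<open>Pro-p groups: closed subgroups, characters to Z/p and primitivity\<close>

context pro_p_group
begin

text \<open>The continuous dual of the Frattini quotient, a vector space over F_p; the values on
  \<open>carrier G\<close> are residues in \<open>{0..<p}\<close>.\<close>

abbreviation chars where "chars \<equiv> open_homs G T (integer_mod_group p)"

lemma open_normal_quotient:
  assumes N: "N \<lhd> G" "openin T N"
  shows "group (G Mod N)" "\<exists>k. order (G Mod N) = p ^ k"
    "(\<lambda>x. N #> x) \<in> open_homs G T (G Mod N)" "kernel G (G Mod N) (\<lambda>x. N #> x) = N"
proof -
  interpret N: normal N G by (rule N)
  show "group (G Mod N)" by (rule N.factorgroup_is_group)
  show "\<exists>k. order (G Mod N) = p ^ k"
    using index_power[OF N] by (simp add: order_def FactGroup_def)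
  show ker: "kernel G (G Mod N) (\<lambda>x. N #> x) = N"
    unfolding kernel_def using coset_join1[OF _ _ N.is_subgroup] coset_join2[OF _ N.is_subgroup] N.subset
    by auto
  show "(\<lambda>x. N #> x) \<in> open_homs G T (G Mod N)"
    unfolding open_homs_def using ker N(2) N.r_coset_hom_Mod by simp
qed

text \<open>The x with x g outside K form a neighbourhood of one; if it contains N, then N g misses
  K.\<close>

lemma separate_closed_subgroup:
  assumes K: "subgroup K G" "closedin T K" and g: "g \<in> carrier G" "g \<notin> K"
  obtains N where "N \<lhd> G" "openin T N" "N #> g \<notin> (\<lambda>x. N #> x) ` K"
proof -
  interpret K: subgroup K G by (rule K)
  define U where "U = {x \<in> carrier G. x \<otimes> g \<in> carrier G - K}"
  have "openin T U" unfolding U_def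
    by (rule openin_right_translation) (use K g in \<open>auto simp: closedin_def topspace_eq\<close>)
  moreover have "\<one> \<in> U" unfolding U_def using g by simp
  ultimately obtain V where "subgroup V G" "openin T V" "V \<subseteq> U" using open_subgroup_base by blast
  then obtain N where N: "N \<lhd> G" "openin T N" "N \<subseteq> U" using open_normal_core[OF compact] by (metis subset_trans)
  interpret N: normal N G by (rule N)
  have "N #> g \<noteq> N #> x" if "x \<in> K" for x
  proof
    assume "N #> g = N #> x"
    then have "x \<in> N #> g" using rcos_self[OF _ N.is_subgroup, of x] that by simp
    then obtain n where n: "n \<in> N" "x = n \<otimes> g" unfolding r_coset_def by auto
    then have "n \<in> U" using N by auto
    then show False unfolding U_def using n that by simp
  qed
  then show ?thesis using N that by blast
qed

text \<open>Once N separates some g from K, the image of K in the finite p-group G/N is still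
  proper, and a character that kills this image is pulled back to G.\<close>

lemma proper_closed_subgroup_char:
  assumes K: "subgroup K G" "closedin T K" "K \<noteq> carrier G"
  obtains \<xi> a where "\<xi> \<in> chars" "\<And>x. x \<in> K \<Longrightarrow> \<xi> x = 0" "a \<in> carrier G" "\<xi> a \<noteq> 0"
proof -
  interpret K: subgroup K G by (rule K)
  obtain g where g: "g \<in> carrier G" "g \<notin> K" using K(3) K.subset by blast
  obtain N where N: "N \<lhd> G" "openin T N" "N #> g \<notin> (\<lambda>x. N #> x) ` K"
    using separate_closed_subgroup[OF K(1,2) g] by blast
  note Q = open_normal_quotient[OF N(1,2)]
  interpret Q: group "G Mod N" by (rule Q)
  interpret \<pi>: group_hom G "G Mod N" "\<lambda>x. N #> x"
    using open_homsD(1)[OF Q(3)] by unfold_locales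
  obtain k where k: "order (G Mod N) = p ^ k" using Q(2) by blast
  define L where "L = (\<lambda>x. N #> x) ` K"
  have "subgroup L (G Mod N)" unfolding L_def by (rule \<pi>.subgroup_img_is_subgroup[OF K(1)])
  moreover have "L \<noteq> carrier (G Mod N)" using N(3) \<pi>.hom_closed[OF g(1)] unfolding L_def by blast
  ultimately obtain \<xi> a where \<xi>: "\<xi> \<in> hom (G Mod N) (integer_mod_group p)"
    "\<And>q. q \<in> L \<Longrightarrow> \<xi> q = 0" "a \<in> carrier (G Mod N)" "\<xi> a \<noteq> 0"
    using Q.p_group_proper_subgroup_character[OF prime_p k] by blast
  obtain b where b: "b \<in> carrier G" "a = N #> b" using \<xi>(3) by (auto simp: carrier_FactGroup)
  show ?thesis
  proof
    show "\<xi> \<circ> (\<lambda>x. N #> x) \<in> chars" by (rule open_homs_compose[OF Q(3) \<xi>(1) Q(1)]) simp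
    show "(\<xi> \<circ> (\<lambda>x. N #> x)) x = 0" if "x \<in> K" for x using \<xi>(2) that by (simp add: L_def)
    show "b \<in> carrier G" by fact
    show "(\<xi> \<circ> (\<lambda>x. N #> x)) b \<noteq> 0" using \<xi>(4) b by simp
  qed
qed

text \<open>For the indices, an open subgroup N of H contains the kernel of H -> G/M for some open
  normal M of G, so its index divides the order of G/M.\<close>

lemma closed_subgroup_pro_p:
  assumes H: "subgroup H G" "closedin T H"
  shows "pro_p_group p (G\<lparr>carrier := H\<rparr>) (subtopology T H)"
proof -
  interpret H: subgroup H G by (rule H)
  let ?H = "G\<lparr>carrier := H\<rparr>" and ?T = "subtopology T H"
  interpret HG: group ?H by (rule subgroup_imp_group[OF H(1)])
  have inv_eq: "m_inv ?H x = inv x" if "x \<in> H" for x using m_inv_consistent[OF H(1) that] .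
  interpret HT: topological_group ?H ?T
  proof
    show "topspace ?T = carrier ?H" using H.subset by (auto simp: topspace_eq)
    have "continuous_map (prod_topology ?T ?T) T (\<lambda>(a, b). a \<otimes> b)"
      unfolding subtopology_Times[symmetric] by (rule continuous_map_from_subtopology[OF continuous_mult])
    then show "continuous_map (prod_topology ?T ?T) ?T (\<lambda>(a, b). a \<otimes>\<^bsub>?H\<^esub> b)"
      by (auto simp: continuous_map_in_subtopology)
    have "continuous_map ?T T (m_inv G)" by (rule continuous_map_from_subtopology[OF continuous_inv])
    then have "continuous_map ?T ?T (m_inv G)"
      by (auto simp: continuous_map_in_subtopology)
    then show "continuous_map ?T ?T (m_inv ?H)"
      by (rule continuous_map_eq) (auto simp: inv_eq)
  qed
  show ?thesis
  proof
    show "prime p" by (rule prime_p)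
    show "compact_space ?T"
      using closedin_compact_space[OF compact H(2)] by (rule compact_space_subtopology)
    show "Hausdorff_space ?T" by (rule Hausdorff_space_subtopology[OF Hausdorff])
    have base: "\<exists>V. subgroup V G \<and> openin T V \<and> V \<inter> H \<subseteq> U" if U: "openin ?T U" "\<one>\<^bsub>?H\<^esub> \<in> U" for U
    proof -
      obtain W where "openin T W" "U = W \<inter> H" using U(1) by (auto simp: openin_subtopology)
      then show ?thesis using open_subgroup_base[of W] U(2) by auto
    qed
    show "\<exists>K. subgroup K ?H \<and> openin ?T K \<and> K \<subseteq> U" if U: "openin ?T U" "\<one>\<^bsub>?H\<^esub> \<in> U" for U
    proof -
      obtain V where V: "subgroup V G" "openin T V" "V \<inter> H \<subseteq> U" using base[OF U] by blast
      have "subgroup (V \<inter> H) ?H"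
        by (rule subgroup_incl[OF subgroups_Inter_pair[OF V(1) H(1)] H(1)]) auto
      moreover have "openin ?T (V \<inter> H)" using V(2) by (auto simp: openin_subtopology)
      ultimately show ?thesis using V(3) by blast
    qed
    show "\<exists>k. card (rcosets\<^bsub>?H\<^esub> N) = p ^ k" if N: "N \<lhd> ?H" "openin ?T N" for N
    proof -
      interpret N: normal N ?H by (rule N)
      obtain V where V: "subgroup V G" "openin T V" "V \<inter> H \<subseteq> N" using base[OF N(2)] N.one_closed by auto
      obtain M where M: "M \<lhd> G" "openin T M" "M \<subseteq> V" using open_normal_core[OF compact V(1,2)] by blast
      note Q = open_normal_quotient[OF M(1,2)]
      have "group_hom ?H (G Mod M) (\<lambda>x. M #> x)"
        using Q(1) open_homsD(1)[OF Q(3)] HG.is_group H.subset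
        by (auto simp: group_hom_def group_hom_axioms_def hom_def Pi_def)
      moreover have "kernel ?H (G Mod M) (\<lambda>x. M #> x) \<subseteq> N"
        using Q(4) M(3) V(3) H.subset by (auto simp: kernel_def)
      ultimately have "card (rcosets\<^bsub>?H\<^esub> N) dvd order (G Mod M)"
        using index_dvd_order N.subgroup_axioms by blast
      then show ?thesis using Q(2) prime_p divides_primepow_nat by metis
    qed
  qed
qed

text \<open>The Burnside basis theorem in dual form: a closed subgroup is proper only if a nonzero
  character kills it.\<close>

lemma topologically_generates_iff:
  assumes "X \<subseteq> carrier G"
  shows "topologically_generates G T X \<longleftrightarrow>
    (\<forall>\<xi>\<in>chars. (\<forall>x\<in>X. \<xi> x = 0) \<longrightarrow> (\<forall>g\<in>carrier G. \<xi> g = 0))"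
proof
  assume X: "topologically_generates G T X"
  have triv: "(\<lambda>_. 0) \<in> chars"
    using prime_gt_0_nat[OF prime_p] openin_topspace[of T]
    by (auto simp: open_homs_def hom_def kernel_def carrier_integer_mod_group topspace_eq)
  show "\<forall>\<xi>\<in>chars. (\<forall>x\<in>X. \<xi> x = 0) \<longrightarrow> (\<forall>g\<in>carrier G. \<xi> g = 0)"
    using topologically_generates_eqI[OF X group_integer_mod_group _ triv] by blast
next
  assume *: "\<forall>\<xi>\<in>chars. (\<forall>x\<in>X. \<xi> x = 0) \<longrightarrow> (\<forall>g\<in>carrier G. \<xi> g = 0)"
  let ?K = "T closure_of (generate G X)"
  have gen: "subgroup (generate G X) G" by (rule generate_is_subgroup[OF assms])
  have "X \<subseteq> generate G X" by (auto intro: generate.incl)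
  also have "\<dots> \<subseteq> ?K"
    using closure_of_subset[of "generate G X" T] subgroup.subset[OF gen] by (simp add: topspace_eq)
  finally have "X \<subseteq> ?K" .
  then have "?K = carrier G"
    using proper_closed_subgroup_char[OF closure_of_subgroup[OF gen] closedin_closure_of] * by (metis subsetD)
  then show "topologically_generates G T X" using assms by (simp add: topologically_generates_def)
qed

lemma not_primitive_if_chars_vanish:
  assumes "\<And>\<xi>. \<xi> \<in> chars \<Longrightarrow> \<xi> g = 0"
  shows "\<not> primitive_element G T g"
proof
  assume "primitive_element G T g"
  then obtain X where X: "g \<in> X" "topologically_generates G T X"
    "\<And>Y. Y \<subset> X \<Longrightarrow> \<not> topologically_generates G T Y" unfolding primitive_element_def by blast
  have XG: "X \<subseteq> carrier G" using X(2) by (simp add: topologically_generates_def)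
  have "topologically_generates G T (X - {g})"
  proof -
    have "X - {g} \<subseteq> carrier G" using XG by auto
    then show ?thesis
      using X(2) assms unfolding topologically_generates_iff[OF XG] topologically_generates_iff[OF \<open>X - {g} \<subseteq> carrier G\<close>]
      by (metis DiffI singletonD)
  qed
  then show False using X(1,3) by blast
qed

lemma char_hom: "\<xi> \<in> chars \<Longrightarrow> group_hom G (integer_mod_group p) \<xi>"
  using open_homsD(1) by (auto simp: group_hom_def group_hom_axioms_def)

lemma char_mult: "\<xi> \<in> chars \<Longrightarrow> x \<in> carrier G \<Longrightarrow> y \<in> carrier G \<Longrightarrow> \<xi> (x \<otimes> y) = (\<xi> x + \<xi> y) mod int p"
  using group_hom.hom_mult[OF char_hom] by simp

lemma char_range: "\<xi> \<in> chars \<Longrightarrow> x \<in> carrier G \<Longrightarrow> 0 \<le> \<xi> x \<and> \<xi> x < int p"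
  using group_hom.hom_closed[OF char_hom] prime_gt_0_nat[OF prime_p] by (auto simp: carrier_integer_mod_group)

lemma char_pow: "\<xi> \<in> chars \<Longrightarrow> x \<in> carrier G \<Longrightarrow> \<xi> (x [^] (n::nat)) = (int n * \<xi> x) mod int p"
  using group_hom.hom_nat_pow[OF char_hom]
    group_hom.hom_closed[OF char_hom] by simp

lemma char_closed_kernel:
  assumes "\<xi> \<in> chars" shows "closedin T {x \<in> carrier G. \<xi> x = 0}" "closedin T {x \<in> carrier G. \<xi> x \<noteq> 0}"
proof -
  have "openin T {x \<in> carrier G. \<xi> x \<in> A}" for A
    by (rule open_hom_openin[OF assms group_integer_mod_group])
  then have op: "openin T {x \<in> carrier G. \<xi> x \<in> {0}}" "openin T {x \<in> carrier G. \<xi> x \<in> - {0}}" by blast+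
  have "topspace T - {x \<in> carrier G. \<xi> x = 0} = {x \<in> carrier G. \<xi> x \<in> - {0}}"
    "topspace T - {x \<in> carrier G. \<xi> x \<noteq> 0} = {x \<in> carrier G. \<xi> x \<in> {0}}" by (auto simp: topspace_eq)
  then show "closedin T {x \<in> carrier G. \<xi> x = 0}" "closedin T {x \<in> carrier G. \<xi> x \<noteq> 0}"
    unfolding closedin_def using op by (auto simp: topspace_eq)
qed

text \<open>One step of Gaussian elimination: n represents -\<xi>(h)/\<xi>(x) modulo p.\<close>

lemma char_adjust:
  assumes \<xi>: "\<xi> \<in> chars" and x: "x \<in> carrier G" "\<xi> x \<noteq> 0" and h: "h \<in> carrier G"
  obtains n :: nat where "\<xi> (h \<otimes> x [^] n) = 0"
proof -
  have "\<not> int p dvd \<xi> x" using char_range[OF \<xi> x(1)] x(2) by (auto dest: zdvd_imp_le)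
  then have "coprime (\<xi> x) (int p)" using prime_p prime_imp_coprime[of "int p" "\<xi> x"] by (simp add: coprime_commute)
  then obtain m where m: "[\<xi> x * m = 1] (mod int p)" using cong_solve_coprime_int by blast
  define n where "n = nat ((- (\<xi> h) * m) mod int p)"
  have n: "int n = (- (\<xi> h) * m) mod int p" unfolding n_def using prime_gt_0_nat[OF prime_p] by simp
  have "[\<xi> h + int n * \<xi> x = \<xi> h + (- (\<xi> h) * m) * \<xi> x] (mod int p)"
    unfolding n by (intro cong_add cong_mult) (auto simp: cong_def)
  also have "\<xi> h + (- (\<xi> h) * m) * \<xi> x = \<xi> h + - (\<xi> h) * (\<xi> x * m)" by simp
  also have "[\<xi> h + - (\<xi> h) * (\<xi> x * m) = \<xi> h + - (\<xi> h) * 1] (mod int p)"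
    by (intro cong_add cong_mult m) auto
  finally have "(\<xi> h + int n * \<xi> x) mod int p = 0" by (simp add: cong_def)
  then have "\<xi> (h \<otimes> x [^] n) = 0" using \<xi> x h by (simp add: char_mult char_pow mod_add_right_eq)
  then show ?thesis using that by blast
qed

text \<open>
  The minimal generating set is dual to a basis \<open>\<Omega> \<ni> \<xi>\<close> of the \<open>\<bbbF>\<^sub>p\<close>-vector space of
  characters all of whose members other than \<open>\<xi>\<close> vanish at \<open>g\<close>; such a basis comes from Zorn's lemma
  and the dual elements from compactness.
\<close>

lemma primitive_if_char_nonzero:
  assumes \<xi>: "\<xi> \<in> chars" and g: "g \<in> carrier G" "\<xi> g \<noteq> 0"
  shows "primitive_element G T g"
proof -
  \<comment> \<open>Linear independence in terms of kernels: b is outside the span of a finite set A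
    exactly when some h is killed by all of A but not by b.\<close>
  define indep where "indep \<Omega> \<longleftrightarrow> (\<forall>b\<in>\<Omega>. \<forall>A. finite A \<longrightarrow> A \<subseteq> \<Omega> - {b} \<longrightarrow>
      (\<exists>h\<in>carrier G. (\<forall>a\<in>A. a h = 0) \<and> b h \<noteq> 0))" for \<Omega> :: "('a \<Rightarrow> int) set"
  define \<Z> where "\<Z> = {\<Omega>. \<xi> \<in> \<Omega> \<and> \<Omega> \<subseteq> chars \<and> (\<forall>b\<in>\<Omega> - {\<xi>}. b g = 0) \<and> indep \<Omega>}"
  have "\<exists>M\<in>\<Z>. \<forall>X\<in>\<Z>. M \<subseteq> X \<longrightarrow> X = M"
  proof (rule subset_Zorn_nonempty)
    have "{\<xi>} \<in> \<Z>" unfolding \<Z>_def indep_def using \<xi> g by auto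
    then show "\<Z> \<noteq> {}" by blast
    fix \<C> assume ne: "\<C> \<noteq> {}" and ch: "subset.chain \<Z> \<C>"
    then have sub: "\<C> \<subseteq> \<Z>" by (simp add: subset.chain_def)
    have "indep (\<Union>\<C>)"
      unfolding indep_def
    proof (intro ballI allI impI)
      fix b A assume b: "b \<in> \<Union>\<C>" and A: "finite A" "A \<subseteq> \<Union>\<C> - {b}"
      then have "finite (insert b A)" "insert b A \<subseteq> \<Union>\<C>" by auto
      then obtain B where B: "B \<in> \<C>" "insert b A \<subseteq> B"
        using finite_subset_Union_chain[OF _ _ ne ch] by metis
      then have "indep B" using sub unfolding \<Z>_def by blast
      moreover have "b \<in> B" "A \<subseteq> B - {b}" using A B(2) by auto
      ultimately show "\<exists>h\<in>carrier G. (\<forall>a\<in>A. a h = 0) \<and> b h \<noteq> 0"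
        unfolding indep_def using A(1) by simp
    qed
    then show "\<Union>\<C> \<in> \<Z>" using ne sub unfolding \<Z>_def by blast
  qed
  then obtain \<Omega> where \<Omega>: "\<Omega> \<in> \<Z>" and max: "\<And>X. X \<in> \<Z> \<Longrightarrow> \<Omega> \<subseteq> X \<Longrightarrow> X = \<Omega>" by blast
  have \<xi>\<Omega>: "\<xi> \<in> \<Omega>" and \<Omega>c: "\<Omega> \<subseteq> chars" and \<Omega>g: "\<And>b. b \<in> \<Omega> \<Longrightarrow> b \<noteq> \<xi> \<Longrightarrow> b g = 0"
    and ind: "\<And>b A. b \<in> \<Omega> \<Longrightarrow> finite A \<Longrightarrow> A \<subseteq> \<Omega> - {b} \<Longrightarrow> \<exists>h\<in>carrier G. (\<forall>a\<in>A. a h = 0) \<and> b h \<noteq> 0"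
    using \<Omega> unfolding \<Z>_def indep_def by auto
  \<comment> \<open>By maximality, adjoining \<mu> destroys independence. If the dependent member is
    some b other than \<mu>, an exchange argument expresses \<mu> through b and the rest.\<close>
  have spans: "\<exists>A\<subseteq>\<Omega>. finite A \<and> (\<forall>h\<in>carrier G. (\<forall>a\<in>A. a h = 0) \<longrightarrow> \<mu> h = 0)"
    if \<mu>: "\<mu> \<in> chars" "\<mu> g = 0" for \<mu>
  proof (cases "\<mu> \<in> \<Omega>")
    case True
    then show ?thesis by (intro exI[of _ "{\<mu>}"]) auto
  next
    case False
    then have "insert \<mu> \<Omega> \<notin> \<Z>" using max by blast
    then have "\<not> indep (insert \<mu> \<Omega>)" using \<Omega> \<mu> g unfolding \<Z>_def by auto
    then obtain b A where bA: "b \<in> insert \<mu> \<Omega>" "finite A" "A \<subseteq> insert \<mu> \<Omega> - {b}"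
      "\<And>h. h \<in> carrier G \<Longrightarrow> (\<forall>a\<in>A. a h = 0) \<Longrightarrow> b h = 0" unfolding indep_def by blast
    show ?thesis
    proof (cases "b = \<mu>")
      case True
      then show ?thesis using bA by blast
    next
      case False
      then have b: "b \<in> \<Omega>" using bA by blast
      let ?A = "A - {\<mu>}"
      have A\<Omega>: "?A \<subseteq> \<Omega> - {b}" using bA(3) by blast
      obtain f where f: "f \<in> carrier G" "\<And>a. a \<in> ?A \<Longrightarrow> a f = 0" "b f \<noteq> 0"
        using ind[OF b _ A\<Omega>] bA(2) by blast
      \<comment> \<open>Otherwise a power of h corrects f so that \<mu> vanishes there too; all of A
        then kills the corrected element, but b does not.\<close>
      have "\<mu> h = 0" if h: "h \<in> carrier G" "\<forall>a\<in>insert b ?A. a h = 0" for h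
      proof (rule ccontr)
        assume "\<mu> h \<noteq> 0"
        from char_adjust[OF \<mu>(1) h(1) this f(1)] obtain n :: nat where n: "\<mu> (f \<otimes> h [^] n) = 0" .
        have val: "a (f \<otimes> h [^] n) = a f" if "a \<in> chars" "a h = 0" for a
          using that f(1) h(1) char_range[OF that(1) f(1)] by (simp add: char_mult char_pow)
        have "\<forall>a\<in>A. a (f \<otimes> h [^] n) = 0"
        proof
          fix a assume "a \<in> A"
          show "a (f \<otimes> h [^] n) = 0"
          proof (cases "a = \<mu>")
            case False
            then have "a \<in> ?A" using \<open>a \<in> A\<close> by simp
            then have "a \<in> chars" "a h = 0" "a f = 0" using h(2) f(2) A\<Omega> \<Omega>c by blast+
            then show ?thesis using val[of a] by simp
          qed (simp add: n)
        qed
        then have "b (f \<otimes> h [^] n) = 0" using bA(4)[of "f \<otimes> h [^] n"] f(1) h(1) by simp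
        moreover have "b \<in> chars" "b h = 0" using b \<Omega>c h(2) by blast+
        ultimately show False using val[of b] f(3) by simp
      qed
      then show ?thesis using b A\<Omega> bA(2) by (intro exI[of _ "insert b ?A"]) auto
    qed
  qed
  \<comment> \<open>Compactness: each condition on x is closed, and any finitely many of them hold
    at a common point by independence.\<close>
  have dual: "\<exists>x\<in>carrier G. b x \<noteq> 0 \<and> (\<forall>a\<in>\<Omega> - {b}. a x = 0)" if b: "b \<in> \<Omega>" for b
  proof -
    define \<U> where "\<U> = insert {x \<in> carrier G. b x \<noteq> 0} ((\<lambda>a. {x \<in> carrier G. a x = 0}) ` (\<Omega> - {b}))"
    have "\<Inter>\<U> \<noteq> {}"
    proof (rule compact_space_fip[THEN iffD1, OF compact, rule_format], intro conjI ballI allI impI)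
      show "closedin T C" if "C \<in> \<U>" for C
        using that b \<Omega>c char_closed_kernel unfolding \<U>_def by auto
      fix \<F> assume F: "finite \<F> \<and> \<F> \<subseteq> \<U>"
      then have "finite (\<F> - {{x \<in> carrier G. b x \<noteq> 0}})"
        "\<F> - {{x \<in> carrier G. b x \<noteq> 0}} \<subseteq> (\<lambda>a. {x \<in> carrier G. a x = 0}) ` (\<Omega> - {b})"
        unfolding \<U>_def by auto
      then obtain A where A: "A \<subseteq> \<Omega> - {b}" "finite A"
        "\<F> - {{x \<in> carrier G. b x \<noteq> 0}} = (\<lambda>a. {x \<in> carrier G. a x = 0}) ` A"
        using finite_subset_image by meson
      obtain h where h: "h \<in> carrier G" "\<forall>a\<in>A. a h = 0" "b h \<noteq> 0" using ind[OF b A(2,1)] by blast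
      have "h \<in> C" if "C \<in> \<F>" for C
      proof (cases "C = {x \<in> carrier G. b x \<noteq> 0}")
        case False
        then have "C \<in> (\<lambda>a. {x \<in> carrier G. a x = 0}) ` A" using that A(3) by blast
        then show ?thesis using h by auto
      qed (use h in simp)
      then show "\<Inter>\<F> \<noteq> {}" by blast
    qed
    then show ?thesis unfolding \<U>_def by auto
  qed
  \<comment> \<open>The dual element at \<xi> is g itself, which is allowed because the other
    members of \<Omega> vanish at g. This puts g into the generating set.\<close>
  define e where "e b = (if b = \<xi> then g else (SOME x. x \<in> carrier G \<and> b x \<noteq> 0 \<and> (\<forall>a\<in>\<Omega> - {b}. a x = 0)))" for b
  have e: "e b \<in> carrier G \<and> b (e b) \<noteq> 0 \<and> (\<forall>a\<in>\<Omega> - {b}. a (e b) = 0)" if "b \<in> \<Omega>" for b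
  proof (cases "b = \<xi>")
    case True
    then show ?thesis unfolding e_def using g \<Omega>g by auto
  next
    case False
    have "\<exists>x. x \<in> carrier G \<and> b x \<noteq> 0 \<and> (\<forall>a\<in>\<Omega> - {b}. a x = 0)" using dual[OF that] by blast
    from someI_ex[OF this] show ?thesis unfolding e_def using False by simp
  qed
  have eG: "e ` \<Omega> \<subseteq> carrier G" using e by blast
  have "topologically_generates G T (e ` \<Omega>)"
    unfolding topologically_generates_iff[OF eG]
  proof (intro ballI impI)
    fix \<mu> h assume \<mu>: "\<mu> \<in> chars" and van: "\<forall>x\<in>e ` \<Omega>. \<mu> x = 0" and h: "h \<in> carrier G"
    have "\<mu> g = 0" using van \<xi>\<Omega> unfolding e_def by force
    then obtain A where A: "A \<subseteq> \<Omega>" "finite A" "\<forall>h\<in>carrier G. (\<forall>a\<in>A. a h = 0) \<longrightarrow> \<mu> h = 0"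
      using spans[OF \<mu>] by blast
    \<comment> \<open>Members of A are removed one at a time: multiplying by a power of the dual
      element \<open>e b\<close> makes b vanish and changes neither the other values nor that of
      \<mu>.\<close>
    from A(2,1,3) have "\<forall>h\<in>carrier G. \<mu> h = 0"
    proof (induction A rule: finite_induct)
      case (insert b A)
      have b: "b \<in> \<Omega>" "b \<in> chars" using insert.prems \<Omega>c by auto
      have "\<mu> h = 0" if h: "h \<in> carrier G" "\<forall>a\<in>A. a h = 0" for h
      proof -
        have "e b \<in> carrier G" "b (e b) \<noteq> 0" using e[OF b(1)] by auto
        from char_adjust[OF b(2) this h(1)] obtain n :: nat where n: "b (h \<otimes> e b [^] n) = 0" .
        have "a (h \<otimes> e b [^] n) = 0" if "a \<in> A" for a
        proof -
          have a: "a \<in> chars" "a (e b) = 0" "a h = 0"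
            using that insert.prems(1) insert.hyps(2) \<Omega>c e[OF b(1)] h(2) by auto
          then show ?thesis using h(1) e[OF b(1)] by (simp add: char_mult char_pow)
        qed
        then have "\<mu> (h \<otimes> e b [^] n) = 0" using insert.prems(2) n e[OF b(1)] h(1) by simp
        moreover have "\<mu> (e b) = 0" using van b by blast
        ultimately show ?thesis
          using h(1) e[OF b(1)] \<mu> char_range[OF \<mu> h(1)] by (simp add: char_mult char_pow)
      qed
      then show ?case using insert.IH insert.prems(1) by blast
    qed simp
    then show "\<mu> h = 0" using h by blast
  qed
  moreover have "\<not> topologically_generates G T Y" if Y: "Y \<subset> e ` \<Omega>" for Y
  proof
    assume gen: "topologically_generates G T Y"
    obtain b where b: "b \<in> \<Omega>" "e b \<notin> Y" using Y by blast
    have "b y = 0" if "y \<in> Y" for y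
    proof -
      obtain c where c: "c \<in> \<Omega>" "y = e c" using Y \<open>y \<in> Y\<close> by blast
      then have "b \<in> \<Omega> - {c}" using b that by auto
      then show ?thesis using e[OF c(1)] c(2) by blast
    qed
    moreover have YG: "Y \<subseteq> carrier G" using Y eG by blast
    ultimately have "b (e b) = 0"
      using gen topologically_generates_iff[OF YG] b(1) \<Omega>c e[OF b(1)] by blast
    then show False using e[OF b(1)] by blast
  qed
  moreover have "g \<in> e ` \<Omega>" using \<xi>\<Omega> unfolding e_def by force
  ultimately show ?thesis unfolding primitive_element_def by blast
qed

end

section \<open>Free pro-p groups and their finite quotients\<close>

lemma discrete_pro_p_group:
  assumes P: "group P" and p: "prime p" and ord: "order P = p ^ k"
  shows "pro_p_group p P (discrete_topology (carrier P))"
proof -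
  interpret group P by (rule P)
  have fin: "finite (carrier P)"
    using ord p by (metis order_gt_0_iff_finite prime_gt_0_nat zero_less_power)
  show ?thesis
  proof
    show "continuous_map (prod_topology (discrete_topology (carrier P)) (discrete_topology (carrier P)))
        (discrete_topology (carrier P)) (\<lambda>(a, b). a \<otimes>\<^bsub>P\<^esub> b)"
      by (auto simp: prod_topology_discrete_topology[symmetric])
    show "continuous_map (discrete_topology (carrier P)) (discrete_topology (carrier P)) (m_inv P)" by auto
    show "\<exists>H. subgroup H P \<and> openin (discrete_topology (carrier P)) H \<and> H \<subseteq> U"
      if "openin (discrete_topology (carrier P)) U" "\<one>\<^bsub>P\<^esub> \<in> U" for U
      using that triv_subgroup by (intro exI[of _ "{\<one>\<^bsub>P\<^esub>}"]) auto
    show "\<exists>k. card (rcosets\<^bsub>P\<^esub> N) = p ^ k" if "N \<lhd> P" for N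
    proof -
      have "card (rcosets\<^bsub>P\<^esub> N) dvd p ^ k"
        using lagrange[OF normal_imp_subgroup[OF that]] ord by (metis dvd_triv_left)
      then show ?thesis using p divides_primepow_nat by metis
    qed
  qed (use fin p in \<open>auto simp: compact_space_discrete_topology\<close>)
qed

text \<open>The universal property speaks about groups with elements of type \<open>nat set\<close>;
  a finite group is moved there by encoding its elements as distinct singletons.\<close>

lemma finite_p_group_copy:
  assumes P: "group P" and p: "prime p" and ord: "order P = p ^ k"
  obtains H :: "nat set monoid" and \<iota> where "pro_p_group p H (discrete_topology (carrier H))"
    "\<iota> \<in> hom H P" "inj_on \<iota> (carrier H)" "\<iota> ` carrier H = carrier P"
proof -
  interpret group P by (rule P)
  have fin: "finite (carrier P)"
    using ord p by (metis order_gt_0_iff_finite prime_gt_0_nat zero_less_power)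
  then obtain f :: "'a \<Rightarrow> nat" where f: "inj_on f (carrier P)" using finite_imp_inj_to_nat_seg by blast
  define h where "h = (\<lambda>y. {f y})"
  have h: "inj_on h (carrier P)" using f by (auto simp: inj_on_def h_def)
  define \<iota> where "\<iota> = the_inv_into (carrier P) h"
  have \<iota>h: "\<iota> (h y) = y" if "y \<in> carrier P" for y
    unfolding \<iota>_def by (rule the_inv_into_f_f[OF h that])
  define H0 :: "nat set monoid" where "H0 = \<lparr>carrier = UNIV, mult = (\<lambda>X Y. h (\<iota> X \<otimes>\<^bsub>P\<^esub> \<iota> Y)), one = h \<one>\<^bsub>P\<^esub>\<rparr>"
  let ?H = "H0\<lparr>carrier := h ` carrier P, one := h \<one>\<^bsub>P\<^esub>\<rparr>"
  have "h \<in> hom P H0" by (auto simp: hom_def H0_def \<iota>h)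
  then have H: "group ?H" by (rule hom_imp_img_group)
  have car: "carrier ?H = h ` carrier P" by simp
  have "order ?H = p ^ k" unfolding order_def car using ord card_image[OF h] by (simp add: order_def)
  then have "pro_p_group p ?H (discrete_topology (carrier ?H))" by (rule discrete_pro_p_group[OF H p])
  moreover have "\<iota> \<in> hom ?H P" by (auto simp: hom_def H0_def \<iota>h)
  moreover have "inj_on \<iota> (carrier ?H)" using \<iota>h by (auto simp: inj_on_def car)
  moreover have "\<iota> ` carrier ?H = carrier P" using \<iota>h by (force simp: car)
  ultimately show ?thesis using that by blast
qed

locale free_pro_p = pro_p_group p G T for p and G (structure) and T +
  fixes m :: nat and x :: "nat \<Rightarrow> 'a"
  assumes free: "free_pro_p_group p G T m x"
begin

lemma gens_closed: "i \<in> {1..m} \<Longrightarrow> x i \<in> carrier G"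
  using free by (auto simp: free_pro_p_group_def)

lemma universal:
  fixes H :: "nat set monoid"
  assumes "pro_p_group p H S" "f \<in> {1..m} \<rightarrow> carrier H"
  shows "\<exists>\<phi>\<in>continuous_hom G T H S. (\<forall>i\<in>{1..m}. \<phi> (x i) = f i) \<and>
    (\<forall>\<psi>\<in>continuous_hom G T H S. (\<forall>i\<in>{1..m}. \<psi> (x i) = f i) \<longrightarrow> (\<forall>g\<in>carrier G. \<psi> g = \<phi> g))"
  using free assms unfolding free_pro_p_group_def by simp

text \<open>The existence half of the universal property, carried over to finite p-groups of any
  element type by means of such a copy.\<close>

lemma open_hom_exists:
  assumes P: "group P" "order P = p ^ k" and w: "w \<in> {1..m} \<rightarrow> carrier P"
  shows "\<exists>\<rho>\<in>open_homs G T P. \<forall>i\<in>{1..m}. \<rho> (x i) = w i"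
proof -
  obtain H :: "nat set monoid" and \<iota> where H: "pro_p_group p H (discrete_topology (carrier H))"
    and \<iota>: "\<iota> \<in> hom H P" "inj_on \<iota> (carrier H)" "\<iota> ` carrier H = carrier P"
    using finite_p_group_copy[OF P(1) prime_p P(2)] by metis
  interpret H: pro_p_group p H "discrete_topology (carrier H)" by (rule H)
  define f where "f i = inv_into (carrier H) \<iota> (w i)" for i
  have f: "f i \<in> carrier H \<and> \<iota> (f i) = w i" if "i \<in> {1..m}" for i
    using w that \<iota>(3) unfolding f_def by (metis PiE f_inv_into_f inv_into_into)
  have "f \<in> {1..m} \<rightarrow> carrier H" using f by auto
  from universal[OF H this]
  obtain \<phi> where \<phi>: "\<phi> \<in> continuous_hom G T H (discrete_topology (carrier H))"
    "\<forall>i\<in>{1..m}. \<phi> (x i) = f i" by (elim bexE conjE)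
  have hom: "\<phi> \<in> hom G H" and cont: "continuous_map T (discrete_topology (carrier H)) \<phi>"
    using \<phi>(1) by (auto simp: continuous_hom_def)
  have "openin T {y \<in> topspace T. \<phi> y \<in> {\<one>\<^bsub>H\<^esub>}}"
    by (rule openin_continuous_map_preimage[OF cont]) simp
  then have "\<phi> \<in> open_homs G T H" using hom by (simp add: open_homs_def kernel_def topspace_eq)
  then have "\<iota> \<circ> \<phi> \<in> open_homs G T P" using open_homs_compose[OF _ \<iota>(1) H.is_group P(1)] by blast
  then show ?thesis using \<phi>(2) f by (intro bexI[of _ "\<iota> \<circ> \<phi>"]) auto
qed

text \<open>A character that vanishes on the generators solves the same extension problem as the
  trivial one, so the uniqueness half of the universal property identifies them, after a transfer to
  a copy of Z/p over \<open>nat set\<close>.\<close>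

lemma generators_generate: "topologically_generates G T (x ` {1..m})"
proof -
  have sub: "x ` {1..m} \<subseteq> carrier G" using gens_closed by blast
  show ?thesis
    unfolding topologically_generates_iff[OF sub]
  proof (intro ballI impI)
    fix \<xi> g assume \<xi>: "\<xi> \<in> chars" "\<forall>y\<in>x ` {1..m}. \<xi> y = 0" and g: "g \<in> carrier G"
    let ?Z = "integer_mod_group p"
    have ord: "order ?Z = p ^ 1"
      using prime_gt_0_nat[OF prime_p] by (simp add: order_def carrier_integer_mod_group)
    obtain H :: "nat set monoid" and \<iota> where H: "pro_p_group p H (discrete_topology (carrier H))"
      and \<iota>: "\<iota> \<in> hom H ?Z" "inj_on \<iota> (carrier H)" "\<iota> ` carrier H = carrier ?Z"
      using finite_p_group_copy[OF group_integer_mod_group prime_p ord] by metis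
    interpret H: pro_p_group p H "discrete_topology (carrier H)" by (rule H)
    have "group_hom H ?Z \<iota>" using \<iota>(1) H.is_group by (simp add: group_hom_def group_hom_axioms_def)
    then have \<iota>1: "\<iota> \<one>\<^bsub>H\<^esub> = 0" using group_hom.hom_one by fastforce
    define j where "j = inv_into (carrier H) \<iota>"
    have j: "j y \<in> carrier H" "\<iota> (j y) = y" if "y \<in> carrier ?Z" for y
      using that \<iota>(3) unfolding j_def by (auto intro: inv_into_into f_inv_into_f)
    have jhom: "j \<in> hom ?Z H"
    proof (rule homI)
      fix y z assume yz: "y \<in> carrier ?Z" "z \<in> carrier ?Z"
      then have "y \<otimes>\<^bsub>?Z\<^esub> z = \<iota> (j y \<otimes>\<^bsub>H\<^esub> j z)"
        using j hom_mult[OF \<iota>(1)] by simp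
      moreover have "j y \<otimes>\<^bsub>H\<^esub> j z \<in> carrier H" using j yz by simp
      ultimately show "j (y \<otimes>\<^bsub>?Z\<^esub> z) = j y \<otimes>\<^bsub>H\<^esub> j z"
        using inv_into_f_f[OF \<iota>(2)] by (simp add: j_def)
    qed (use j in auto)
    have j0: "j 0 = \<one>\<^bsub>H\<^esub>" using \<iota>1 inv_into_f_f[OF \<iota>(2), of "\<one>\<^bsub>H\<^esub>"] unfolding j_def by simp
    have "j \<circ> \<xi> \<in> open_homs G T H" by (rule open_homs_compose[OF \<xi>(1) jhom]) (simp_all add: H.is_group)
    then have 1: "j \<circ> \<xi> \<in> continuous_hom G T H (discrete_topology (carrier H))"
      using open_hom_continuous[OF _ H.is_group] open_homsD(1) by (auto simp: continuous_hom_def)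
    have 2: "(\<lambda>_. \<one>\<^bsub>H\<^esub>) \<in> continuous_hom G T H (discrete_topology (carrier H))"
      by (auto simp: continuous_hom_def hom_def)
    have "(\<lambda>_. \<one>\<^bsub>H\<^esub>) \<in> {1..m} \<rightarrow> carrier H" by simp
    from universal[OF H this] obtain \<phi> where
      uniq: "\<forall>\<psi>\<in>continuous_hom G T H (discrete_topology (carrier H)).
        (\<forall>i\<in>{1..m}. \<psi> (x i) = \<one>\<^bsub>H\<^esub>) \<longrightarrow> (\<forall>g\<in>carrier G. \<psi> g = \<phi> g)" by (elim bexE conjE)
    have "(j \<circ> \<xi>) g = \<phi> g" using uniq[rule_format, OF 1 _ g] \<xi>(2) j0 by simp
    also have "\<dots> = \<one>\<^bsub>H\<^esub>" using uniq[rule_format, OF 2 _ g] by simp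
    finally have "j (\<xi> g) = \<one>\<^bsub>H\<^esub>" by simp
    moreover have "\<xi> g \<in> carrier ?Z" using open_homsD(1)[OF \<xi>(1)] g by (auto simp: hom_def)
    ultimately show "\<xi> g = 0" using j(2) \<iota>1 by metis
  qed
qed

lemma open_hom_ext:
  assumes "group P" "\<rho> \<in> open_homs G T P" "\<sigma> \<in> open_homs G T P"
    and "\<And>i. i \<in> {1..m} \<Longrightarrow> \<rho> (x i) = \<sigma> (x i)" and "g \<in> carrier G"
  shows "\<rho> g = \<sigma> g"
  using topologically_generates_eqI[OF generators_generate assms(1-3) _ assms(5)] assms(4) by blast

end

section \<open>p-adic exponents\<close>

lemma padic_carrier:
  "\<alpha> \<in> carrier (padic_ints p) \<longleftrightarrow> (\<forall>n. 0 \<le> \<alpha> n \<and> \<alpha> n < int p ^ n \<and> \<alpha> (Suc n) mod int p ^ n = \<alpha> n)"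
  by (simp add: padic_ints_def)

lemma padic_mod:
  assumes "\<alpha> \<in> carrier (padic_ints p)" "m \<le> n" shows "\<alpha> n mod int p ^ m = \<alpha> m"
  using assms(2)
proof (induction n rule: dec_induct)
  case base
  then show ?case using assms(1) by (simp add: padic_carrier mod_pos_pos_trivial)
next
  case (step n)
  have "\<alpha> (Suc n) mod int p ^ m = \<alpha> (Suc n) mod int p ^ n mod int p ^ m"
    using step(1) by (simp add: mod_mod_cancel le_imp_power_dvd)
  then show ?case using assms(1) step by (simp add: padic_carrier)
qed

lemma padic_add_pow_one: "add_pow (padic_ints p) m \<one>\<^bsub>padic_ints p\<^esub> = (\<lambda>n. int m mod int p ^ n)"
proof (induction m)
  case 0
  then show ?case by (simp add: add_pow_def nat_pow_def padic_ints_def)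
next
  case (Suc m)
  have "add_pow (padic_ints p) (Suc m) \<one>\<^bsub>padic_ints p\<^esub> =
    (\<lambda>n. (add_pow (padic_ints p) m \<one>\<^bsub>padic_ints p\<^esub> n + 1 mod int p ^ n) mod int p ^ n)"
    by (simp add: add_pow_def nat_pow_def padic_ints_def)
  then show ?case unfolding Suc by (simp add: mod_add_eq add.commute)
qed

lemma padic_multiples_power:
  assumes p: "prime p"
  shows "padic_multiples p (p ^ k) = {\<alpha> \<in> carrier (padic_ints p). \<alpha> k = 0}"
proof -
  have pos: "0 < int p ^ n" for n using prime_gt_0_nat[OF p] by simp
  have eq: "padic_multiples p (p ^ k) =
    {\<lambda>n. \<gamma> n * (int p ^ k mod int p ^ n) mod int p ^ n | \<gamma>. \<gamma> \<in> carrier (padic_ints p)}"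
    unfolding padic_multiples_def cgenideal_def padic_add_pow_one by (simp add: padic_ints_def)
  have "(\<lambda>n. \<gamma> n * (int p ^ k mod int p ^ n) mod int p ^ n) \<in> carrier (padic_ints p)"
    if "\<gamma> \<in> carrier (padic_ints p)" for \<gamma>
  proof -
    have "\<gamma> (Suc n) * int p ^ k mod int p ^ Suc n mod int p ^ n = \<gamma> n * int p ^ k mod int p ^ n" for n
    proof -
      have "\<gamma> (Suc n) * int p ^ k mod int p ^ Suc n mod int p ^ n = \<gamma> (Suc n) * int p ^ k mod int p ^ n"
        by (simp add: mod_mod_cancel)
      also have "\<dots> = (\<gamma> (Suc n) mod int p ^ n) * int p ^ k mod int p ^ n" by (simp add: mod_mult_left_eq)
      finally show ?thesis using that by (simp add: padic_carrier)
    qed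
    then show ?thesis using pos by (simp add: padic_carrier mod_mult_right_eq)
  qed
  moreover have "\<alpha> \<in> padic_multiples p (p ^ k)" if \<alpha>: "\<alpha> \<in> carrier (padic_ints p)" "\<alpha> k = 0" for \<alpha>
  proof -
    \<comment> \<open>The quotient by p^k is known modulo p^n only from k further digits of
      \<alpha>, hence the shifted index.\<close>
    define \<gamma> where "\<gamma> n = \<alpha> (n + k) div int p ^ k" for n
    have "int p ^ k dvd \<alpha> (n + k)" for n using padic_mod[OF \<alpha>(1), of k "n + k"] \<alpha>(2) by (simp add: dvd_eq_mod_eq_0)
    then have \<gamma>: "\<alpha> (n + k) = \<gamma> n * int p ^ k" for n by (simp add: \<gamma>_def)
    have "\<gamma> \<in> carrier (padic_ints p)"
      unfolding padic_carrier
    proof (intro allI conjI)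
      fix n
      have r: "0 \<le> \<alpha> (n + k)" "\<alpha> (n + k) < int p ^ (n + k)" using \<alpha>(1) by (auto simp: padic_carrier)
      then show "0 \<le> \<gamma> n" unfolding \<gamma>_def using pos[of k] by (simp add: pos_imp_zdiv_nonneg_iff)
      show "\<gamma> n < int p ^ n" using r(2) pos[of k] unfolding \<gamma> power_add by simp
      have "\<gamma> (Suc n) * int p ^ k mod (int p ^ n * int p ^ k) = \<gamma> n * int p ^ k"
        using \<alpha>(1) \<gamma>[of n] \<gamma>[of "Suc n"] by (simp add: padic_carrier power_add[symmetric]) (metis add_Suc)
      then show "\<gamma> (Suc n) mod int p ^ n = \<gamma> n" using prime_gt_0_nat[OF p] by (simp add: mod_mult_mult2)
    qed
    moreover have "\<alpha> = (\<lambda>n. \<gamma> n * (int p ^ k mod int p ^ n) mod int p ^ n)"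
    proof
      fix n
      show "\<alpha> n = \<gamma> n * (int p ^ k mod int p ^ n) mod int p ^ n"
        using padic_mod[OF \<alpha>(1), of n "n + k"] unfolding \<gamma> by (simp add: mod_mult_right_eq)
    qed
    ultimately show ?thesis unfolding eq by blast
  qed
  ultimately show ?thesis unfolding eq by auto
qed

text \<open>Exponents matter only modulo the order of a, a divisor of p^M, and from level M on the
  residues of \<alpha> agree modulo p^M.\<close>

lemma (in group) int_pow_padic:
  assumes "order G = p ^ M" "a \<in> carrier G" "\<alpha> \<in> carrier (padic_ints p)" "M \<le> n"
  shows "a [^] \<alpha> n = a [^] nat (\<alpha> M)"
proof -
  have "int p ^ M dvd \<alpha> n - \<alpha> M"
    using padic_mod[OF assms(3,4)] by (metis dvd_minus_mod)
  then have "int (ord a) dvd \<alpha> M - \<alpha> n"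
    using ord_dvd_group_order[OF assms(2)] assms(1)
    by (metis dvd_diff_commute dvd_trans of_nat_dvd_iff of_nat_power)
  then have "a [^] \<alpha> n = a [^] \<alpha> M" using int_pow_eq[OF assms(2)] by blast
  also have "\<dots> = a [^] int (nat (\<alpha> M))" using assms(3) by (simp add: padic_carrier)
  finally show ?thesis by (simp add: int_pow_int)
qed

context pro_p_group
begin

text \<open>Compactness yields a cluster point of the powers. Modulo any open normal subgroup the
  powers are eventually constant, so the cluster point is a limit; it is unique by the Hausdorff
  property, which justifies the description in \<open>padic_pow\<close>.\<close>

lemma padic_pow_limit:
  assumes y: "y \<in> carrier G" and \<alpha>: "\<alpha> \<in> carrier (padic_ints p)"
  shows "limitin T (\<lambda>n. y [^] \<alpha> n) (padic_pow G T y \<alpha>) sequentially"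
proof -
  define s where "s n = y [^] \<alpha> n" for n
  have sG: "s n \<in> carrier G" for n unfolding s_def using y by simp
  define C where "C n = T closure_of (s ` {n..})" for n
  have "\<Inter>(range C) \<noteq> {}"
  proof (rule compact_space_fip[THEN iffD1, OF compact, rule_format], intro conjI ballI allI impI)
    fix \<F> assume "finite \<F> \<and> \<F> \<subseteq> range C"
    then obtain A where A: "finite A" "\<F> = C ` A" using finite_subset_image by (metis)
    obtain n where n: "\<And>a. a \<in> A \<Longrightarrow> a \<le> n" using A(1) by (meson finite_nat_set_iff_bounded_le)
    have "s n \<in> C a" if "a \<in> A" for a
      using closure_of_subset[of "s ` {a..}" T] sG n[OF that] unfolding C_def by (auto simp: topspace_eq)
    then show "\<Inter>\<F> \<noteq> {}" using A(2) by blast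
  qed (auto simp: C_def)
  then obtain l where l: "\<And>n. l \<in> C n" by auto
  have lG: "l \<in> carrier G" using l[of 0] closure_of_subset_topspace[of T] unfolding C_def topspace_eq[symmetric] by blast
  have "limitin T s l sequentially"
    unfolding limitin_def
  proof (intro conjI allI impI)
    show "l \<in> topspace T" using lG by (simp add: topspace_eq)
    fix U assume U: "openin T U \<and> l \<in> U"
    define W where "W = {g \<in> carrier G. l \<otimes> g \<in> U}"
    have "openin T W" "\<one> \<in> W" unfolding W_def using openin_left_translation U lG by auto
    then obtain V where V: "subgroup V G" "openin T V" "V \<subseteq> W" using open_subgroup_base by blast
    then obtain N where N: "N \<lhd> G" "openin T N" "N \<subseteq> W" using open_normal_core[OF compact] by (metis subset_trans)
    interpret N: normal N G by (rule N)
    note Q = open_normal_quotient[OF N(1,2)]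
    obtain M where M: "order (G Mod N) = p ^ M" using Q(2) by blast
    interpret \<pi>: group_hom G "G Mod N" "\<lambda>x. N #> x"
      using open_homsD(1)[OF Q(3)] Q(1) by (simp add: group_hom_def group_hom_axioms_def)
    have const: "N #> s n = N #> s M" if "M \<le> n" for n
    proof -
      have "N #> s i = (N #> y) [^]\<^bsub>G Mod N\<^esub> \<alpha> i" for i
        unfolding s_def using \<pi>.hom_int_pow[OF y] by simp
      then show ?thesis
        using group.int_pow_padic[OF Q(1) M _ \<alpha> that, of "N #> y"] group.int_pow_padic[OF Q(1) M _ \<alpha>, of "N #> y" M]
          \<pi>.hom_closed[OF y] by simp
    qed
    have "openin T (N #> l)" by (rule openin_r_coset[OF N(2) N.subset lG])
    moreover have "l \<in> N #> l" by (rule rcos_self[OF lG N.is_subgroup])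
    ultimately obtain k where k: "k \<ge> M" "s k \<in> N #> l"
      using l[of M] unfolding C_def in_closure_of by auto
    have "N #> s k = N #> l" using repr_independence[OF k(2) lG N.is_subgroup] by simp
    then have "s n \<in> U" if "M \<le> n" for n
    proof -
      have "s n \<in> N #> s n" by (rule rcos_self[OF sG N.is_subgroup])
      also have "\<dots> = l <# N" using const[OF that] const[OF k(1)] \<open>N #> s k = N #> l\<close> N.coset_eq lG by simp
      finally obtain h where "h \<in> N" "s n = l \<otimes> h" unfolding l_coset_def by auto
      then show ?thesis using N(3) unfolding W_def by auto
    qed
    then show "\<forall>\<^sub>F n in sequentially. s n \<in> U" unfolding eventually_sequentially by blast
  qed
  moreover have "l' = l" if "limitin T s l' sequentially" for l'
    using limitin_Hausdorff_unique[OF that calculation] Hausdorff by simp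
  ultimately have "limitin T s (THE l. limitin T s l sequentially) sequentially" by (rule theI)
  then show ?thesis unfolding padic_pow_def s_def .
qed

lemma padic_pow_closed:
  assumes "y \<in> carrier G" "\<alpha> \<in> carrier (padic_ints p)" shows "padic_pow G T y \<alpha> \<in> carrier G"
  using padic_pow_limit[OF assms] by (simp add: limitin_def topspace_eq)

text \<open>In the discrete group P the convergent sequence of powers becomes constant, so later
  computations involve ordinary powers only. The exponent is the residue at the level M given by the
  order of P.\<close>

lemma open_hom_padic_pow:
  assumes \<rho>: "\<rho> \<in> open_homs G T P" and P: "group P" "order P = p ^ M"
    and y: "y \<in> carrier G" and \<alpha>: "\<alpha> \<in> carrier (padic_ints p)"
  shows "\<rho> (padic_pow G T y \<alpha>) = \<rho> y [^]\<^bsub>P\<^esub> nat (\<alpha> M)"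
proof -
  let ?l = "padic_pow G T y \<alpha>"
  interpret \<rho>: group_hom G P \<rho>
    using open_homsD(1)[OF \<rho>] P(1) by (simp add: group_hom_def group_hom_axioms_def)
  have "openin T {g \<in> carrier G. \<rho> g \<in> {\<rho> ?l}}" by (rule open_hom_openin[OF \<rho> P(1)])
  then have "\<forall>\<^sub>F n in sequentially. y [^] \<alpha> n \<in> {g \<in> carrier G. \<rho> g \<in> {\<rho> ?l}}"
    using padic_pow_limit[OF y \<alpha>] padic_pow_closed[OF y \<alpha>] unfolding limitin_def by blast
  then have "\<forall>\<^sub>F n in sequentially. \<rho> (y [^] \<alpha> n) = \<rho> ?l" by (rule eventually_mono) simp
  moreover have "\<forall>\<^sub>F n in sequentially. \<rho> (y [^] \<alpha> n) = \<rho> y [^]\<^bsub>P\<^esub> nat (\<alpha> M)"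
    unfolding eventually_sequentially
    using \<rho>.hom_int_pow[OF y] group.int_pow_padic[OF P _ \<alpha>] \<rho>.hom_closed[OF y] by auto
  ultimately have "\<forall>\<^sub>F n in sequentially. \<rho> ?l = \<rho> y [^]\<^bsub>P\<^esub> nat (\<alpha> M)"
    by eventually_elim simp
  then show ?thesis by simp
qed

end

section \<open>Finite wreath products of cyclic groups\<close>

text \<open>
  The group \<open>(\<int>/r)\<^sup>\<int>\<^sup>/\<^sup>q \<rtimes> \<int>/q\<close>: the second component of a pair is a \<open>q\<close>-periodic function on
  the integers with values in \<open>{0..<r}\<close>, on which the first component acts by translation.
\<close>

definition wreath :: "nat \<Rightarrow> nat \<Rightarrow> (int \<times> (int \<Rightarrow> int)) monoid" where
  "wreath q r = \<lparr>carrier = {0..<int q} \<times> {f. \<forall>z. f z \<in> {0..<int r} \<and> f (z + int q) = f z},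
     mult = (\<lambda>a b. ((fst a + fst b) mod int q, \<lambda>z. (snd a z + snd b (z + fst a)) mod int r)),
     one = (0, \<lambda>_. 0)\<rparr>"

lemma wreath_carrier:
  "a \<in> carrier (wreath q r) \<longleftrightarrow> 0 \<le> fst a \<and> fst a < int q \<and>
    (\<forall>z. 0 \<le> snd a z \<and> snd a z < int r \<and> snd a (z + int q) = snd a z)"
  by (auto simp: wreath_def mem_Times_iff)

lemma wreath_one: "\<one>\<^bsub>wreath q r\<^esub> = (0, \<lambda>_. 0)"
  by (simp add: wreath_def)

lemma fst_wreath_mult: "fst (a \<otimes>\<^bsub>wreath q r\<^esub> b) = (fst a + fst b) mod int q"
  by (simp add: wreath_def)

lemma snd_wreath_mult: "snd (a \<otimes>\<^bsub>wreath q r\<^esub> b) z = (snd a z + snd b (z + fst a)) mod int r"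
  by (simp add: wreath_def)

lemma periodic_add_mult:
  fixes f :: "int \<Rightarrow> 'a"
  assumes "\<And>z. f (z + h) = f z" shows "f (z + k * h) = f z"
proof -
  have n: "f (z + int n * h) = f z" for z n
  proof (induction n)
    case (Suc n)
    have "f (z + int (Suc n) * h) = f ((z + int n * h) + h)" by (simp add: algebra_simps)
    then show ?case using assms Suc by simp
  qed simp
  show ?thesis
  proof (cases "k \<ge> 0")
    case True
    then show ?thesis using n[of z "nat k"] by simp
  next
    case False
    then show ?thesis using n[of "z + k * h" "nat (- k)"] by simp
  qed
qed

lemma periodic_cong:
  fixes f :: "int \<Rightarrow> 'a"
  assumes "\<And>z. f (z + h) = f z" "[a = b] (mod h)" shows "f a = f b"
proof -
  obtain k where "a = b + k * h" using assms(2) by (metis cong_iff_lin cong_sym mult.commute)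
  then show ?thesis using periodic_add_mult[of f h, OF assms(1)] by simp
qed

lemma wreath_shift_cong:
  assumes "a \<in> carrier (wreath q r)" "[y = z] (mod int q)" shows "snd a y = snd a z"
  using periodic_cong[of "snd a", OF _ assms(2)] assms(1) by (simp add: wreath_carrier)

lemma group_wreath:
  assumes "q > 0" "r > 0"
  shows "group (wreath q r)"
proof (rule groupI)
  show "a \<otimes>\<^bsub>wreath q r\<^esub> b \<in> carrier (wreath q r)"
    if "a \<in> carrier (wreath q r)" "b \<in> carrier (wreath q r)" for a b
  proof -
    have "snd b (z + int q + fst a) = snd b (z + fst a)" for z
      by (rule wreath_shift_cong[OF that(2)]) (simp add: cong_iff_dvd_diff)
    then show ?thesis
      using that assms unfolding wreath_carrier fst_wreath_mult snd_wreath_mult by simp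
  qed
  show "\<one>\<^bsub>wreath q r\<^esub> \<in> carrier (wreath q r)" using assms by (simp add: wreath_carrier wreath_one)
  show "a \<otimes>\<^bsub>wreath q r\<^esub> b \<otimes>\<^bsub>wreath q r\<^esub> c = a \<otimes>\<^bsub>wreath q r\<^esub> (b \<otimes>\<^bsub>wreath q r\<^esub> c)"
    if "a \<in> carrier (wreath q r)" "b \<in> carrier (wreath q r)" "c \<in> carrier (wreath q r)" for a b c
  proof (rule prod_eqI)
    show "fst (a \<otimes>\<^bsub>wreath q r\<^esub> b \<otimes>\<^bsub>wreath q r\<^esub> c) = fst (a \<otimes>\<^bsub>wreath q r\<^esub> (b \<otimes>\<^bsub>wreath q r\<^esub> c))"
      by (simp add: fst_wreath_mult mod_simps add.assoc)
    have "snd c (z + (fst a + fst b) mod int q) = snd c (z + fst a + fst b)" for z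
      by (rule wreath_shift_cong[OF that(3)]) (simp add: cong_def mod_simps add.assoc)
    then show "snd (a \<otimes>\<^bsub>wreath q r\<^esub> b \<otimes>\<^bsub>wreath q r\<^esub> c) = snd (a \<otimes>\<^bsub>wreath q r\<^esub> (b \<otimes>\<^bsub>wreath q r\<^esub> c))"
      by (simp add: fun_eq_iff snd_wreath_mult fst_wreath_mult mod_simps add.assoc)
  qed
  show "\<one>\<^bsub>wreath q r\<^esub> \<otimes>\<^bsub>wreath q r\<^esub> a = a" if "a \<in> carrier (wreath q r)" for a
    using that by (auto simp: wreath_carrier wreath_one fst_wreath_mult snd_wreath_mult prod_eq_iff fun_eq_iff)
  show "\<exists>b\<in>carrier (wreath q r). b \<otimes>\<^bsub>wreath q r\<^esub> a = \<one>\<^bsub>wreath q r\<^esub>"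
    if a: "a \<in> carrier (wreath q r)" for a
  proof
    let ?b = "((- fst a) mod int q, \<lambda>z. (- snd a (z - fst a)) mod int r)"
    have "snd a (z + int q - fst a) = snd a (z - fst a)" for z
      by (rule wreath_shift_cong[OF a]) (simp add: cong_iff_dvd_diff)
    then show "?b \<in> carrier (wreath q r)" using assms by (simp add: wreath_carrier)
    have "snd a (z + (- fst a) mod int q) = snd a (z - fst a)" for z
      by (rule wreath_shift_cong[OF a]) (simp add: cong_def mod_simps)
    then show "?b \<otimes>\<^bsub>wreath q r\<^esub> a = \<one>\<^bsub>wreath q r\<^esub>"
      by (simp add: prod_eq_iff fun_eq_iff snd_wreath_mult fst_wreath_mult wreath_one mod_simps)
  qed
qed

lemma order_wreath:
  assumes "q > 0"
  shows "order (wreath q r) = q * r ^ q"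
proof -
  let ?B = "{0..<int q} \<times> ({0..<int q} \<rightarrow>\<^sub>E {0..<int r})"
  have mod: "snd a (z mod int q) = snd a z" if "a \<in> carrier (wreath q r)" for a z
    by (rule wreath_shift_cong[OF that]) (simp add: cong_def)
  have "bij_betw (\<lambda>a. (fst a, restrict (snd a) {0..<int q})) (carrier (wreath q r)) ?B"
  proof (rule bij_betwI[where g = "\<lambda>b. (fst b, \<lambda>z. snd b (z mod int q))"])
    show "(\<lambda>a. (fst a, restrict (snd a) {0..<int q})) \<in> carrier (wreath q r) \<rightarrow> ?B"
      by (auto simp: wreath_carrier)
    show "(\<lambda>b. (fst b, \<lambda>z. snd b (z mod int q))) \<in> ?B \<rightarrow> carrier (wreath q r)"
      using assms by (fastforce simp: wreath_carrier PiE_iff)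
    show "(fst (fst a, restrict (snd a) {0..<int q}), \<lambda>z. snd (fst a, restrict (snd a) {0..<int q}) (z mod int q)) = a"
      if "a \<in> carrier (wreath q r)" for a
      using mod[OF that] assms by (auto simp: prod_eq_iff fun_eq_iff)
    show "(fst (fst b, \<lambda>z. snd b (z mod int q)), restrict (snd (fst b, \<lambda>z. snd b (z mod int q))) {0..<int q}) = b"
      if "b \<in> ?B" for b
      using that by (auto simp: prod_eq_iff fun_eq_iff PiE_iff extensional_def restrict_def)
  qed
  then have "card (carrier (wreath q r)) = card ?B" by (rule bij_betw_same_card)
  then show ?thesis by (simp add: order_def card_cartesian_product card_PiE)
qed

lemma fst_hom_wreath: "q > 0 \<Longrightarrow> fst \<in> hom (wreath q r) (integer_mod_group q)"
  by (auto simp: hom_def fst_wreath_mult wreath_carrier carrier_integer_mod_group)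

lemma fst_wreath_pow:
  assumes "a \<in> carrier (wreath q r)"
  shows "fst (a [^]\<^bsub>wreath q r\<^esub> (n::nat)) = (int n * fst a) mod int q"
  by (induction n) (simp_all add: wreath_one fst_wreath_mult mod_simps algebra_simps nat_pow_def)

text \<open>The Fox derivative of a power: D a multiplied by 1 + t + ... + t^(n-1), where t is the
  translation by which a acts.\<close>

lemma snd_wreath_pow:
  assumes a: "a \<in> carrier (wreath q r)"
  shows "snd (a [^]\<^bsub>wreath q r\<^esub> (n::nat)) z = (\<Sum>j<n. snd a (z + int j * fst a)) mod int r"
proof (induction n)
  case (Suc n)
  have "snd a (z + int n * fst a mod int q) = snd a (z + int n * fst a)"
    by (rule wreath_shift_cong[OF a]) (simp add: cong_def mod_simps)
  then show ?case using Suc fst_wreath_pow[OF a, of n]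
    by (simp add: snd_wreath_mult mod_simps nat_pow_def)
qed (simp add: wreath_one nat_pow_def)

text \<open>Comparing components in b a [a,b] = a b avoids inverses; the argument
  \<open>z + fst a + fst b\<close> comes from the action of b a on the base component of
  [a,b].\<close>

lemma wreath_commutator:
  assumes q: "q > 0" "r > 0" and a: "a \<in> carrier (wreath q r)" and b: "b \<in> carrier (wreath q r)"
  shows "fst (commutator (wreath q r) a b) = 0"
    and "[snd (commutator (wreath q r) a b) (z + fst a + fst b) =
      snd a z - snd a (z + fst b) + snd b (z + fst a) - snd b z] (mod int r)"
proof -
  interpret W: group "wreath q r" by (rule group_wreath[OF q])
  let ?c = "commutator (wreath q r) a b"
  have c: "?c \<in> carrier (wreath q r)" using a b by (simp add: commutator_def)
  have eq: "(b \<otimes>\<^bsub>wreath q r\<^esub> a) \<otimes>\<^bsub>wreath q r\<^esub> ?c = a \<otimes>\<^bsub>wreath q r\<^esub> b"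
  proof -
    have "a \<otimes>\<^bsub>wreath q r\<^esub> (inv\<^bsub>wreath q r\<^esub> a \<otimes>\<^bsub>wreath q r\<^esub> y) = y"
      "b \<otimes>\<^bsub>wreath q r\<^esub> (inv\<^bsub>wreath q r\<^esub> b \<otimes>\<^bsub>wreath q r\<^esub> y) = y" if "y \<in> carrier (wreath q r)" for y
      using that a b by (simp_all add: W.m_assoc[symmetric])
    then show ?thesis using a b by (simp add: commutator_def W.m_assoc)
  qed
  have f: "((fst b + fst a) mod int q + fst ?c) mod int q = (fst a + fst b) mod int q"
    using arg_cong[OF eq, of fst] by (simp add: fst_wreath_mult)
  then have "[fst a + fst b + fst ?c = fst a + fst b + 0] (mod int q)"
    by (simp add: cong_def mod_simps add.commute)
  then have "[fst ?c = 0] (mod int q)" by (simp only: cong_add_lcancel)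
  then show "fst ?c = 0" using c by (simp add: cong_def wreath_carrier)
  have s: "((snd b z + snd a (z + fst b)) mod int r + snd ?c (z + (fst b + fst a) mod int q)) mod int r =
      (snd a z + snd b (z + fst a)) mod int r"
    using arg_cong[OF eq, of "\<lambda>u. snd u z"] by (simp add: fst_wreath_mult snd_wreath_mult)
  have sh: "snd ?c (z + (fst b + fst a) mod int q) = snd ?c (z + fst a + fst b)"
    by (rule wreath_shift_cong[OF c]) (simp add: cong_def mod_simps algebra_simps)
  have "[(snd b z + snd a (z + fst b)) + snd ?c (z + fst a + fst b) = snd a z + snd b (z + fst a)] (mod int r)"
    using s unfolding sh cong_def by (simp add: mod_simps)
  from cong_diff[OF this cong_refl[of "snd b z + snd a (z + fst b)"]]
  show "[snd ?c (z + fst a + fst b) = snd a z - snd a (z + fst b) + snd b (z + fst a) - snd b z] (mod int r)"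
    by (simp add: algebra_simps)
qed

lemma wreath_list_mult:
  assumes "\<And>g. g \<in> set gs \<Longrightarrow> fst g = 0"
  shows "fst (list_mult (wreath q r) gs) = 0"
    and "snd (list_mult (wreath q r) gs) z = (\<Sum>g\<leftarrow>gs. snd g z) mod int r"
  using assms
  by (induction gs) (auto simp: list_mult_def wreath_one fst_wreath_mult snd_wreath_mult mod_simps)

section \<open>Words in powers and commutators, and their images under homomorphisms\<close>

lemma (in group) list_mult_closed: "set gs \<subseteq> carrier G \<Longrightarrow> list_mult G gs \<in> carrier G"
  by (induction gs) (auto simp: list_mult_def)

lemma (in group_hom) hom_list_mult:
  "set gs \<subseteq> carrier G \<Longrightarrow> h (list_mult G gs) = list_mult H (map h gs)"
proof (induction gs)
  case (Cons g gs)
  then have "foldr (\<otimes>) gs \<one> \<in> carrier G" using G.list_mult_closed[of gs] by (simp add: list_mult_def)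
  then show ?case using Cons by (simp add: list_mult_def)
qed (simp add: list_mult_def)

lemma (in group) commutator_closed: "a \<in> carrier G \<Longrightarrow> b \<in> carrier G \<Longrightarrow> commutator G a b \<in> carrier G"
  by (simp add: commutator_def)

lemma (in group_hom) hom_commutator:
  "a \<in> carrier G \<Longrightarrow> b \<in> carrier G \<Longrightarrow> h (commutator G a b) = commutator H (h a) (h b)"
  by (simp add: commutator_def)

lemma (in comm_group) commutator_one:
  assumes "a \<in> carrier G" "b \<in> carrier G" shows "commutator G a b = \<one>"
proof -
  have "inv a \<otimes> inv b = inv (a \<otimes> b)" using assms by (simp add: inv_mult)
  then show ?thesis using assms by (simp add: commutator_def m_assoc)
qed

lemma (in group) list_mult_one: "set gs \<subseteq> {\<one>} \<Longrightarrow> list_mult G gs = \<one>"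
  by (induction gs) (auto simp: list_mult_def)

text \<open>One shape for the words of all four parts: \<open>u\<close> supplies the powers, while
  \<open>a\<close> and \<open>b\<close> are generators in the almost primitive case and p-adic
  powers of generators in the test case. \<open>u\<close> is indexed from 1, \<open>a\<close> and
  \<open>b\<close> from 0.\<close>

definition surface_word :: "('a, 'c) monoid_scheme \<Rightarrow> nat \<Rightarrow> nat \<Rightarrow> (nat \<Rightarrow> 'a) \<Rightarrow> (nat \<Rightarrow> 'a) \<Rightarrow> (nat \<Rightarrow> 'a) \<Rightarrow> 'a" where
  "surface_word G n k u a b = list_mult G
    (map u [1..<n + 1] @ map (\<lambda>j. commutator G (a j) (b j)) [0..<k])"

lemma (in group) surface_word_closed:
  assumes "\<And>i. i \<in> {1..n} \<Longrightarrow> u i \<in> carrier G" "\<And>j. j < k \<Longrightarrow> a j \<in> carrier G" "\<And>j. j < k \<Longrightarrow> b j \<in> carrier G"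
  shows "surface_word G n k u a b \<in> carrier G"
  unfolding surface_word_def by (rule list_mult_closed) (use assms in \<open>auto simp: commutator_closed\<close>)

lemma (in group_hom) hom_surface_word:
  assumes "\<And>i. i \<in> {1..n} \<Longrightarrow> u i \<in> carrier G" "\<And>j. j < k \<Longrightarrow> a j \<in> carrier G" "\<And>j. j < k \<Longrightarrow> b j \<in> carrier G"
  shows "h (surface_word G n k u a b) = surface_word H n k (h \<circ> u) (h \<circ> a) (h \<circ> b)"
proof -
  have "set (map u [1..<n + 1] @ map (\<lambda>j. commutator G (a j) (b j)) [0..<k]) \<subseteq> carrier G"
    using assms by (auto simp: G.commutator_closed)
  note hom_list_mult[OF this]
  moreover have "map (\<lambda>j. h (commutator G (a j) (b j))) [0..<k] = map (\<lambda>j. commutator H (h (a j)) (h (b j))) [0..<k]"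
    using assms by (simp add: hom_commutator)
  ultimately show ?thesis unfolding surface_word_def by (simp add: o_def del: upt_Suc)
qed

text \<open>All factors lie in the abelian base group, where multiplication is pointwise
  addition.\<close>

lemma snd_wreath_surface_word:
  assumes q: "q > 0" "r > 0" and u: "\<And>i. i \<in> {1..n} \<Longrightarrow> fst (u i) = 0"
    and ab: "\<And>j. j < k \<Longrightarrow> a j \<in> carrier (wreath q r)" "\<And>j. j < k \<Longrightarrow> b j \<in> carrier (wreath q r)"
  shows "[snd (surface_word (wreath q r) n k u a b) z =
    (\<Sum>i=1..n. snd (u i) z) + (\<Sum>j<k. snd (commutator (wreath q r) (a j) (b j)) z)] (mod int r)"
proof -
  have "snd (surface_word (wreath q r) n k u a b) z =
    (\<Sum>g\<leftarrow>map u [1..<n + 1] @ map (\<lambda>j. commutator (wreath q r) (a j) (b j)) [0..<k]. snd g z) mod int r"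
    unfolding surface_word_def
  proof (rule wreath_list_mult)
    have "fst (commutator (wreath q r) (a j) (b j)) = 0" if "j < k" for j
      by (rule wreath_commutator(1)[OF q ab(1)[OF that] ab(2)[OF that]])
    then show "fst g = 0" if "g \<in> set (map u [1..<n + 1] @ map (\<lambda>j. commutator (wreath q r) (a j) (b j)) [0..<k])" for g
      using that u by (auto simp del: upt_Suc)
  qed
  also have "\<dots> = ((\<Sum>i=1..n. snd (u i) z) + (\<Sum>j<k. snd (commutator (wreath q r) (a j) (b j)) z)) mod int r"
    by (simp add: o_def interv_sum_list_conv_sum_set_nat atLeastLessThanSuc_atLeastAtMost lessThan_atLeast0
        del: upt_Suc)
  finally show ?thesis by (simp add: cong_def)
qed

section \<open>Almost primitive words\<close>

lemma (in pro_p_group) char_surface_word: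
  assumes \<xi>: "\<xi> \<in> chars"
    and u: "\<And>i. i \<in> {1..n} \<Longrightarrow> u i \<in> carrier G \<and> \<xi> (u i) = 0"
    and ab: "\<And>j. j < k \<Longrightarrow> a j \<in> carrier G" "\<And>j. j < k \<Longrightarrow> b j \<in> carrier G"
  shows "\<xi> (surface_word G n k u a b) = 0"
proof -
  let ?Z = "integer_mod_group p"
  interpret \<xi>: group_hom G ?Z \<xi> by (rule char_hom[OF \<xi>])
  interpret Z: comm_group ?Z by simp
  have "\<xi> (surface_word G n k u a b) = surface_word ?Z n k (\<xi> \<circ> u) (\<xi> \<circ> a) (\<xi> \<circ> b)"
    by (rule \<xi>.hom_surface_word) (use u ab in auto)
  also have "\<dots> = \<one>\<^bsub>?Z\<^esub>"
    unfolding surface_word_def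
    by (rule \<xi>.H.list_mult_one) (use u ab Z.commutator_one \<xi>.hom_closed in auto)
  finally show ?thesis by simp
qed

lemma order_integer_mod_group: "q > 0 \<Longrightarrow> order (integer_mod_group q) = q"
  by (simp add: order_def carrier_integer_mod_group)

lemma (in pro_p_group) char_padic_pow:
  assumes "\<xi> \<in> chars" "y \<in> carrier G" "\<alpha> \<in> carrier (padic_ints p)" "\<alpha> 1 = 0"
  shows "\<xi> (padic_pow G T y \<alpha>) = 0"
proof -
  have "\<xi> (padic_pow G T y \<alpha>) = \<xi> y [^]\<^bsub>integer_mod_group p\<^esub> nat (\<alpha> 1)"
    by (rule open_hom_padic_pow[OF assms(1) _ _ assms(2,3)])
      (simp_all add: order_integer_mod_group prime_gt_0_nat[OF prime_p])
  then show ?thesis using assms(4) by simp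
qed

lemma sum_periodic:
  fixes f :: "nat \<Rightarrow> 'a::comm_semiring_1"
  assumes "\<And>j. f (j + p) = f j"
  shows "(\<Sum>j<p * b. f j) = of_nat b * (\<Sum>j<p. f j)"
proof -
  have f: "f (j + m * p) = f j" for j m
    by (induction m) (use assms[of "j + _ * p"] in \<open>simp_all add: algebra_simps\<close>)
  have "(\<Sum>j<p * b. f j) = (\<Sum>m<b. sum f {m * p..<m * p + p})"
    by (subst sum.nat_group) (simp add: mult.commute)
  also have "sum f {m * p..<m * p + p} = (\<Sum>j<p. f j)" for m
    using sum.shift_bounds_nat_ivl[of f 0 "m * p" p] f by (simp add: lessThan_atLeast0 add.commute)
  then have "(\<Sum>m<b. sum f {m * p..<m * p + p}) = (\<Sum>m<b. \<Sum>j<p. f j)" by simp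
  finally show ?thesis by simp
qed

context free_pro_p
begin

text \<open>The order of this wreath product is p^(N + L p^N), so freeness applies.\<close>

lemma wreath_hom:
  assumes w: "\<And>i. i \<in> {1..m} \<Longrightarrow> w i \<in> carrier (wreath (p ^ N) (p ^ L))"
  obtains \<rho> where "\<rho> \<in> open_homs G T (wreath (p ^ N) (p ^ L))" "\<And>i. i \<in> {1..m} \<Longrightarrow> \<rho> (x i) = w i"
proof -
  have pos: "0 < p ^ i" for i using prime_gt_0_nat[OF prime_p] by simp
  have "order (wreath (p ^ N) (p ^ L)) = p ^ (N + L * p ^ N)"
    unfolding order_wreath[OF pos] by (simp add: power_add power_mult)
  from open_hom_exists[OF group_wreath[OF pos pos] this, of w] show ?thesis using w that by blast
qed

text \<open>Evaluation at z is additive on the base group, into which \<rho> maps H; so it gives a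
  character of H, and this character is nonzero at g.\<close>

lemma proper_subgroup_primitive:
  assumes H: "subgroup H G" "closedin T H" "g \<in> H"
    and \<rho>: "\<rho> \<in> open_homs G T (wreath q p)" "q > 0" "\<And>h. h \<in> H \<Longrightarrow> fst (\<rho> h) = 0" "snd (\<rho> g) z \<noteq> 0"
  shows "primitive_element (G\<lparr>carrier := H\<rparr>) (subtopology T H) g"
proof -
  have p0: "p > 0" using prime_gt_0_nat[OF prime_p] .
  interpret W: group "wreath q p" by (rule group_wreath[OF \<rho>(2) p0])
  interpret H: subgroup H G by (rule H)
  interpret \<rho>: group_hom G "wreath q p" \<rho>
    using open_homsD(1)[OF \<rho>(1)] by unfold_locales
  interpret HP: pro_p_group p "G\<lparr>carrier := H\<rparr>" "subtopology T H" by (rule closed_subgroup_pro_p[OF H(1,2)])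
  define \<xi> where "\<xi> h = snd (\<rho> h) z" for h
  have "\<xi> \<in> open_homs (G\<lparr>carrier := H\<rparr>) (subtopology T H) (integer_mod_group p)"
  proof -
    have "\<xi> \<in> hom (G\<lparr>carrier := H\<rparr>) (integer_mod_group p)"
    proof (rule homI)
      fix h assume "h \<in> carrier (G\<lparr>carrier := H\<rparr>)"
      then have "\<rho> h \<in> carrier (wreath q p)" by simp
      then show "\<xi> h \<in> carrier (integer_mod_group p)"
        using p0 unfolding \<xi>_def by (simp add: wreath_carrier carrier_integer_mod_group)
    qed (use \<rho>(3) in \<open>simp add: \<xi>_def snd_wreath_mult\<close>)
    moreover have "kernel (G\<lparr>carrier := H\<rparr>) (integer_mod_group p) \<xi> = {x \<in> carrier G. \<rho> x \<in> {a. snd a z = 0}} \<inter> H"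
      by (auto simp: kernel_def \<xi>_def)
    then have "openin (subtopology T H) (kernel (G\<lparr>carrier := H\<rparr>) (integer_mod_group p) \<xi>)"
      by (simp only: openin_subtopology_Int[OF open_hom_openin[OF \<rho>(1) W.is_group]])
    ultimately show ?thesis by (simp add: open_homs_def)
  qed
  then show ?thesis using HP.primitive_if_char_nonzero[of \<xi> g] H(3) \<rho>(4) by (simp add: \<xi>_def)
qed

end

lemma sum_only:
  fixes f :: "nat \<Rightarrow> int"
  assumes "finite A" "i \<in> A" "\<And>j. j \<in> A \<Longrightarrow> j \<noteq> i \<Longrightarrow> f j = 0" shows "sum f A = f i"
  using assms by (simp add: sum.remove[OF assms(1,2)])

text \<open>Primitivity in G fails because characters kill p-th powers and commutators. For a proper
  H, a character \<theta> that kills H is nonzero at some x_i. The indicator \<delta> of the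
  multiples of p is placed at x_i if i <= n and at the commutator partner of x_i otherwise, all
  other base components being 0; some coordinate of the word is then a unit modulo p.\<close>

lemma (in free_pro_p) almost_primitive_surface_word:
  assumes m: "m = n + 2 * k"
    and \<alpha>: "\<And>i. i \<in> {1..n} \<Longrightarrow> \<alpha> i \<in> padic_multiples p p - padic_multiples p (p ^ 2)"
  shows "almost_primitive_element G T (surface_word G n k (\<lambda>i. padic_pow G T (x i) (\<alpha> i))
    (\<lambda>j. x (n + 2 * j + 1)) (\<lambda>j. x (n + 2 * j + 2)))"
    (is "almost_primitive_element G T (surface_word G n k ?u ?a ?b)")
proof -
  let ?g = "surface_word G n k ?u ?a ?b"
  have p0: "p > 0" using prime_gt_0_nat[OF prime_p] .
  have \<alpha>c: "\<alpha> i \<in> carrier (padic_ints p)" and \<alpha>1: "\<alpha> i 1 = 0" and \<alpha>2: "\<alpha> i 2 \<noteq> 0" if "i \<in> {1..n}" for i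
    using \<alpha>[OF that] padic_multiples_power[OF prime_p, of 1] padic_multiples_power[OF prime_p, of 2] by auto
  have xc: "i \<in> {1..n} \<Longrightarrow> x i \<in> carrier G" for i using gens_closed m by simp
  have ac: "j < k \<Longrightarrow> ?a j \<in> carrier G" and bc: "j < k \<Longrightarrow> ?b j \<in> carrier G" for j
    using gens_closed m by simp_all
  have uc: "i \<in> {1..n} \<Longrightarrow> ?u i \<in> carrier G" for i using padic_pow_closed[OF xc \<alpha>c] .
  have gc: "?g \<in> carrier G" by (rule surface_word_closed) (use uc ac bc in auto)
  have "\<not> primitive_element G T ?g"
  proof (rule not_primitive_if_chars_vanish)
    fix \<xi> assume \<xi>: "\<xi> \<in> chars"
    show "\<xi> ?g = 0"
      by (rule char_surface_word[OF \<xi> _ ac bc]) (use uc char_padic_pow[OF \<xi> xc \<alpha>c \<alpha>1] in auto)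
  qed
  moreover have "primitive_element (G\<lparr>carrier := H\<rparr>) (subtopology T H) ?g"
    if H: "subgroup H G" "closedin T H" "H \<noteq> carrier G" "?g \<in> H" for H
  proof -
    obtain \<theta> c where \<theta>: "\<theta> \<in> chars" "\<And>h. h \<in> H \<Longrightarrow> \<theta> h = 0" "c \<in> carrier G" "\<theta> c \<noteq> 0"
      using proper_closed_subgroup_char[OF H(1-3)] by metis
    have \<theta>c: "0 \<le> \<theta> (x i) \<and> \<theta> (x i) < int p" if "i \<in> {1..m}" for i
      using char_range[OF \<theta>(1) gens_closed[OF that]] .
    have "x ` {1..m} \<subseteq> carrier G" using gens_closed by blast
    from topologically_generates_iff[OF this] generators_generate \<theta>
    obtain i where i: "i \<in> {1..m}" "\<theta> (x i) \<noteq> 0" by blast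
    have nd: "\<not> int p dvd \<theta> (x i)" using \<theta>c[OF i(1)] i(2) by (auto dest: zdvd_imp_le)
    define \<delta> where "\<delta> z = (if int p dvd z then 1 else 0 :: int)" for z
    define W where "W = wreath p p"
    have W: "group W" unfolding W_def by (rule group_wreath[OF p0 p0])
    have ordW: "order W = p ^ (1 + p)" unfolding W_def order_wreath[OF p0] by simp
    have ex: "\<exists>\<rho>. \<rho> \<in> open_homs G T W \<and>
        (\<forall>l\<in>{1..m}. fst (\<rho> (x l)) = \<theta> (x l) \<and> snd (\<rho> (x l)) = (if l = i' then \<delta> else (\<lambda>_. 0))) \<and>
        (\<forall>y\<in>carrier G. fst (\<rho> y) = \<theta> y \<and> \<rho> y \<in> carrier W)" for i'
    proof -
      define w where "w l = (\<theta> (x l), if l = i' then \<delta> else (\<lambda>_. 0))" for l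
      have "w l \<in> carrier (wreath (p ^ 1) (p ^ 1))" if "l \<in> {1..m}" for l
        using \<theta>c[OF that] prime_gt_1_nat[OF prime_p] by (auto simp: w_def wreath_carrier \<delta>_def)
      then obtain \<rho> where \<rho>: "\<rho> \<in> open_homs G T (wreath (p ^ 1) (p ^ 1))"
          "\<And>l. l \<in> {1..m} \<Longrightarrow> \<rho> (x l) = w l"
        using wreath_hom[of w 1 1] by metis
      have \<rho>W: "\<rho> \<in> open_homs G T W" using \<rho>(1) by (simp add: W_def)
      have "fst \<circ> \<rho> \<in> chars"
        by (rule open_homs_compose[OF \<rho>W _ W]) (use fst_hom_wreath[OF p0] in \<open>simp_all add: W_def\<close>)
      then have "(fst \<circ> \<rho>) y = \<theta> y" if "y \<in> carrier G" for y
        by (rule open_hom_ext[OF group_integer_mod_group _ \<theta>(1) _ that]) (simp add: \<rho>(2) w_def)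
      moreover have "\<rho> y \<in> carrier W" if "y \<in> carrier G" for y
        using open_homsD(1)[OF \<rho>W] that by (auto simp: hom_def)
      ultimately show ?thesis using \<rho>W \<rho>(2) by (intro exI[of _ \<rho>]) (auto simp: w_def)
    qed
    have conclude: ?thesis if \<rho>: "\<rho> \<in> open_homs G T W" "\<forall>y\<in>carrier G. fst (\<rho> y) = \<theta> y"
      and "snd (\<rho> ?g) z \<noteq> 0" for \<rho> z
    proof (rule proper_subgroup_primitive[OF H(1,2,4) \<rho>(1)[unfolded W_def] p0])
      show "fst (\<rho> h) = 0" if "h \<in> H" for h
        using \<rho>(2) \<theta>(2) that subgroup.mem_carrier[OF H(1)] by simp
    qed fact
    have word: "[snd (\<rho> ?g) z = (\<Sum>l=1..n. snd (\<rho> (?u l)) z) +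
        (\<Sum>j<k. snd (commutator W (\<rho> (?a j)) (\<rho> (?b j))) z)] (mod int p)"
      if \<rho>: "\<rho> \<in> open_homs G T W" "\<forall>y\<in>carrier G. fst (\<rho> y) = \<theta> y \<and> \<rho> y \<in> carrier W" for \<rho> z
    proof -
      interpret \<rho>: group_hom G W \<rho>
        using open_homsD(1)[OF \<rho>(1)] W by (simp add: group_hom_def group_hom_axioms_def)
      have "\<rho> ?g = surface_word W n k (\<rho> \<circ> ?u) (\<rho> \<circ> ?a) (\<rho> \<circ> ?b)"
        by (rule \<rho>.hom_surface_word) (use uc ac bc in auto)
      moreover have "fst (\<rho> (?u l)) = 0" if "l \<in> {1..n}" for l
        using \<rho>(2) uc[OF that] char_padic_pow[OF \<theta>(1) xc[OF that] \<alpha>c[OF that] \<alpha>1[OF that]] by simp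
      ultimately show ?thesis
        using snd_wreath_surface_word[OF p0 p0, of n "\<rho> \<circ> ?u" k "\<rho> \<circ> ?a" "\<rho> \<circ> ?b" z] \<rho>(2) ac bc
        by (simp add: W_def)
    qed
    have pow0: "snd (\<rho> (?u l)) z = (\<Sum>j<nat (\<alpha> l (1 + p)). snd (\<rho> (x l)) (z + int j * \<theta> (x l))) mod int p"
      if \<rho>: "\<rho> \<in> open_homs G T W" "\<forall>y\<in>carrier G. fst (\<rho> y) = \<theta> y \<and> \<rho> y \<in> carrier W" and l: "l \<in> {1..n}" for \<rho> l z
    proof -
      have "\<rho> (?u l) = \<rho> (x l) [^]\<^bsub>W\<^esub> nat (\<alpha> l (1 + p))"
        by (rule open_hom_padic_pow[OF \<rho>(1) W ordW xc[OF l] \<alpha>c[OF l]])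
      then show ?thesis
        using snd_wreath_pow[of "\<rho> (x l)" p p "nat (\<alpha> l (1 + p))" z] \<rho>(2) xc[OF l] by (simp add: W_def)
    qed
    have comm: "[snd (commutator W (\<rho> (?a j)) (\<rho> (?b j))) (z + \<theta> (?a j) + \<theta> (?b j)) =
        snd (\<rho> (?a j)) z - snd (\<rho> (?a j)) (z + \<theta> (?b j)) + snd (\<rho> (?b j)) (z + \<theta> (?a j)) - snd (\<rho> (?b j)) z] (mod int p)"
      if \<rho>: "\<forall>y\<in>carrier G. fst (\<rho> y) = \<theta> y \<and> \<rho> y \<in> carrier W" and j: "j < k" for \<rho> j z
      using wreath_commutator(2)[OF p0 p0, of "\<rho> (?a j)" "\<rho> (?b j)" z] \<rho> ac[OF j] bc[OF j] by (simp add: W_def)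
    have comm0: "snd (commutator W (\<rho> (?a j)) (\<rho> (?b j))) z = 0"
      if \<rho>: "\<forall>y\<in>carrier G. fst (\<rho> y) = \<theta> y \<and> \<rho> y \<in> carrier W" and j: "j < k"
        and 0: "snd (\<rho> (?a j)) = (\<lambda>_. 0)" "snd (\<rho> (?b j)) = (\<lambda>_. 0)" for \<rho> j z
    proof -
      have "commutator W (\<rho> (?a j)) (\<rho> (?b j)) \<in> carrier W"
        using group.commutator_closed[OF W] \<rho> ac[OF j] bc[OF j] by simp
      then show ?thesis
        using comm[OF \<rho> j, of "z - \<theta> (?a j) - \<theta> (?b j)"] unfolding 0
        by (auto simp: cong_def wreath_carrier W_def)
    qed
    show ?thesis
    proof (cases "i \<le> n")
      case True
      then have iN: "i \<in> {1..n}" using i by simp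
      obtain \<rho> where \<rho>: "\<rho> \<in> open_homs G T W" "\<forall>y\<in>carrier G. fst (\<rho> y) = \<theta> y \<and> \<rho> y \<in> carrier W"
        and sn: "\<And>l. l \<in> {1..m} \<Longrightarrow> snd (\<rho> (x l)) = (if l = i then \<delta> else (\<lambda>_. 0))"
        using ex[of i] by blast
      \<comment> \<open>W has order p^(1+p), so e is the exponent that W sees. Because 1 + p >= 2,
        it still has p-adic valuation exactly 1.\<close>
      define e where "e = nat (\<alpha> i (1 + p))"
      have e: "int e = \<alpha> i (1 + p)" using \<alpha>c[OF iN] by (simp add: e_def padic_carrier)
      have "int e mod int p ^ 1 = 0" "int e mod int p ^ 2 \<noteq> 0"
        unfolding e using padic_mod[OF \<alpha>c[OF iN], of 1 "1 + p"] padic_mod[OF \<alpha>c[OF iN], of 2 "1 + p"]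
          \<alpha>1[OF iN] \<alpha>2[OF iN] prime_gt_1_nat[OF prime_p] by simp_all
      then have "int p dvd int e" "\<not> int p ^ 2 dvd int e" by (simp_all add: dvd_eq_mod_eq_0)
      then have "p dvd e" "\<not> p ^ 2 dvd e" by (metis of_nat_dvd_iff, metis of_nat_dvd_iff of_nat_power)
      then obtain f where f: "e = p * f" "\<not> p dvd f" by (auto simp: power2_eq_square)
      \<comment> \<open>As \<theta>(x_i) is a unit modulo p, a full turn of the translation meets
        the support of \<delta> exactly once.\<close>
      have "(\<Sum>j<p. \<delta> (int j * \<theta> (x i))) = \<delta> (int 0 * \<theta> (x i))"
      proof (rule sum_only)
        fix j assume "j \<in> {..<p}" "j \<noteq> 0"
        then have "\<not> int p dvd int j" by (auto dest: zdvd_imp_le)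
        then show "\<delta> (int j * \<theta> (x i)) = 0"
          using nd prime_p by (simp add: \<delta>_def prime_dvd_mult_iff)
      qed (use p0 in auto)
      moreover have "(\<Sum>j<e. \<delta> (0 + int j * \<theta> (x i))) = of_nat f * (\<Sum>j<p. \<delta> (int j * \<theta> (x i)))"
        unfolding f(1) add_0_left
      proof (rule sum_periodic)
        show "\<delta> (int (j + p) * \<theta> (x i)) = \<delta> (int j * \<theta> (x i))" for j
          by (simp add: \<delta>_def distrib_right dvd_add_left_iff)
      qed
      ultimately have "snd (\<rho> (?u i)) 0 = int f mod int p"
        using pow0[OF \<rho> iN, of 0] sn[OF i(1)] by (simp add: \<delta>_def e_def)
      moreover have "(\<Sum>l=1..n. snd (\<rho> (?u l)) 0) = snd (\<rho> (?u i)) 0"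
      proof (rule sum_only)
        fix l assume "l \<in> {1..n}" "l \<noteq> i"
        then show "snd (\<rho> (?u l)) 0 = 0" using pow0[OF \<rho>, of l 0] sn[of l] m by simp
      qed (use iN in auto)
      moreover have "(\<Sum>j<k. snd (commutator W (\<rho> (?a j)) (\<rho> (?b j))) 0) = 0"
        by (rule sum.neutral) (use comm0[OF \<rho>(2)] sn iN m in auto)
      ultimately have "[snd (\<rho> ?g) 0 = int f] (mod int p)"
        using word[OF \<rho>, of 0] by (simp add: cong_def)
      then have "snd (\<rho> ?g) 0 \<noteq> 0"
        using f(2) by (metis cong_0_iff cong_sym of_nat_dvd_iff)
      then show ?thesis using conclude \<rho> by blast
    next
      case False
      \<comment> \<open>Beyond n the generators are paired as n + 2j + 1 and n + 2j + 2;
        \<open>i'\<close> is the partner of i.\<close>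
      define j where "j = (i - n - 1) div 2"
      have "i = n + 2 * j + 1 \<or> i = n + 2 * j + 2" and jk: "j < k" unfolding j_def using False i m by auto
      then obtain i' where i': "(i = n + 2 * j + 1 \<and> i' = n + 2 * j + 2) \<or> (i = n + 2 * j + 2 \<and> i' = n + 2 * j + 1)"
        by blast
      obtain \<rho> where \<rho>: "\<rho> \<in> open_homs G T W" "\<forall>y\<in>carrier G. fst (\<rho> y) = \<theta> y \<and> \<rho> y \<in> carrier W"
        and sn: "\<And>l. l \<in> {1..m} \<Longrightarrow> snd (\<rho> (x l)) = (if l = i' then \<delta> else (\<lambda>_. 0))"
        using ex[of i'] by blast
      \<comment> \<open>At this argument the commutator formula has base point 0, where \<delta> is
        1, and compares it with \<theta>(x_i), where \<delta> is 0.\<close>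
      define z where "z = \<theta> (?a j) + \<theta> (?b j)"
      have "(\<Sum>l=1..n. snd (\<rho> (?u l)) z) = 0"
        by (rule sum.neutral) (use pow0[OF \<rho>] sn i' m in auto)
      moreover have "(\<Sum>j<k. snd (commutator W (\<rho> (?a j)) (\<rho> (?b j))) z) = snd (commutator W (\<rho> (?a j)) (\<rho> (?b j))) z"
        by (rule sum_only) (use jk comm0[OF \<rho>(2)] sn i' m in \<open>auto simp del: One_nat_def\<close>)
      ultimately have "[snd (\<rho> ?g) z = snd (\<rho> (?a j)) 0 - snd (\<rho> (?a j)) (\<theta> (?b j)) + snd (\<rho> (?b j)) (\<theta> (?a j)) - snd (\<rho> (?b j)) 0] (mod int p)"
        using word[OF \<rho>, of z] comm[OF \<rho>(2) jk, of 0] cong_trans by (simp add: z_def)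
      moreover have "snd (\<rho> (?a j)) 0 - snd (\<rho> (?a j)) (\<theta> (?b j)) + snd (\<rho> (?b j)) (\<theta> (?a j)) - snd (\<rho> (?b j)) 0 \<in> {1, - 1}"
      proof -
        have \<delta>: "\<delta> 0 = 1" "\<delta> (\<theta> (x i)) = 0" using nd by (simp_all add: \<delta>_def)
        have sa: "snd (\<rho> (?a j)) = (if n + 2 * j + 1 = i' then \<delta> else (\<lambda>_. 0))"
          and sb: "snd (\<rho> (?b j)) = (if n + 2 * j + 2 = i' then \<delta> else (\<lambda>_. 0))"
          by (rule sn, use jk m in simp)+
        from i' show ?thesis unfolding sa sb using \<delta> by (elim disjE conjE) simp_all
      qed
      ultimately have "[snd (\<rho> ?g) z = 1] (mod int p) \<or> [snd (\<rho> ?g) z = - 1] (mod int p)"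
        by (elim insertE emptyE) (simp_all only: simp_thms)
      then have "snd (\<rho> ?g) z \<noteq> 0"
        using prime_gt_1_nat[OF prime_p] by (auto simp: cong_iff_dvd_diff)
      then show ?thesis using conclude \<rho> by blast
    qed
  qed
  ultimately show ?thesis unfolding almost_primitive_element_def using gc by blast
qed

section \<open>Endomorphisms\<close>

text \<open>By the pigeonhole principle the iterates on S are eventually periodic; an index beyond
  the preperiod that is a multiple of the period gives an idempotent.\<close>

lemma finite_idempotent_iterate:
  assumes fin: "finite S" and F: "F ` S \<subseteq> S"
  obtains n :: nat where "n > 0" "\<And>w. w \<in> S \<Longrightarrow> (F ^^ n) ((F ^^ n) w) = (F ^^ n) w"
proof -
  have cl: "(F ^^ n) w \<in> S" if "w \<in> S" for n w
    by (induction n) (use that F in auto)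
  have "range (\<lambda>n. restrict (F ^^ n) S) \<subseteq> S \<rightarrow>\<^sub>E S" using cl by auto
  then have "finite (range (\<lambda>n. restrict (F ^^ n) S))" using fin finite_PiE finite_subset by metis
  then have "\<not> inj (\<lambda>n. restrict (F ^^ n) S)" using finite_imageD infinite_UNIV_nat by blast
  then obtain i j where "i \<noteq> j" "restrict (F ^^ i) S = restrict (F ^^ j) S" unfolding inj_def by auto
  then obtain i j where ij: "i < j" "restrict (F ^^ i) S = restrict (F ^^ j) S" by (metis linorder_neqE_nat)
  define d where "d = j - i"
  have d: "d > 0" "j = d + i" using ij by (auto simp: d_def)
  have step: "(F ^^ (n + d)) w = (F ^^ n) w" if "n \<ge> i" "w \<in> S" for n w
  proof -
    have "(F ^^ (n + d)) w = (F ^^ (n - i)) ((F ^^ j) w)" using that d by (simp flip: funpow_add[THEN fun_cong, unfolded o_def])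
    also have "(F ^^ j) w = (F ^^ i) w" using fun_cong[OF ij(2), of w] that by simp
    also have "(F ^^ (n - i)) ((F ^^ i) w) = (F ^^ n) w"
      using that by (simp flip: funpow_add[THEN fun_cong, unfolded o_def])
    finally show ?thesis .
  qed
  have steps: "(F ^^ (n + t * d)) w = (F ^^ n) w" if "n \<ge> i" "w \<in> S" for n t w
  proof (induction t)
    case (Suc t)
    have "(F ^^ (n + Suc t * d)) w = (F ^^ (n + t * d + d)) w" by (simp add: algebra_simps)
    then show ?case using step[of "n + t * d" w] that Suc by simp
  qed simp
  \<comment> \<open>A positive multiple of the period d that is at least the preperiod i.\<close>
  let ?n = "Suc i * d"
  have "?n \<ge> i" using d(1) by (cases d) auto
  then have "(F ^^ ?n) ((F ^^ ?n) w) = (F ^^ ?n) w" if "w \<in> S" for w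
    using steps[of ?n w "Suc i"] that by (simp only: funpow_add o_def)
  moreover have "?n > 0" using d by simp
  ultimately show ?thesis using that by blast
qed

context topological_group
begin

lemma continuous_endo_closed: "\<phi> \<in> continuous_hom G T G T \<Longrightarrow> y \<in> carrier G \<Longrightarrow> \<phi> y \<in> carrier G"
  by (auto simp: continuous_hom_def hom_def)

lemma continuous_endo_group_hom: "\<phi> \<in> continuous_hom G T G T \<Longrightarrow> group_hom G G \<phi>"
  by (auto simp: continuous_hom_def group_hom_def group_hom_axioms_def)

lemma continuous_endo_funpow:
  assumes "\<phi> \<in> continuous_hom G T G T" shows "\<phi> ^^ n \<in> continuous_hom G T G T"
proof (induction n)
  case 0
  then show ?case by (auto simp: continuous_hom_def hom_def)
next
  case (Suc n)
  then have "\<phi> \<circ> (\<phi> ^^ n) \<in> hom G G" using assms by (auto simp: continuous_hom_def hom_def Pi_def)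
  moreover have "continuous_map T T (\<phi> \<circ> (\<phi> ^^ n))"
    using Suc assms by (auto simp: continuous_hom_def intro: continuous_map_compose)
  ultimately show ?case by (simp add: continuous_hom_def o_def)
qed

lemma open_homs_endo:
  assumes "\<phi> \<in> continuous_hom G T G T" "\<rho> \<in> open_homs G T P"
  shows "\<rho> \<circ> \<phi> \<in> open_homs G T P"
proof -
  have "kernel G P (\<rho> \<circ> \<phi>) = {y \<in> topspace T. \<phi> y \<in> kernel G P \<rho>}"
    using continuous_endo_closed[OF assms(1)] by (auto simp: kernel_def topspace_eq)
  then have "openin T (kernel G P (\<rho> \<circ> \<phi>))"
    using openin_continuous_map_preimage[of T T \<phi>] assms by (simp add: continuous_hom_def open_homs_def)
  then show ?thesis using assms by (auto simp: continuous_hom_def open_homs_def hom_def Pi_def)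
qed

end

lemma (in pro_p_group) continuous_endo_image:
  assumes "\<phi> \<in> continuous_hom G T G T"
  shows "subgroup (\<phi> ` carrier G) G" "closedin T (\<phi> ` carrier G)"
proof -
  interpret \<phi>: group_hom G G \<phi> by (rule continuous_endo_group_hom[OF assms])
  show "subgroup (\<phi> ` carrier G) G" by (rule \<phi>.img_is_subgroup)
  have "closed_map T T \<phi>"
    by (rule continuous_imp_closed_map[OF _ compact Hausdorff]) (use assms in \<open>simp add: continuous_hom_def\<close>)
  then show "closedin T (\<phi> ` carrier G)" unfolding closed_map_def by (metis closedin_topspace topspace_eq)
qed

section \<open>Homomorphisms to a finite p-group as tuples, and minimal generating sets\<close>

context free_pro_p
begin

text \<open>Homomorphisms to a finite p-group P are parametrized by the finite set of m-tuples in P,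
  so precomposition with an endomorphism becomes a self-map of a finite set.\<close>

definition hom_of_tuple :: "('e, 'f) monoid_scheme \<Rightarrow> (nat \<Rightarrow> 'e) \<Rightarrow> 'a \<Rightarrow> 'e" where
  "hom_of_tuple P w = (SOME \<rho>. \<rho> \<in> open_homs G T P \<and> (\<forall>i\<in>{1..m}. \<rho> (x i) = w i))"

lemma hom_of_tuple:
  assumes P: "group P" "order P = p ^ k" and w: "w \<in> {1..m} \<rightarrow>\<^sub>E carrier P"
  shows "hom_of_tuple P w \<in> open_homs G T P" "\<And>i. i \<in> {1..m} \<Longrightarrow> hom_of_tuple P w (x i) = w i"
proof -
  have "w \<in> {1..m} \<rightarrow> carrier P" using w by (simp add: PiE_iff Pi_iff)
  then have "\<exists>\<rho>. \<rho> \<in> open_homs G T P \<and> (\<forall>i\<in>{1..m}. \<rho> (x i) = w i)"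
    using open_hom_exists[OF P] by blast
  then have "hom_of_tuple P w \<in> open_homs G T P \<and> (\<forall>i\<in>{1..m}. hom_of_tuple P w (x i) = w i)"
    unfolding hom_of_tuple_def by (rule someI_ex)
  then show "hom_of_tuple P w \<in> open_homs G T P" "\<And>i. i \<in> {1..m} \<Longrightarrow> hom_of_tuple P w (x i) = w i" by blast+
qed

lemma tuple_of_hom:
  assumes "\<rho> \<in> open_homs G T P" shows "(\<lambda>i\<in>{1..m}. \<rho> (x i)) \<in> {1..m} \<rightarrow>\<^sub>E carrier P"
  using open_homsD(1)[OF assms] gens_closed by (auto simp: hom_def)

lemma hom_of_tuple_of_hom:
  assumes P: "group P" "order P = p ^ k" and \<rho>: "\<rho> \<in> open_homs G T P" and y: "y \<in> carrier G"
  shows "\<rho> y = hom_of_tuple P (\<lambda>i\<in>{1..m}. \<rho> (x i)) y"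
proof (rule open_hom_ext[OF P(1) \<rho> hom_of_tuple(1)[OF P tuple_of_hom[OF \<rho>]] _ y])
  fix i assume "i \<in> {1..m}"
  then show "\<rho> (x i) = hom_of_tuple P (\<lambda>i\<in>{1..m}. \<rho> (x i)) (x i)"
    using hom_of_tuple(2)[OF P tuple_of_hom[OF \<rho>], of i] by simp
qed

lemma finite_p_group: "order P = p ^ k \<Longrightarrow> finite (carrier P)"
  using prime_gt_0_nat[OF prime_p] by (metis card.infinite order_def power_eq_0_iff less_nat_zero_code)

lemma finite_tuples: "order P = p ^ k \<Longrightarrow> finite ({1..m} \<rightarrow>\<^sub>E carrier P)"
  using finite_p_group by (intro finite_PiE) auto

text \<open>Precomposition with \<phi> acts on tuples as \<open>F\<close>, and the exponent n comes
  from an idempotent iterate of F. It depends on P but not on \<rho>.\<close>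

lemma idempotent_iterate:
  assumes \<phi>: "\<phi> \<in> continuous_hom G T G T" and P: "group P" "order P = p ^ k"
  obtains n :: nat where "n > 0"
    "\<And>\<rho> y. \<rho> \<in> open_homs G T P \<Longrightarrow> y \<in> carrier G \<Longrightarrow> \<rho> ((\<phi> ^^ n) ((\<phi> ^^ n) y)) = \<rho> ((\<phi> ^^ n) y)"
proof -
  define h where "h = hom_of_tuple P"
  note h = hom_of_tuple[OF P, folded h_def] hom_of_tuple_of_hom[OF P, folded h_def] tuple_of_hom[where P = P] finite_tuples[OF P(2)]
  let ?S = "{1..m} \<rightarrow>\<^sub>E carrier P"
  define F where "F w = (\<lambda>i\<in>{1..m}. h w (\<phi> (x i)))" for w
  have F: "F w \<in> ?S" "\<And>y. y \<in> carrier G \<Longrightarrow> h w (\<phi> y) = h (F w) y" if w: "w \<in> ?S" for w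
    using h(4)[OF open_homs_endo[OF \<phi> h(1)[OF w]]] h(3)[OF open_homs_endo[OF \<phi> h(1)[OF w]]] by (simp_all add: F_def)
  have FS: "(F ^^ n) w \<in> ?S" if "w \<in> ?S" for n w by (induction n) (use that F in auto)
  have Fn: "h w ((\<phi> ^^ n) y) = h ((F ^^ n) w) y" if "w \<in> ?S" "y \<in> carrier G" for w y n
    using that(2)
  proof (induction n arbitrary: y)
    case (Suc n)
    have "h w ((\<phi> ^^ Suc n) y) = h w ((\<phi> ^^ n) (\<phi> y))" by (simp add: funpow_swap1)
    then show ?case using Suc.IH[OF continuous_endo_closed[OF \<phi> Suc.prems]] F(2)[OF FS[OF that(1)] Suc.prems] by simp
  qed simp
  have "F ` ?S \<subseteq> ?S" by (rule image_subsetI) (rule F(1))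
  then obtain n where n: "n > 0" "\<And>w. w \<in> ?S \<Longrightarrow> (F ^^ n) ((F ^^ n) w) = (F ^^ n) w"
    using finite_idempotent_iterate[OF h(5)] by metis
  show ?thesis
  proof (rule that[OF n(1)])
    fix \<rho> y assume \<rho>: "\<rho> \<in> open_homs G T P" and y: "y \<in> carrier G"
    let ?w = "\<lambda>i\<in>{1..m}. \<rho> (x i)"
    note w = h(4)[OF \<rho>]
    have ey: "(\<phi> ^^ n) y \<in> carrier G" by (rule continuous_endo_closed[OF continuous_endo_funpow[OF \<phi>] y])
    then have eey: "(\<phi> ^^ n) ((\<phi> ^^ n) y) \<in> carrier G"
      by (rule continuous_endo_closed[OF continuous_endo_funpow[OF \<phi>]])
    show "\<rho> ((\<phi> ^^ n) ((\<phi> ^^ n) y)) = \<rho> ((\<phi> ^^ n) y)"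
      using h(3)[OF \<rho> ey] h(3)[OF \<rho> eey] Fn[OF w ey, of n] Fn[OF FS[OF w] y, of n n] Fn[OF w y, of n] n(2)[OF w]
      by simp
  qed
qed

text \<open>The Hopf property. Precomposition with a surjection is injective on homomorphisms to the
  finite group G/N, hence bijective; so G -> G/N factors through \<phi>, and the kernel of \<phi>
  lies in N.\<close>

lemma surjective_endo_automorphism:
  assumes \<phi>: "\<phi> \<in> continuous_hom G T G T" and surj: "\<phi> ` carrier G = carrier G"
  shows "\<phi> \<in> iso G G \<and> homeomorphic_map T T \<phi>"
proof -
  interpret \<phi>: group_hom G G \<phi> by (rule continuous_endo_group_hom[OF \<phi>])
  have inj: "inj_on \<phi> (carrier G)"
    unfolding \<phi>.inj_on_one_iff
  proof (intro allI impI, rule ccontr)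
    fix z assume z: "z \<in> carrier G" "\<phi> z = \<one>" "z \<noteq> \<one>"
    have "closedin T {\<one>}" by (rule closedin_Hausdorff_singleton[OF Hausdorff]) (simp add: topspace_eq)
    then obtain N where N: "N \<lhd> G" "openin T N" "N #> z \<notin> (\<lambda>x. N #> x) ` {\<one>}"
      using separate_closed_subgroup[OF triv_subgroup _ z(1)] z(3) by auto
    let ?P = "G Mod N"
    note Q = open_normal_quotient[OF N(1,2)]
    obtain k where k: "order ?P = p ^ k" using Q(2) by blast
    define h where "h = hom_of_tuple ?P"
  note h = hom_of_tuple[OF Q(1) k, folded h_def] hom_of_tuple_of_hom[OF Q(1) k, folded h_def] tuple_of_hom[where P = ?P] finite_tuples[OF k]
    let ?S = "{1..m} \<rightarrow>\<^sub>E carrier ?P"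
    define F where "F w = (\<lambda>i\<in>{1..m}. h w (\<phi> (x i)))" for w
    have F: "F w \<in> ?S" "\<And>y. y \<in> carrier G \<Longrightarrow> h w (\<phi> y) = h (F w) y" if w: "w \<in> ?S" for w
      using h(4)[OF open_homs_endo[OF \<phi> h(1)[OF w]]] h(3)[OF open_homs_endo[OF \<phi> h(1)[OF w]]] by (simp_all add: F_def)
    have injF: "inj_on F ?S"
    proof (rule inj_onI)
      fix v w assume v: "v \<in> ?S" and w: "w \<in> ?S" and eq: "F v = F w"
      have all: "h v y = h w y" if "y \<in> carrier G" for y
      proof -
        obtain y' where y': "y' \<in> carrier G" "y = \<phi> y'" using \<open>y \<in> carrier G\<close> surj by (metis imageE)
        then show ?thesis using F(2)[OF v y'(1)] F(2)[OF w y'(1)] eq by simp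
      qed
      show "v = w"
        by (rule PiE_ext[OF v w]) (metis all gens_closed h(2) v w)
    qed
    have "F ` ?S \<subseteq> ?S" by (rule image_subsetI) (rule F(1))
    \<comment> \<open>The tuple of the projection G -> G/N is attained, which is the factorization
      through \<phi>.\<close>
    from endo_inj_surj[OF h(5) this injF] h(4)[OF Q(3)]
    have "(\<lambda>i\<in>{1..m}. N #> x i) \<in> F ` ?S" by simp
    then obtain w where w: "w \<in> ?S" "F w = (\<lambda>i\<in>{1..m}. N #> x i)" by (elim imageE) simp
    have proj: "N #> y = h w (\<phi> y)" if "y \<in> carrier G" for y
      using h(3)[OF Q(3) that] F(2)[OF w(1) that] w(2) by simp
    have "N #> z = N #> \<one>" using proj[OF z(1)] proj[OF one_closed] z(2) by simp
    then show False using N(3) by simp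
  qed
  have "\<phi> \<in> iso G G" using \<phi> inj surj by (simp add: continuous_hom_def iso_def bij_betw_def)
  moreover have "homeomorphic_map T T \<phi>"
    by (rule continuous_imp_homeomorphic_map[OF _ compact Hausdorff])
      (use \<phi> inj surj in \<open>simp_all add: continuous_hom_def topspace_eq\<close>)
  ultimately show ?thesis by blast
qed

text \<open>A family of characters dual to Y has p^|Y| distinct linear combinations over F_p, while
  a character is determined by its values at the m generators, which leaves p^m
  possibilities.\<close>

lemma minimal_generating_card:
  assumes fin: "finite Y" and gen: "topologically_generates G T Y"
    and min: "\<forall>Z. Z \<subset> Y \<longrightarrow> \<not> topologically_generates G T Z"
  shows "card Y \<le> m"
proof -
  let ?Z = "integer_mod_group p"
  have p0: "p > 0" using prime_gt_0_nat[OF prime_p] .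
  have YG: "Y \<subseteq> carrier G" using gen by (simp add: topologically_generates_def)
  \<comment> \<open>Without y the set fails to generate, and the character that witnesses this
    cannot vanish at y.\<close>
  have "\<exists>\<xi>\<in>chars. (\<forall>y'\<in>Y - {y}. \<xi> y' = 0) \<and> \<xi> y \<noteq> 0" if y: "y \<in> Y" for y
  proof -
    have sub: "Y - {y} \<subseteq> carrier G" using YG by blast
    have "\<not> topologically_generates G T (Y - {y})" using min y by blast
    then obtain \<xi> g where "\<xi> \<in> chars" "\<forall>y'\<in>Y - {y}. \<xi> y' = 0" "g \<in> carrier G" "\<xi> g \<noteq> 0"
      using topologically_generates_iff[OF sub] by blast
    moreover then have "\<xi> y \<noteq> 0" using gen topologically_generates_iff[OF YG] by blast
    ultimately show ?thesis by blast
  qed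
  then obtain \<xi> where \<xi>: "\<And>y. y \<in> Y \<Longrightarrow> \<xi> y \<in> chars" "\<And>y y'. y \<in> Y \<Longrightarrow> y' \<in> Y - {y} \<Longrightarrow> \<xi> y y' = 0"
    "\<And>y. y \<in> Y \<Longrightarrow> \<xi> y y \<noteq> 0" by metis
  define \<mu> where "\<mu> c g = (\<Sum>y\<in>Y. c y * \<xi> y g) mod int p" for c g
  have \<mu>: "\<mu> c \<in> chars" for c
  proof -
    have mult: "\<mu> c (a \<otimes> b) = (\<mu> c a + \<mu> c b) mod int p" if "a \<in> carrier G" "b \<in> carrier G" for a b
    proof -
      have "[(\<Sum>y\<in>Y. c y * \<xi> y (a \<otimes> b)) = (\<Sum>y\<in>Y. c y * \<xi> y a + c y * \<xi> y b)] (mod int p)"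
        using \<xi>(1) that
        by (intro cong_sum) (simp add: char_mult cong_def mod_simps distrib_left[symmetric])
      then show ?thesis unfolding \<mu>_def by (simp add: cong_def sum.distrib mod_simps)
    qed
    have "\<mu> c \<in> hom G ?Z" using mult p0 by (auto simp: hom_def carrier_integer_mod_group) (simp_all add: \<mu>_def)
    moreover have "openin T (kernel G ?Z (\<mu> c))"
    proof (rule openin_invariant[of "carrier G \<inter> (\<Inter>y\<in>Y. kernel G ?Z (\<xi> y))"])
      have "openin T (kernel G ?Z (\<xi> y))" if "y \<in> Y" for y using \<xi>(1)[OF that] by (simp add: open_homs_def)
      then show "openin T (carrier G \<inter> (\<Inter>y\<in>Y. kernel G ?Z (\<xi> y)))"
        using fin openin_topspace[of T] by (cases "Y = {}") (auto simp: topspace_eq)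
      show "\<one> \<in> carrier G \<inter> (\<Inter>y\<in>Y. kernel G ?Z (\<xi> y))"
        using group_hom.hom_one[OF char_hom[OF \<xi>(1)]] by (auto simp: kernel_def)
      show "a \<otimes> b \<in> kernel G ?Z (\<mu> c)"
        if a: "a \<in> kernel G ?Z (\<mu> c)" and b: "b \<in> carrier G \<inter> (\<Inter>y\<in>Y. kernel G ?Z (\<xi> y))" for a b
      proof -
        have "\<mu> c b = 0" unfolding \<mu>_def using b by (auto simp: kernel_def)
        then show ?thesis using a b mult[of a b] p0 by (auto simp: kernel_def)
      qed
    qed (auto simp: kernel_def)
    ultimately show ?thesis by (simp add: open_homs_def)
  qed
  let ?B = "Y \<rightarrow>\<^sub>E {0..<int p}" and ?A = "{1..m} \<rightarrow>\<^sub>E {0..<int p}"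
  have "inj_on (\<lambda>c. \<lambda>i\<in>{1..m}. \<mu> c (x i)) ?B"
  proof (rule inj_onI)
    fix c d assume c: "c \<in> ?B" and d: "d \<in> ?B" and eq: "(\<lambda>i\<in>{1..m}. \<mu> c (x i)) = (\<lambda>i\<in>{1..m}. \<mu> d (x i))"
    have "\<mu> c (x i) = \<mu> d (x i)" if "i \<in> {1..m}" for i using fun_cong[OF eq, of i] that by simp
    then have all: "\<mu> c g = \<mu> d g" if "g \<in> carrier G" for g
      using open_hom_ext[OF group_integer_mod_group \<mu> \<mu> _ that] by blast
    show "c = d"
    proof (rule PiE_ext[OF c d])
      fix y assume y: "y \<in> Y"
      have val: "\<mu> e y = (e y * \<xi> y y) mod int p" for e
      proof -
        have "(\<Sum>y'\<in>Y - {y}. e y' * \<xi> y' y) = 0" by (rule sum.neutral) (use \<xi>(2) y in auto)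
        then show ?thesis unfolding \<mu>_def by (subst sum.remove[OF fin y]) simp
      qed
      have "[c y * \<xi> y y = d y * \<xi> y y] (mod int p)"
        using all[of y] y YG unfolding val by (auto simp: cong_def)
      moreover have "coprime (\<xi> y y) (int p)"
      proof -
        have "0 \<le> \<xi> y y \<and> \<xi> y y < int p" using char_range[OF \<xi>(1)[OF y]] y YG by blast
        then have "\<not> int p dvd \<xi> y y" using \<xi>(3)[OF y] by (auto dest: zdvd_imp_le)
        then show ?thesis using prime_p prime_imp_coprime[of "int p" "\<xi> y y"] by (simp add: coprime_commute)
      qed
      ultimately have "[c y = d y] (mod int p)" by (simp add: cong_mult_rcancel)
      moreover have "c y \<in> {0..<int p}" "d y \<in> {0..<int p}" using c d y by auto
      ultimately show "c y = d y" by (simp add: cong_def)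
    qed
  qed
  moreover have "(\<lambda>c. \<lambda>i\<in>{1..m}. \<mu> c (x i)) ` ?B \<subseteq> ?A" using p0 by (auto simp: \<mu>_def)
  moreover have "finite ?A" by (rule finite_PiE) auto
  ultimately have "card ?B \<le> card ?A" by (rule card_inj_on_le)
  then have "p ^ card Y \<le> p ^ m" using fin by (simp add: card_funcsetE)
  then show ?thesis by (rule power_le_imp_le_exp[OF prime_gt_1_nat[OF prime_p]])
qed

text \<open>
  Restriction to \<open>Y\<close> is an injection from the homomorphisms into \<open>P\<close>, of which there are \<open>|P|\<^sup>m\<close>, to the maps
  \<open>Y \<rightarrow> P\<close>, of which there are at most \<open>|P|\<^sup>m\<close>.
\<close>

lemma minimal_generating_extension:
  assumes fin: "finite Y" and gen: "topologically_generates G T Y"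
    and min: "\<forall>Z. Z \<subset> Y \<longrightarrow> \<not> topologically_generates G T Z"
    and P: "group P" "order P = p ^ k" and v: "v \<in> Y \<rightarrow> carrier P"
  shows "\<exists>\<rho>\<in>open_homs G T P. \<forall>y\<in>Y. \<rho> y = v y"
proof -
  have YG: "Y \<subseteq> carrier G" using gen by (simp add: topologically_generates_def)
  define h where "h = hom_of_tuple P"
  note h = hom_of_tuple[OF P, folded h_def] hom_of_tuple_of_hom[OF P, folded h_def] tuple_of_hom[where P = P] finite_tuples[OF P(2)]
  let ?A = "{1..m} \<rightarrow>\<^sub>E carrier P" and ?B = "Y \<rightarrow>\<^sub>E carrier P"
  define R where "R w = (\<lambda>y\<in>Y. h w y)" for w
  have "inj_on R ?A"
  proof (rule inj_onI)
    fix v w assume v: "v \<in> ?A" and w: "w \<in> ?A" and eq: "R v = R w"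
    have Y: "h v y = h w y" if "y \<in> Y" for y using fun_cong[OF eq, of y] that by (simp add: R_def)
    have all: "h v y = h w y" if "y \<in> carrier G" for y
      by (rule topologically_generates_eqI[OF gen P(1) h(1)[OF v] h(1)[OF w] Y that])
    show "v = w" by (rule PiE_ext[OF v w]) (metis all gens_closed h(2) v w)
  qed
  moreover have RB: "R ` ?A \<subseteq> ?B"
  proof
    fix u assume "u \<in> R ` ?A"
    then obtain w where w: "w \<in> ?A" "u = R w" by blast
    then show "u \<in> ?B" using open_homsD(1)[OF h(1)[OF w(1)]] YG by (auto simp: R_def hom_def)
  qed
  moreover have finP: "finite (carrier P)"
    using P(2) prime_gt_0_nat[OF prime_p] by (metis card.infinite order_def power_eq_0_iff less_nat_zero_code)
  have "card ?B \<le> card ?A"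
  proof -
    have "card (carrier P) \<ge> 1" using P(2) prime_gt_0_nat[OF prime_p] by (simp add: order_def Suc_leI)
    then show ?thesis using minimal_generating_card[OF fin gen min] fin by (simp add: card_funcsetE power_increasing)
  qed
  ultimately have "R ` ?A = ?B"
    using fin finP by (intro card_seteq) (simp_all add: card_image finite_PiE)
  moreover have "restrict v Y \<in> ?B" using v by auto
  ultimately obtain w where w: "w \<in> ?A" "restrict v Y = R w" by blast
  have "h w y = v y" if "y \<in> Y" for y using fun_cong[OF w(2), of y] that by (simp add: R_def)
  then show ?thesis using h(1)[OF w(1)] by blast
qed

text \<open>
  Replace \<open>\<phi>\<close> by an iterate \<open>e\<close> that acts idempotently on homomorphisms to \<open>P\<close>.  The elements
  \<open>e x\<^sub>i\<close> and \<open>x\<^sub>i (e x\<^sub>i)\<^sup>-\<^sup>1\<close> generate, so a minimal generating set \<open>Y\<close> can be chosen among them.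
  It is not contained in the image of \<open>e\<close>, and \<open>g\<close> does not involve the elements of the second kind.
\<close>

lemma nonsurjective_endo_fixed:
  assumes \<phi>: "\<phi> \<in> continuous_hom G T G T" and nsurj: "\<phi> ` carrier G \<noteq> carrier G"
    and g: "g \<in> carrier G" "\<phi> g = g" and P: "group P" "order P = p ^ k"
  obtains Y y0 where "finite Y" "topologically_generates G T Y"
    "\<forall>Z. Z \<subset> Y \<longrightarrow> \<not> topologically_generates G T Z" "y0 \<in> Y"
    "\<And>\<rho> \<sigma>. \<rho> \<in> open_homs G T P \<Longrightarrow> \<sigma> \<in> open_homs G T P \<Longrightarrow>
      (\<And>y. y \<in> Y - {y0} \<Longrightarrow> \<rho> y = \<sigma> y) \<Longrightarrow> \<rho> g = \<sigma> g"
proof -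
  obtain n where n: "n > 0"
    "\<And>\<rho> y. \<rho> \<in> open_homs G T P \<Longrightarrow> y \<in> carrier G \<Longrightarrow> \<rho> ((\<phi> ^^ n) ((\<phi> ^^ n) y)) = \<rho> ((\<phi> ^^ n) y)"
    using idempotent_iterate[OF \<phi> P] by metis
  define e where "e = \<phi> ^^ n"
  have e: "e \<in> continuous_hom G T G T" unfolding e_def by (rule continuous_endo_funpow[OF \<phi>])
  interpret e: group_hom G G e by (rule continuous_endo_group_hom[OF e])
  have idem: "\<rho> (e (e y)) = \<rho> (e y)" if "\<rho> \<in> open_homs G T P" "y \<in> carrier G" for \<rho> y
    using n(2)[OF that] by (simp add: e_def)
  have eg: "e g = g" unfolding e_def by (induction n) (simp_all add: g)
  define Y1 where "Y1 = (\<lambda>i. e (x i)) ` {1..m}"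
  define Y2 where "Y2 = (\<lambda>i. x i \<otimes> inv (e (x i))) ` {1..m}"
  have Y12: "Y1 \<union> Y2 \<subseteq> carrier G" unfolding Y1_def Y2_def using gens_closed by auto
  have gensG: "x ` {1..m} \<subseteq> carrier G" using gens_closed by blast
  have "topologically_generates G T (Y1 \<union> Y2)"
    unfolding topologically_generates_iff[OF Y12]
  proof (intro ballI impI)
    fix \<xi> y assume \<xi>: "\<xi> \<in> chars" "\<forall>y\<in>Y1 \<union> Y2. \<xi> y = 0" and y: "y \<in> carrier G"
    have "\<xi> (x i) = 0" if i: "i \<in> {1..m}" for i
    proof -
      have xi: "x i \<in> carrier G" using gens_closed[OF i] .
      have "x i = (x i \<otimes> inv (e (x i))) \<otimes> e (x i)" using xi by (simp add: m_assoc)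
      then have "\<xi> (x i) = (\<xi> (x i \<otimes> inv (e (x i))) + \<xi> (e (x i))) mod int p"
        using char_mult[OF \<xi>(1), of "x i \<otimes> inv (e (x i))" "e (x i)"] xi by simp
      moreover have "e (x i) \<in> Y1 \<union> Y2" "x i \<otimes> inv (e (x i)) \<in> Y1 \<union> Y2"
        using i unfolding Y1_def Y2_def by blast+
      then have "\<xi> (e (x i)) = 0" "\<xi> (x i \<otimes> inv (e (x i))) = 0" by (auto intro: \<xi>(2)[rule_format])
      ultimately show ?thesis by simp
    qed
    then show "\<xi> y = 0" using topologically_generates_iff[OF gensG] generators_generate \<xi>(1) y by blast
  qed
  moreover have "finite (Y1 \<union> Y2)" unfolding Y1_def Y2_def by simp
  moreover define gens where "gens Y \<longleftrightarrow> Y \<subseteq> Y1 \<union> Y2 \<and> topologically_generates G T Y" for Y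
  ultimately have "gens (Y1 \<union> Y2)" by simp
  then obtain Y where "gens Y" "\<forall>Z. gens Z \<longrightarrow> card Y \<le> card Z"
    using ex_has_least_nat[of gens "Y1 \<union> Y2" card] by blast
  then have Y: "Y \<subseteq> Y1 \<union> Y2" "topologically_generates G T Y"
    "\<And>Z. Z \<subseteq> Y1 \<union> Y2 \<Longrightarrow> topologically_generates G T Z \<Longrightarrow> card Y \<le> card Z"
    by (simp_all add: gens_def)
  have finY: "finite Y" using Y(1) \<open>finite (Y1 \<union> Y2)\<close> finite_subset by blast
  have "\<not> topologically_generates G T Z" if "Z \<subset> Y" for Z
    using Y(1) Y(3)[of Z] psubset_card_mono[OF finY that] that by auto
  then have min: "\<forall>Z. Z \<subset> Y \<longrightarrow> \<not> topologically_generates G T Z" by blast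
  \<comment> \<open>Since n > 0, \<open>Y1\<close> lies in the image of \<phi>, a proper closed
    subgroup, which is killed by a nonzero character.\<close>
  have "\<not> Y \<subseteq> Y1"
  proof
    assume "Y \<subseteq> Y1"
    also have "Y1 \<subseteq> \<phi> ` carrier G"
    proof
      fix y assume "y \<in> Y1"
      then obtain i where i: "i \<in> {1..m}" "y = (\<phi> ^^ n) (x i)" unfolding Y1_def e_def by auto
      obtain n' where "n = Suc n'" using n(1) by (cases n) auto
      then have "y = \<phi> ((\<phi> ^^ n') (x i))" using i by simp
      then show "y \<in> \<phi> ` carrier G"
        using continuous_endo_closed[OF continuous_endo_funpow[OF \<phi>] gens_closed[OF i(1)]] by blast
    qed
    finally have sub: "Y \<subseteq> \<phi> ` carrier G" .
    define I where "I = \<phi> ` carrier G"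
    note I = continuous_endo_image[OF \<phi>, folded I_def] nsurj[folded I_def]
    obtain \<xi> a where \<xi>: "\<xi> \<in> chars" "\<And>y. y \<in> I \<Longrightarrow> \<xi> y = 0" "a \<in> carrier G" "\<xi> a \<noteq> 0"
      using proper_closed_subgroup_char[OF I] by blast
    have "Y \<subseteq> carrier G" using Y(1) Y12 by blast
    moreover have "\<xi> y = 0" if "y \<in> Y" for y using \<xi>(2) sub that unfolding I_def by blast
    ultimately show False using topologically_generates_iff[of Y] Y(2) \<xi>(1,3,4) by blast
  qed
  then obtain y0 where y0: "y0 \<in> Y" "y0 \<notin> Y1" by blast
  have "\<rho> g = \<sigma> g" if \<rho>: "\<rho> \<in> open_homs G T P" and \<sigma>: "\<sigma> \<in> open_homs G T P"
    and eq: "\<And>y. y \<in> Y - {y0} \<Longrightarrow> \<rho> y = \<sigma> y" for \<rho> \<sigma>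
  proof -
    \<comment> \<open>Idempotence in the eyes of P: no homomorphism to P distinguishes e (x_i (e
      x_i)^-1) from one.\<close>
    have trivial: "\<tau> (e y) = \<one>\<^bsub>P\<^esub>" if \<tau>: "\<tau> \<in> open_homs G T P" and y: "y \<in> Y2" for \<tau> y
    proof -
      obtain i where i: "i \<in> {1..m}" "y = x i \<otimes> inv (e (x i))" using y unfolding Y2_def by blast
      interpret \<tau>: group_hom G P \<tau> using open_homsD(1)[OF \<tau>] P(1) by (simp add: group_hom_def group_hom_axioms_def)
      have "\<tau> (e y) = \<tau> (e (x i)) \<otimes>\<^bsub>P\<^esub> inv\<^bsub>P\<^esub> \<tau> (e (e (x i)))" unfolding i(2) using gens_closed[OF i(1)] by simp
      then show ?thesis using idem[OF \<tau> gens_closed[OF i(1)]] gens_closed[OF i(1)] by simp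
    qed
    \<comment> \<open>After composition with e, members of \<open>Y2\<close> become trivial and
      members of \<open>Y1\<close> look fixed by e, so the value at \<open>y0\<close> no longer
      enters. The relation e g = g turns the result into the claim about g.\<close>
    have "\<rho> (e y) = \<sigma> (e y)" if y: "y \<in> Y" for y
    proof (cases "y \<in> Y2")
      case True
      then show ?thesis using trivial[OF \<rho> True] trivial[OF \<sigma> True] by simp
    next
      case False
      then have "y \<in> Y1" using y Y(1) by blast
      then obtain i where i: "i \<in> {1..m}" "y = e (x i)" unfolding Y1_def by blast
      have "y \<in> Y - {y0}" using y0 y \<open>y \<in> Y1\<close> by blast
      then show ?thesis using eq[of y] idem[OF \<rho> gens_closed[OF i(1)]] idem[OF \<sigma> gens_closed[OF i(1)]] i(2) by simp
    qed
    then have "(\<rho> \<circ> e) g = (\<sigma> \<circ> e) g"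
      by (intro topologically_generates_eqI[OF Y(2) P(1) open_homs_endo[OF e \<rho>] open_homs_endo[OF e \<sigma>] _ g(1)]) simp
    then show ?thesis by (simp add: eg)
  qed
  then show ?thesis using that[OF finY Y(2) min y0(1)] by blast
qed

end

section \<open>Test words\<close>

text \<open>b accounts for at most i - 1 factors p, so at least j + 1 come from y.\<close>

lemma prime_power_dvd_mult_cancel:
  fixes p :: int
  assumes p: "prime p" shows "\<not> p ^ i dvd b \<Longrightarrow> p ^ (i + j) dvd b * y \<Longrightarrow> p ^ Suc j dvd y"
proof (induction i arbitrary: b)
  case (Suc i)
  show ?case
  proof (cases "p dvd b")
    case True
    then obtain c where c: "b = p * c" by blast
    have "\<not> p ^ i dvd c" using Suc.prems(1) c by auto
    moreover have "p ^ (i + j) dvd c * y" using Suc.prems(2) p unfolding c by (simp add: mult.assoc)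
    ultimately show ?thesis by (rule Suc.IH)
  next
    case False
    then have "coprime (p ^ (Suc i + j)) b" using p by (simp add: prime_imp_coprime)
    then have "p ^ (Suc i + j) dvd y" using Suc.prems(2) by (simp add: coprime_dvd_mult_right_iff)
    moreover have "p ^ Suc j dvd p ^ (Suc i + j)" by (rule le_imp_power_dvd) simp
    ultimately show ?thesis by (rule dvd_trans[rotated])
  qed
qed simp

text \<open>Modulo p the p consecutive blocks of length h have equal sums.\<close>

lemma dvd_sum_of_shift_invariant:
  fixes v :: "int \<Rightarrow> int"
  assumes "\<And>z. int p dvd v (z + int h) - v z"
  shows "int p dvd (\<Sum>z<p * h. v (int z))"
proof -
  have shift: "[v (z + int j * int h) = v z] (mod int p)" for z j
  proof (induction j)
    case (Suc j)
    have "[v ((z + int j * int h) + int h) = v (z + int j * int h)] (mod int p)"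
      using assms by (simp add: cong_iff_dvd_diff)
    from cong_trans[OF this Suc] show ?case by (simp add: algebra_simps)
  qed simp
  have "(\<Sum>z<p * h. v (int z)) = (\<Sum>j<p. \<Sum>z=j * h..<j * h + h. v (int z))"
    by (simp add: sum.nat_group)
  also have "(\<Sum>z=j * h..<j * h + h. v (int z)) = (\<Sum>z<h. v (int z + int j * int h))" for j
    using sum.shift_bounds_nat_ivl[of "\<lambda>z. v (int z)" 0 "j * h" h]
    by (simp add: lessThan_atLeast0 add.commute)
  then have "(\<Sum>j<p. \<Sum>z=j * h..<j * h + h. v (int z)) = (\<Sum>j<p. \<Sum>z<h. v (int z + int j * int h))" by simp
  also have "[\<dots> = (\<Sum>j<p. \<Sum>z<h. v (int z))] (mod int p)"
    by (intro cong_sum shift)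
  finally show ?thesis by (simp add: cong_dvd_iff)
qed

text \<open>
  With \<open>w z = v (z + h) - v z\<close>, the hypothesis makes \<open>w\<close> invariant modulo \<open>p\<^sup>2\<close> under translation by
  \<open>c\<close>, hence by \<open>h\<close>; summing over a period, \<open>p w \<equiv> 0\<close> modulo \<open>p\<^sup>2\<close>.
\<close>

lemma shift_invariant_of_commutator:
  fixes v :: "int \<Rightarrow> int" and c :: int
  assumes p: "prime p" and per: "\<And>z. v (z + int (p ^ Suc M)) = v z"
    and b: "\<not> int p ^ L dvd b" and c: "\<not> int p ^ Suc M dvd c"
    and dvd: "\<And>z. int p ^ Suc L dvd b * ((v (z + int (p ^ M)) - v z) - (v (z + int (p ^ M) + c) - v (z + c)))"
  shows "int p dvd v (z + int (p ^ M)) - v z"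
proof -
  define h where "h = int (p ^ M)"
  define q where "q = int (p ^ Suc M)"
  have q: "q = int p * h" by (simp add: q_def h_def)
  define w where "w z = v (z + h) - v z" for z
  have wq: "w (z + q) = w z" for z
    using per[of z] per[of "z + h"] unfolding w_def q_def[symmetric] by (simp add: algebra_simps)
  have wc: "[w (z + c) = w z] (mod int p ^ 2)" for z
  proof -
    \<comment> \<open>b absorbs at most L - 1 of the factors p, which leaves p^2.\<close>
    have "int p ^ (L + 1) dvd b * (w z - w (z + c))"
      using dvd[of z] unfolding w_def h_def[symmetric] by (simp add: algebra_simps)
    from prime_power_dvd_mult_cancel[OF _ b this] p have "int p ^ 2 dvd w z - w (z + c)" by (simp add: numeral_2_eq_2)
    then show ?thesis by (simp add: cong_iff_dvd_diff dvd_diff_commute)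
  qed
  have wcn: "[w (z + int n * c) = w z] (mod int p ^ 2)" for z n
  proof (induction n)
    case (Suc n)
    from cong_trans[OF wc[of "z + int n * c"] Suc] show ?case by (simp add: algebra_simps)
  qed simp
  \<comment> \<open>The gcd of c and q is a power of p different from q, so it divides h. Up to the
    period q, translation by h is therefore an iterate of translation by c; reducing the coefficient
    modulo q makes it a natural number.\<close>
  obtain s t where st: "h = int s * c + t * q"
  proof -
    obtain e where e: "gcd c q = int p ^ e" "e \<le> Suc M"
    proof -
      have "gcd c q dvd int (p ^ Suc M)" by (simp add: q_def)
      then have "nat (gcd c q) dvd p ^ Suc M" by (simp add: nat_dvd_iff del: power_Suc of_nat_power)
      then obtain e where "e \<le> Suc M" "nat (gcd c q) = p ^ e" using divides_primepow_nat[OF p] by blast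
      then show ?thesis using that[of e] by (metis gcd_ge_0_int int_nat_eq of_nat_power)
    qed
    have "e \<noteq> Suc M" using e(1) c by (metis gcd_dvd1)
    then have "gcd c q dvd h" unfolding e(1) h_def using e(2) by (simp add: le_imp_power_dvd)
    then obtain d where d: "h = d * gcd c q" by (metis dvdE mult.commute)
    obtain s' t' where "s' * c + t' * q = gcd c q" using bezout_int by blast
    then have st': "h = (d * s') * c + (d * t') * q" unfolding d by (simp add: algebra_simps flip: \<open>_ = gcd c q\<close>)
    have "q > 0" using prime_gt_0_nat[OF p] by (simp add: q_def)
    define s where "s = nat ((d * s') mod q)"
    have "int s = (d * s') mod q" using \<open>q > 0\<close> by (simp add: s_def)
    then have "d * s' = int s + q * ((d * s') div q)" by simp
    then have "h = int s * c + (q * ((d * s') div q) * c + (d * t') * q)"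
      using st' by (metis add.assoc distrib_right)
    then have "h = int s * c + (((d * s') div q) * c + d * t') * q" by (simp add: algebra_simps)
    then show ?thesis using that by blast
  qed
  have wh: "[w (z + h) = w z] (mod int p ^ 2)" for z
  proof -
    have "w (z + h) = w (z + int s * c)"
      using periodic_add_mult[of w q "z + int s * c" t, OF wq] by (simp add: st algebra_simps)
    then show ?thesis using wcn by simp
  qed
  have whn: "[w (z + int j * h) = w z] (mod int p ^ 2)" for z j
  proof (induction j)
    case (Suc j)
    from cong_trans[OF wh[of "z + int j * h"] Suc] show ?case by (simp add: algebra_simps)
  qed simp
  \<comment> \<open>A telescoping sum; it vanishes by periodicity as p h = q, while modulo p^2 all
    its p summands equal \<open>w z\<close>.\<close>
  have "(\<Sum>j<p. w (z + int j * h)) = v (z + int p * h) - v z"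
  proof -
    have "(\<Sum>j<n. w (z + int j * h)) = v (z + int n * h) - v z" for n
      by (induction n) (simp_all add: w_def algebra_simps)
    then show ?thesis .
  qed
  also have "\<dots> = 0" using per[of z] by (simp add: q_def[symmetric] q del: of_nat_power power_Suc)
  finally have "[0 = (\<Sum>j<p. w z)] (mod int p ^ 2)"
    using cong_sum[of "{..<p}" "\<lambda>j. w (z + int j * h)" "\<lambda>_. w z" "int p ^ 2"] whn by simp
  then have "int p * int p dvd int p * w z" by (simp add: cong_dvd_iff cong_0_iff[symmetric] cong_sym_eq power2_eq_square)
  then have "int p dvd w z" using prime_gt_0_nat[OF p] by simp
  then show ?thesis by (simp add: w_def h_def)
qed

lemma padic_not_dvd:
  assumes p: "prime p" and \<alpha>: "\<alpha> \<in> carrier (padic_ints p)" "\<alpha> i \<noteq> 0" and ij: "i \<le> j" "j \<le> M"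
  shows "\<not> int p ^ j dvd \<alpha> M"
proof
  assume "int p ^ j dvd \<alpha> M"
  then have "\<alpha> j = 0" using padic_mod[OF \<alpha>(1) ij(2)] by (simp add: dvd_eq_mod_eq_0)
  then show False using padic_mod[OF \<alpha>(1) ij(1)] \<alpha>(2) by simp
qed

lemma padic_nonzero:
  assumes "\<alpha> \<noteq> \<zero>\<^bsub>padic_ints p\<^esub>" shows "\<exists>i. \<alpha> i \<noteq> 0"
  using assms by (auto simp: padic_ints_def)

text \<open>The augmentation of the group ring reduced modulo p; the base elements on which it
  vanishes form the maximal ideal.\<close>

definition period_sum :: "nat \<Rightarrow> nat \<Rightarrow> int \<times> (int \<Rightarrow> int) \<Rightarrow> int" where
  "period_sum q p a = (\<Sum>z<q. snd a (int z)) mod int p"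

lemma sum_shift_periodic:
  fixes f :: "int \<Rightarrow> int"
  assumes per: "\<And>z. f (z + int q) = f z"
  shows "(\<Sum>z<q. f (int z + s)) = (\<Sum>z<q. f (int z))"
proof (cases "q = 0")
  case False
  have mod: "f (y mod int q) = f y" for y
    by (rule periodic_cong[of f "int q", OF per]) (simp add: cong_def)
  have "(\<Sum>z\<in>{0..<int q}. f (z + s)) = (\<Sum>z\<in>{0..<int q}. f z)"
  proof (rule sum.reindex_bij_witness[of _ "\<lambda>z. (z - s) mod int q" "\<lambda>z. (z + s) mod int q"])
    show "f ((a + s) mod int q) = f (a + s)" for a by (rule mod)
  qed (use False in \<open>auto simp: mod_simps\<close>)
  moreover have "(\<Sum>z\<in>{0..<int q}. g z) = (\<Sum>z<q. g (int z))" for g :: "int \<Rightarrow> int"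
    by (rule sum.reindex_bij_witness[of _ int nat]) auto
  ultimately show ?thesis by simp
qed simp

text \<open>A sum over a full period is unchanged by translation, so the twist in the multiplication
  disappears.\<close>

lemma period_sum_hom:
  assumes "p > 0" "p dvd r"
  shows "period_sum q p \<in> hom (wreath q r) (integer_mod_group p)"
proof (rule homI)
  fix a b assume b: "b \<in> carrier (wreath q r)"
  have "[(\<Sum>z<q. snd (a \<otimes>\<^bsub>wreath q r\<^esub> b) (int z)) = (\<Sum>z<q. snd a (int z) + snd b (int z + fst a))] (mod int p)"
  proof (rule cong_sum)
    fix z
    have "int p dvd int r" using assms(2) by simp
    then show "[snd (a \<otimes>\<^bsub>wreath q r\<^esub> b) (int z) = snd a (int z) + snd b (int z + fst a)] (mod int p)"
      unfolding snd_wreath_mult by (simp add: cong_def mod_mod_cancel)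
  qed
  also have "(\<Sum>z<q. snd a (int z) + snd b (int z + fst a)) = (\<Sum>z<q. snd a (int z)) + (\<Sum>z<q. snd b (int z))"
    using sum_shift_periodic[of "snd b" q "fst a"] b by (simp add: sum.distrib wreath_carrier)
  finally show "period_sum q p (a \<otimes>\<^bsub>wreath q r\<^esub> b) = period_sum q p a \<otimes>\<^bsub>integer_mod_group p\<^esub> period_sum q p b"
    by (simp add: period_sum_def cong_def mod_simps)
qed (use assms in \<open>simp add: period_sum_def carrier_integer_mod_group\<close>)

context free_pro_p
begin

text \<open>The order of choices matters: the group W depends on the exponents alone, the index i is
  read off from the non-surjective endomorphism, and only afterwards is the action of the generators
  adapted to i.\<close>

lemma surface_test_element:
  assumes m: "m = n + 2 * k"
    and \<alpha>: "\<And>i. i \<in> {1..n} \<Longrightarrow> \<alpha> i \<in> padic_multiples p p - {\<zero>\<^bsub>padic_ints p\<^esub>}"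
    and \<beta>: "\<And>i. i \<in> {1..2 * k} \<Longrightarrow> \<beta> i \<in> carrier (padic_ints p) - {\<zero>\<^bsub>padic_ints p\<^esub>}"
  shows "test_element G T (surface_word G n k (\<lambda>i. padic_pow G T (x i) (\<alpha> i))
    (\<lambda>j. padic_pow G T (x (n + 2 * j + 1)) (\<beta> (2 * j + 1)))
    (\<lambda>j. padic_pow G T (x (n + 2 * j + 2)) (\<beta> (2 * j + 2))))"
    (is "test_element G T (surface_word G n k ?u ?a ?b)")
proof -
  let ?g = "surface_word G n k ?u ?a ?b"
  have p0: "p > 0" using prime_gt_0_nat[OF prime_p] .
  have \<alpha>c: "\<alpha> i \<in> carrier (padic_ints p)" and \<alpha>1: "\<alpha> i 1 = 0" and \<alpha>0: "\<exists>j. \<alpha> i j \<noteq> 0" if "i \<in> {1..n}" for i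
    using \<alpha>[OF that] padic_multiples_power[OF prime_p, of 1] padic_nonzero[of "\<alpha> i" p] by auto
  have \<beta>c: "\<beta> i \<in> carrier (padic_ints p)" and \<beta>0: "\<exists>j. \<beta> i j \<noteq> 0" if "i \<in> {1..2 * k}" for i
    using \<beta>[OF that] padic_nonzero[of "\<beta> i" p] by auto
  have xc: "i \<in> {1..n} \<Longrightarrow> x i \<in> carrier G" for i using gens_closed m by simp
  have xac: "j < k \<Longrightarrow> x (n + 2 * j + 1) \<in> carrier G" and xbc: "j < k \<Longrightarrow> x (n + 2 * j + 2) \<in> carrier G" for j
    using gens_closed m by simp_all
  have \<beta>a: "j < k \<Longrightarrow> 2 * j + 1 \<in> {1..2 * k}" and \<beta>b: "j < k \<Longrightarrow> 2 * j + 2 \<in> {1..2 * k}" for j by auto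
  have uc: "i \<in> {1..n} \<Longrightarrow> ?u i \<in> carrier G" for i using padic_pow_closed[OF xc \<alpha>c] .
  have ac: "j < k \<Longrightarrow> ?a j \<in> carrier G" for j using padic_pow_closed[OF xac \<beta>c[OF \<beta>a]] .
  have bc: "j < k \<Longrightarrow> ?b j \<in> carrier G" for j using padic_pow_closed[OF xbc \<beta>c[OF \<beta>b]] .
  have gc: "?g \<in> carrier G" by (rule surface_word_closed) (use uc ac bc in auto)
  have "\<phi> \<in> iso G G \<and> homeomorphic_map T T \<phi>" if \<phi>: "\<phi> \<in> continuous_hom G T G T" "\<phi> ?g = ?g" for \<phi>
  proof (rule surjective_endo_automorphism[OF \<phi>(1)], rule ccontr)
    assume ns: "\<phi> ` carrier G \<noteq> carrier G"
    \<comment> \<open>At level N every exponent has a nonzero residue, so p^N divides none of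
      them.\<close>
    obtain N where N: "\<And>i. i \<in> {1..n} \<Longrightarrow> \<exists>j\<le>N. \<alpha> i j \<noteq> 0" "\<And>i. i \<in> {1..2 * k} \<Longrightarrow> \<exists>j\<le>N. \<beta> i j \<noteq> 0"
    proof -
      obtain f where f: "\<And>i. i \<in> {1..n} \<Longrightarrow> \<alpha> i (f i) \<noteq> 0" using \<alpha>0 by metis
      obtain f' where f': "\<And>i. i \<in> {1..2 * k} \<Longrightarrow> \<beta> i (f' i) \<noteq> 0" using \<beta>0 by metis
      define N where "N = Max (insert 0 (f ` {1..n} \<union> f' ` {1..2 * k}))"
      have "f i \<le> N" if "i \<in> {1..n}" for i unfolding N_def by (rule Max_ge) (use that in auto)
      moreover have "f' i \<le> N" if "i \<in> {1..2 * k}" for i unfolding N_def by (rule Max_ge) (use that in auto)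
      ultimately show ?thesis using that[of N] f f' by blast
    qed
    \<comment> \<open>The extra factor p in r leaves p^2 after cancelling an exponent \<beta>; the
      one in q lets translation by h have order p. W has order p^M, so it sees exponents modulo
      p^M.\<close>
    define q where "q = p ^ Suc N"
    define r where "r = p ^ Suc N"
    define h where "h = int (p ^ N)"
    define W where "W = wreath q r"
    define M where "M = Suc N + Suc N * p ^ Suc N"
    have MN: "Suc N \<le> M" by (simp add: M_def)
    have pN: "1 < p ^ Suc N" by (rule one_less_power[OF prime_gt_1_nat[OF prime_p]]) simp
    have q0: "q > 0" and r0: "r > 0" using p0 by (simp_all add: q_def r_def)
    have qh: "int q = int p * h" by (simp add: q_def h_def)
    have W: "group W" unfolding W_def by (rule group_wreath[OF q0 r0])
    have ordW: "order W = p ^ M"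
      unfolding W_def order_wreath[OF q0] M_def by (simp only: q_def r_def power_add power_mult)
    have ndvd_\<alpha>: "\<not> int p ^ j dvd \<alpha> i M" if "i \<in> {1..n}" "N \<le> j" "j \<le> M" for i j
      using N(1)[OF that(1)] padic_not_dvd[OF prime_p \<alpha>c[OF that(1)]] that(2,3) by (meson le_trans)
    have ndvd_\<beta>: "\<not> int p ^ j dvd \<beta> i M" if "i \<in> {1..2 * k}" "N \<le> j" "j \<le> M" for i j
      using N(2)[OF that(1)] padic_not_dvd[OF prime_p \<beta>c[OF that(1)]] that(2,3) by (meson le_trans)
    obtain Y y0 where Y: "finite Y" "topologically_generates G T Y"
        "\<forall>Z. Z \<subset> Y \<longrightarrow> \<not> topologically_generates G T Z" "y0 \<in> Y"
        "\<And>\<rho> \<sigma>. \<rho> \<in> open_homs G T W \<Longrightarrow> \<sigma> \<in> open_homs G T W \<Longrightarrow>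
          (\<And>y. y \<in> Y - {y0} \<Longrightarrow> \<rho> y = \<sigma> y) \<Longrightarrow> \<rho> ?g = \<sigma> ?g"
      using nonsurjective_endo_fixed[OF \<phi>(1) ns gc \<phi>(2) W ordW] by blast
    have YG: "Y \<subseteq> carrier G" using Y(2) by (simp add: topologically_generates_def)
    \<comment> \<open>The identity of the group ring, a base element outside the maximal
      ideal.\<close>
    define \<delta> where "\<delta> = (0 :: int, \<lambda>z :: int. if int q dvd z then 1 else 0 :: int)"
    have \<delta>W: "\<delta> \<in> carrier W"
      using q0 p0 pN by (auto simp: W_def wreath_carrier \<delta>_def r_def simp del: power_Suc of_nat_power)
    have sum\<delta>: "period_sum q p \<delta> = 1"
    proof -
      have "(\<Sum>z<q. snd \<delta> (int z)) = snd \<delta> (int 0)"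
      proof (rule sum_only)
        fix z assume "z \<in> {..<q}" "z \<noteq> 0"
        then have "\<not> int q dvd int z" by (auto dest: zdvd_imp_le)
        then show "snd \<delta> (int z) = 0" by (simp add: \<delta>_def)
      qed (use q0 in auto)
      then show ?thesis using prime_gt_1_nat[OF prime_p] by (simp add: period_sum_def \<delta>_def)
    qed
    have ps: "period_sum q p \<in> hom W (integer_mod_group p)"
      unfolding W_def by (rule period_sum_hom[OF p0]) (simp add: r_def)
    have ps_char: "period_sum q p \<circ> \<rho> \<in> chars" if "\<rho> \<in> open_homs G T W" for \<rho>
      by (rule open_homs_compose[OF that ps W]) simp
    have ps_one: "period_sum q p \<one>\<^bsub>W\<^esub> = 0" by (simp add: period_sum_def W_def wreath_one)
    have "(\<lambda>y. if y = y0 then \<delta> else \<one>\<^bsub>W\<^esub>) \<in> Y \<rightarrow> carrier W"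
      using \<delta>W group.is_monoid[OF W] by (simp add: monoid.one_closed)
    from minimal_generating_extension[OF Y(1-3) W ordW this]
    obtain \<rho>1 where \<rho>1: "\<rho>1 \<in> open_homs G T W" "\<forall>y\<in>Y. \<rho>1 y = (if y = y0 then \<delta> else \<one>\<^bsub>W\<^esub>)"
      by (elim bexE)
    \<comment> \<open>On Y this is the character dual to \<open>y0\<close>. Its value at x_i will be
      the augmentation of D x_i for every action, which makes the choice of i independent of the
      action.\<close>
    define \<kappa> where "\<kappa> = period_sum q p \<circ> \<rho>1"
    have \<kappa>: "\<kappa> \<in> chars" unfolding \<kappa>_def by (rule ps_char[OF \<rho>1(1)])
    have \<kappa>Y: "\<kappa> y = (if y = y0 then 1 else 0)" if "y \<in> Y" for y
      using \<rho>1(2) that sum\<delta> ps_one by (simp add: \<kappa>_def)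
    have "x ` {1..m} \<subseteq> carrier G" using gens_closed by blast
    moreover have "\<kappa> y0 \<noteq> 0" "y0 \<in> carrier G" using \<kappa>Y[OF Y(4)] Y(4) YG by auto
    ultimately obtain i where i: "i \<in> {1..m}" "\<kappa> (x i) \<noteq> 0"
      using topologically_generates_iff generators_generate \<kappa> by blast
    text \<open>
      A derivation over any homomorphism \<open>G \<rightarrow> \<int>/q\<close>, vanishing at \<open>g\<close> but not at \<open>x\<^sub>i\<close>: the
      choice of \<open>i\<close> is independent of that of the homomorphism.
    \<close>
    have derivation: "\<exists>\<rho>. \<rho> \<in> open_homs G T W \<and> (\<forall>l\<in>{1..m}. fst (\<rho> (x l)) = X l) \<and>
        \<not> int p dvd (\<Sum>z<q. snd (\<rho> (x i)) (int z)) \<and> (\<forall>y\<in>carrier G. \<rho> y \<in> carrier W) \<and>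
        (\<exists>\<sigma>\<in>open_homs G T W. (\<forall>l\<in>{1..m}. \<sigma> (x l) = (X l, \<lambda>_. 0)) \<and> \<rho> ?g = \<sigma> ?g)"
      if X: "\<forall>l\<in>{1..m}. 0 \<le> X l \<and> X l < int q" for X
    proof -
      have "(X l, \<lambda>_. 0) \<in> carrier (wreath (p ^ Suc N) (p ^ Suc N))" if "l \<in> {1..m}" for l
        using X that p0 by (simp add: wreath_carrier q_def)
      \<comment> \<open>\<sigma> has zero base components at all generators and is the reference
        homomorphism; \<rho> below differs from it on Y only by the factor \<delta> at
        \<open>y0\<close>.\<close>
      then obtain \<sigma> where \<sigma>: "\<sigma> \<in> open_homs G T W" "\<And>l. l \<in> {1..m} \<Longrightarrow> \<sigma> (x l) = (X l, \<lambda>_. 0)"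
        using wreath_hom[of "\<lambda>l. (X l, \<lambda>_. 0)" "Suc N" "Suc N"] unfolding W_def q_def r_def by metis
      interpret \<sigma>: group_hom G W \<sigma> using open_homsD(1)[OF \<sigma>(1)] W by (simp add: group_hom_def group_hom_axioms_def)
      have "(\<lambda>y. if y = y0 then \<delta> \<otimes>\<^bsub>W\<^esub> \<sigma> y else \<sigma> y) \<in> Y \<rightarrow> carrier W"
        using \<delta>W subsetD[OF YG] by auto
      from minimal_generating_extension[OF Y(1-3) W ordW this]
      obtain \<rho> where \<rho>: "\<rho> \<in> open_homs G T W" "\<forall>y\<in>Y. \<rho> y = (if y = y0 then \<delta> \<otimes>\<^bsub>W\<^esub> \<sigma> y else \<sigma> y)"
        by (elim bexE)
      have fstc: "fst \<in> hom W (integer_mod_group q)" unfolding W_def by (rule fst_hom_wreath[OF q0])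
      have f: "(fst \<circ> \<rho>) y = (fst \<circ> \<sigma>) y" if "y \<in> carrier G" for y
      proof (rule topologically_generates_eqI[OF Y(2) group_integer_mod_group _ _ _ that])
        show "fst \<circ> \<rho> \<in> open_homs G T (integer_mod_group q)" "fst \<circ> \<sigma> \<in> open_homs G T (integer_mod_group q)"
          by (rule open_homs_compose[OF _ fstc W]; simp add: \<rho> \<sigma>)+
        show "(fst \<circ> \<rho>) y = (fst \<circ> \<sigma>) y" if "y \<in> Y" for y
        proof -
          have "\<sigma> y \<in> carrier W" using YG that by auto
          then show ?thesis using \<rho>(2) that by (auto simp: W_def fst_wreath_mult \<delta>_def wreath_carrier)
        qed
      qed
      have \<sigma>0: "period_sum q p (\<sigma> y) = 0" if "y \<in> carrier G" for y
      proof -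
        have "(\<lambda>_. 0) \<in> chars"
          using p0 openin_topspace[of T]
          by (auto simp: open_homs_def hom_def kernel_def carrier_integer_mod_group topspace_eq)
        from open_hom_ext[OF group_integer_mod_group ps_char[OF \<sigma>(1)] this _ that]
        show ?thesis using \<sigma>(2) by (simp add: period_sum_def)
      qed
      \<comment> \<open>Both sides are characters, so a comparison on Y suffices; there \<sigma>
        contributes 0 and only the augmentation of \<delta> remains.\<close>
      have "(period_sum q p \<circ> \<rho>) (x i) = \<kappa> (x i)"
      proof (rule topologically_generates_eqI[OF Y(2) group_integer_mod_group ps_char[OF \<rho>(1)] \<kappa> _ gens_closed[OF i(1)]])
        fix y assume y: "y \<in> Y"
        then have yG: "y \<in> carrier G" using YG by blast
        have "period_sum q p (\<delta> \<otimes>\<^bsub>W\<^esub> \<sigma> y) = 1"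
          using hom_mult[OF ps \<delta>W \<sigma>.hom_closed[OF yG]] sum\<delta> \<sigma>0[OF yG] prime_gt_1_nat[OF prime_p] by simp
        then show "(period_sum q p \<circ> \<rho>) y = \<kappa> y" using \<rho>(2) y \<kappa>Y[OF y] \<sigma>0[OF yG] by (cases "y = y0") simp_all
      qed
      then have "\<not> int p dvd (\<Sum>z<q. snd (\<rho> (x i)) (int z))" using i(2) by (auto simp: period_sum_def)
      moreover have "\<rho> ?g = \<sigma> ?g" by (rule Y(5)[OF \<rho>(1) \<sigma>(1)]) (simp add: \<rho>(2))
      moreover have "fst (\<rho> (x l)) = X l" if "l \<in> {1..m}" for l using f[OF gens_closed[OF that]] \<sigma>(2)[OF that] by simp
      moreover have "\<rho> y \<in> carrier W" if "y \<in> carrier G" for y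
        using open_homsD(1)[OF \<rho>(1)] that by (auto simp: hom_def)
      ultimately show ?thesis using \<rho>(1) \<sigma> by blast
    qed
    have fst_pow: "fst (\<rho> (padic_pow G T y \<gamma>)) = (\<gamma> M * fst (\<rho> y)) mod int q"
      and snd_pow: "snd (\<rho> (padic_pow G T y \<gamma>)) z = (\<Sum>j<nat (\<gamma> M). snd (\<rho> y) (z + int j * fst (\<rho> y))) mod int r"
      if \<rho>: "\<rho> \<in> open_homs G T W" "\<forall>y\<in>carrier G. \<rho> y \<in> carrier W"
        and y: "y \<in> carrier G" and \<gamma>: "\<gamma> \<in> carrier (padic_ints p)" for \<rho> y \<gamma> z
    proof -
      have eq: "\<rho> (padic_pow G T y \<gamma>) = \<rho> y [^]\<^bsub>W\<^esub> nat (\<gamma> M)" by (rule open_hom_padic_pow[OF \<rho>(1) W ordW y \<gamma>])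
      have \<rho>y: "\<rho> y \<in> carrier (wreath q r)" using \<rho>(2) y by (simp add: W_def)
      have "0 \<le> \<gamma> M" using \<gamma> by (simp add: padic_carrier)
      then show "fst (\<rho> (padic_pow G T y \<gamma>)) = (\<gamma> M * fst (\<rho> y)) mod int q"
        unfolding eq W_def fst_wreath_pow[OF \<rho>y] by simp
      show "snd (\<rho> (padic_pow G T y \<gamma>)) z = (\<Sum>j<nat (\<gamma> M). snd (\<rho> y) (z + int j * fst (\<rho> y))) mod int r"
        unfolding eq W_def by (rule snd_wreath_pow[OF \<rho>y])
    qed
    have snd_pow0: "snd (\<rho> (padic_pow G T y \<gamma>)) z = (\<gamma> M * snd (\<rho> y) z) mod int r"
      if \<rho>: "\<rho> \<in> open_homs G T W" "\<forall>y\<in>carrier G. \<rho> y \<in> carrier W"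
        and y: "y \<in> carrier G" "fst (\<rho> y) = 0" and \<gamma>: "\<gamma> \<in> carrier (padic_ints p)" for \<rho> y \<gamma> z
      using snd_pow[OF \<rho> y(1) \<gamma>, of z] y(2) \<gamma> by (simp add: padic_carrier)
    \<comment> \<open>Translation by h has order p and the exponent is divisible by p, so the
      derivative of the power is a multiple of the sum over a full orbit of this
      translation.\<close>
    have hper: "snd (\<rho> (?u l)) (z + h) = snd (\<rho> (?u l)) z"
      if \<rho>: "\<rho> \<in> open_homs G T W" "\<forall>y\<in>carrier G. \<rho> y \<in> carrier W"
        and l: "l \<in> {1..n}" and fl: "fst (\<rho> (x l)) = h" for \<rho> l z
    proof -
      define v where "v = snd (\<rho> (x l))"
      have "\<rho> (x l) \<in> carrier (wreath q r)" using \<rho>(2) xc[OF l] by (simp add: W_def)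
      then have vq: "v (z + int p * h) = v z" for z unfolding v_def qh[symmetric] by (simp add: wreath_carrier)
      have "\<alpha> l M mod int p ^ 1 = 0" using padic_mod[OF \<alpha>c[OF l], of 1 M] \<alpha>1[OF l] MN by simp
      then have "int p dvd int (nat (\<alpha> l M))" using \<alpha>c[OF l] by (simp add: dvd_eq_mod_eq_0 padic_carrier)
      then obtain f where f: "nat (\<alpha> l M) = p * f" by (metis dvdE of_nat_dvd_iff)
      have sum: "(\<Sum>j<p * f. v (z + int j * h)) = int f * (\<Sum>j<p. v (z + int j * h))" for z
      proof (rule sum_periodic)
        show "v (z + int (j + p) * h) = v (z + int j * h)" for j
          using vq[of "z + int j * h"] by (simp add: algebra_simps)
      qed
      have "(\<Sum>j<p. v (z + h + int j * h)) = (\<Sum>j<p. v (z + int j * h))"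
      proof -
        have "(\<Sum>j<p'. v (z + h + int j * h)) + v z = (\<Sum>j<p'. v (z + int j * h)) + v (z + int p' * h)" for p'
          by (induction p') (simp_all add: algebra_simps)
        from this[of p] show ?thesis using vq by simp
      qed
      then show ?thesis
        unfolding snd_pow[OF \<rho> xc[OF l] \<alpha>c[OF l]] fl f by (simp add: sum flip: v_def)
    qed
    have \<alpha>h: "(\<alpha> l M * h) mod int q = 0" if l: "l \<in> {1..n}" for l
    proof -
      have "\<alpha> l M mod int p ^ 1 = 0" using padic_mod[OF \<alpha>c[OF l], of 1 M] \<alpha>1[OF l] MN by simp
      then show ?thesis unfolding qh by (simp add: dvd_eq_mod_eq_0[symmetric] mult_dvd_mono)
    qed
    have word: "[snd (\<rho> ?g) z = (\<Sum>l=1..n. snd (\<rho> (?u l)) z) +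
        (\<Sum>j<k. snd (commutator W (\<rho> (?a j)) (\<rho> (?b j))) z)] (mod int r)"
      if \<rho>: "\<rho> \<in> open_homs G T W" "\<forall>y\<in>carrier G. \<rho> y \<in> carrier W"
        and fl: "\<And>l. l \<in> {1..n} \<Longrightarrow> fst (\<rho> (x l)) \<in> {0, h}" for \<rho> z
    proof -
      interpret \<rho>: group_hom G W \<rho>
        using open_homsD(1)[OF \<rho>(1)] W by (simp add: group_hom_def group_hom_axioms_def)
      have "\<rho> ?g = surface_word W n k (\<rho> \<circ> ?u) (\<rho> \<circ> ?a) (\<rho> \<circ> ?b)"
        by (rule \<rho>.hom_surface_word) (use uc ac bc in auto)
      moreover have "fst (\<rho> (?u l)) = 0" if "l \<in> {1..n}" for l
        using fl[OF that] \<alpha>h[OF that] unfolding fst_pow[OF \<rho> xc[OF that] \<alpha>c[OF that]] by auto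
      ultimately show ?thesis
        using snd_wreath_surface_word[OF q0 r0, of n "\<rho> \<circ> ?u" k "\<rho> \<circ> ?a" "\<rho> \<circ> ?b" z] \<rho>(2) ac bc
        by (simp add: W_def)
    qed
    have comm: "[snd (commutator W (\<rho> (?a j)) (\<rho> (?b j))) (z + fst (\<rho> (?a j)) + fst (\<rho> (?b j))) =
        snd (\<rho> (?a j)) z - snd (\<rho> (?a j)) (z + fst (\<rho> (?b j))) + snd (\<rho> (?b j)) (z + fst (\<rho> (?a j))) - snd (\<rho> (?b j)) z] (mod int r)"
      if \<rho>: "\<forall>y\<in>carrier G. \<rho> y \<in> carrier W" and j: "j < k" for \<rho> j z
      using wreath_commutator(2)[OF q0 r0, of "\<rho> (?a j)" "\<rho> (?b j)" z] \<rho> ac[OF j] bc[OF j] by (simp add: W_def)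
    have comm_zero: "snd (commutator W (\<rho> (?a j)) (\<rho> (?b j))) z = 0"
      if \<rho>: "\<forall>y\<in>carrier G. \<rho> y \<in> carrier W" and j: "j < k"
        and 0: "fst (\<rho> (?a j)) = 0 \<and> fst (\<rho> (?b j)) = 0 \<or> snd (\<rho> (?a j)) = (\<lambda>_. 0) \<and> snd (\<rho> (?b j)) = (\<lambda>_. 0)" for \<rho> j z
    proof -
      have "commutator W (\<rho> (?a j)) (\<rho> (?b j)) \<in> carrier W"
        using group.commutator_closed[OF W] \<rho> ac[OF j] bc[OF j] by simp
      then have "0 \<le> snd (commutator W (\<rho> (?a j)) (\<rho> (?b j))) z \<and> snd (commutator W (\<rho> (?a j)) (\<rho> (?b j))) z < int r"
        by (simp add: wreath_carrier W_def)
      moreover have "[snd (commutator W (\<rho> (?a j)) (\<rho> (?b j))) z = 0] (mod int r)"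
        using 0 comm[OF \<rho> j, of "z - fst (\<rho> (?a j)) - fst (\<rho> (?b j))"] by auto
      ultimately show ?thesis by (simp add: cong_def)
    qed
    \<comment> \<open>The equation D g = 0 in coordinates: \<rho> and \<sigma> agree at g, and
      \<sigma> g has zero base component modulo r.\<close>
    have vanish: "\<exists>\<rho>. \<rho> \<in> open_homs G T W \<and> (\<forall>l\<in>{1..m}. fst (\<rho> (x l)) = X l) \<and>
        \<not> int p dvd (\<Sum>z<q. snd (\<rho> (x i)) (int z)) \<and> (\<forall>y\<in>carrier G. \<rho> y \<in> carrier W) \<and>
        (\<forall>z. [(\<Sum>l=1..n. snd (\<rho> (?u l)) z) + (\<Sum>j<k. snd (commutator W (\<rho> (?a j)) (\<rho> (?b j))) z) = 0] (mod int r))"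
      if X: "\<forall>l\<in>{1..m}. 0 \<le> X l \<and> X l < int q" "\<forall>l\<in>{1..n}. X l \<in> {0, h}" for X
    proof -
      obtain \<rho> \<sigma> where \<rho>: "\<rho> \<in> open_homs G T W" "\<forall>y\<in>carrier G. \<rho> y \<in> carrier W" "\<forall>l\<in>{1..m}. fst (\<rho> (x l)) = X l"
          "\<not> int p dvd (\<Sum>z<q. snd (\<rho> (x i)) (int z))"
        and \<sigma>: "\<sigma> \<in> open_homs G T W" "\<forall>l\<in>{1..m}. \<sigma> (x l) = (X l, \<lambda>_. 0)" "\<rho> ?g = \<sigma> ?g"
        using derivation[OF X(1)] by (elim exE conjE bexE)
      have \<sigma>W: "\<forall>y\<in>carrier G. \<sigma> y \<in> carrier W" using open_homsD(1)[OF \<sigma>(1)] by (auto simp: hom_def)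
      have \<sigma>pow: "snd (\<sigma> (padic_pow G T (x l) \<gamma>)) = (\<lambda>_. 0)" if "l \<in> {1..m}" "\<gamma> \<in> carrier (padic_ints p)" for l \<gamma>
        using snd_pow[OF \<sigma>(1) \<sigma>W gens_closed[OF that(1)] that(2)] \<sigma>(2) that(1) by (simp add: fun_eq_iff)
      have \<sigma>0: "[snd (\<sigma> ?g) z = 0] (mod int r)" for z
      proof -
        have "(\<Sum>l=1..n. snd (\<sigma> (?u l)) z) = 0"
          by (rule sum.neutral) (use \<sigma>pow[OF _ \<alpha>c] m in auto)
        moreover have "(\<Sum>j<k. snd (commutator W (\<sigma> (?a j)) (\<sigma> (?b j))) z) = 0"
        proof (intro sum.neutral ballI)
          fix j assume "j \<in> {..<k}"
          then have j: "j < k" by simp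
          have "n + 2 * j + 1 \<in> {1..m}" "n + 2 * j + 2 \<in> {1..m}" using j m by auto
          then show "snd (commutator W (\<sigma> (?a j)) (\<sigma> (?b j))) z = 0"
            using comm_zero[OF \<sigma>W j] \<sigma>pow \<beta>c[OF \<beta>a[OF j]] \<beta>c[OF \<beta>b[OF j]] by blast
        qed
        moreover have "fst (\<sigma> (x l)) \<in> {0, h}" if "l \<in> {1..n}" for l using \<sigma>(2) bspec[OF X(2) that] that m by auto
        ultimately show ?thesis using word[OF \<sigma>(1) \<sigma>W, of z] by simp
      qed
      have "fst (\<rho> (x l)) \<in> {0, h}" if "l \<in> {1..n}" for l
        using \<rho>(3) bspec[OF X(2) that] that m by auto
      then have "[(\<Sum>l=1..n. snd (\<rho> (?u l)) z) + (\<Sum>j<k. snd (commutator W (\<rho> (?a j)) (\<rho> (?b j))) z) = snd (\<rho> ?g) z] (mod int r)" for z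
        by (rule cong_sym[OF word[OF \<rho>(1,2)]])
      from cong_trans[OF this \<sigma>0[folded \<sigma>(3)]]
      have "\<forall>z. [(\<Sum>l=1..n. snd (\<rho> (?u l)) z) + (\<Sum>j<k. snd (commutator W (\<rho> (?a j)) (\<rho> (?b j))) z) = 0] (mod int r)"
        by blast
      then show ?thesis using \<rho> by blast
    qed
    have h: "0 \<le> h" "h < int q" "1 < int q"
    proof -
      show "0 \<le> h" by (simp add: h_def)
      show "h < int q" unfolding h_def q_def of_nat_less_iff
        using prime_gt_1_nat[OF prime_p] by (intro power_strict_increasing) auto
      show "1 < int q" using pN unfolding q_def by linarith
    qed
    \<comment> \<open>Invariance under h modulo p puts D x_i into the maximal ideal, against the
      choice of i.\<close>
    have finish: False if "\<And>z. int p dvd snd (\<rho> (x i)) (z + h) - snd (\<rho> (x i)) z"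
      "\<not> int p dvd (\<Sum>z<q. snd (\<rho> (x i)) (int z))" for \<rho>
      using dvd_sum_of_shift_invariant[of p "snd (\<rho> (x i))" "p ^ N"] that by (simp add: h_def q_def)
    show False
    proof (cases "i \<le> n")
      case True
      then have iN: "i \<in> {1..n}" using i by simp
      \<comment> \<open>The powers of the other x_l become periodic under h, no commutator
        contributes, and the i-th power contributes \<alpha>_i D x_i because x_i acts
        trivially.\<close>
      define X where "X l = (if l \<in> {1..n} - {i} then h else 0)" for l
      have "\<forall>l\<in>{1..m}. 0 \<le> X l \<and> X l < int q" "\<forall>l\<in>{1..n}. X l \<in> {0, h}" using h by (auto simp: X_def)
      from vanish[OF this] obtain \<rho> where \<rho>: "\<rho> \<in> open_homs G T W" "\<forall>y\<in>carrier G. \<rho> y \<in> carrier W"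
        and fX: "\<forall>l\<in>{1..m}. fst (\<rho> (x l)) = X l"
        and nd: "\<not> int p dvd (\<Sum>z<q. snd (\<rho> (x i)) (int z))"
        and van: "\<forall>z. [(\<Sum>l=1..n. snd (\<rho> (?u l)) z) + (\<Sum>j<k. snd (commutator W (\<rho> (?a j)) (\<rho> (?b j))) z) = 0] (mod int r)"
        by (elim exE conjE)
      have fst0: "fst (\<rho> (?a j)) = 0 \<and> fst (\<rho> (?b j)) = 0" if j: "j < k" for j
        using fst_pow[OF \<rho> xac[OF j] \<beta>c[OF \<beta>a[OF j]]] fst_pow[OF \<rho> xbc[OF j] \<beta>c[OF \<beta>b[OF j]]] fX j m
        by (simp add: X_def)
      have sum_i: "(\<Sum>l=1..n. snd (\<rho> (?u l)) z) = (\<alpha> i M * snd (\<rho> (x i)) z) mod int r + (\<Sum>l\<in>{1..n} - {i}. snd (\<rho> (?u l)) z)" for z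
      proof -
        have "fst (\<rho> (x i)) = 0" using fX i(1) by (simp add: X_def)
        then have "snd (\<rho> (?u i)) z = (\<alpha> i M * snd (\<rho> (x i)) z) mod int r"
          by (rule snd_pow0[OF \<rho> xc[OF iN] _ \<alpha>c[OF iN]])
        moreover have "(\<Sum>l=1..n. snd (\<rho> (?u l)) z) = snd (\<rho> (?u i)) z + (\<Sum>l\<in>{1..n} - {i}. snd (\<rho> (?u l)) z)"
          by (rule sum.remove[OF _ iN]) simp
        ultimately show ?thesis by simp
      qed
      have per: "(\<Sum>l\<in>{1..n} - {i}. snd (\<rho> (?u l)) (z + h)) = (\<Sum>l\<in>{1..n} - {i}. snd (\<rho> (?u l)) z)" for z
        by (rule sum.cong[OF refl], rule hper[OF \<rho>]) (use fX m in \<open>auto simp: X_def\<close>)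
      have tot: "[\<alpha> i M * snd (\<rho> (x i)) z + (\<Sum>l\<in>{1..n} - {i}. snd (\<rho> (?u l)) z) = 0] (mod int r)" for z
        using van[rule_format, of z] unfolding sum_i using comm_zero[OF \<rho>(2)] fst0 by (simp add: cong_def mod_simps)
      \<comment> \<open>Subtracting the equations at z + h and z cancels the periodic part.\<close>
      have "int p ^ (Suc N + 0) dvd \<alpha> i M * (snd (\<rho> (x i)) (z + h) - snd (\<rho> (x i)) z)" for z
        using cong_diff[OF tot[of "z + h"] tot[of z]] unfolding per
        by (simp add: cong_0_iff r_def algebra_simps)
      note D = this
      have "prime (int p)" using prime_p by simp
      then have "int p ^ Suc 0 dvd snd (\<rho> (x i)) (z + h) - snd (\<rho> (x i)) z" for z
        by (rule prime_power_dvd_mult_cancel[OF _ ndvd_\<alpha>[OF iN _ MN] D]) simp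
      then have "int p dvd snd (\<rho> (x i)) (z + h) - snd (\<rho> (x i)) z" for z by simp
      then show False using nd by (rule finish)
    next
      case False
      define j where "j = (i - n - 1) div 2"
      have j: "j < k" and ij: "i = n + 2 * j + 1 \<or> i = n + 2 * j + 2" unfolding j_def using False i m by auto
      define i' where "i' = (if i = n + 2 * j + 1 then n + 2 * j + 2 else n + 2 * j + 1)"
      \<comment> \<open>The partner of x_i acts by a generator of Z/q. The other commutators have
        trivially acting entries and vanish, and all powers are periodic under h.\<close>
      define X where "X l = (if l \<in> {1..n} then h else if l = i' then 1 else 0)" for l
      have "\<forall>l\<in>{1..m}. 0 \<le> X l \<and> X l < int q" "\<forall>l\<in>{1..n}. X l \<in> {0, h}" using h by (auto simp: X_def)
      from vanish[OF this] obtain \<rho> where \<rho>: "\<rho> \<in> open_homs G T W" "\<forall>y\<in>carrier G. \<rho> y \<in> carrier W"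
        and fX: "\<forall>l\<in>{1..m}. fst (\<rho> (x l)) = X l"
        and nd: "\<not> int p dvd (\<Sum>z<q. snd (\<rho> (x i)) (int z))"
        and van: "\<forall>z. [(\<Sum>l=1..n. snd (\<rho> (?u l)) z) + (\<Sum>j<k. snd (commutator W (\<rho> (?a j)) (\<rho> (?b j))) z) = 0] (mod int r)"
        by (elim exE conjE)
      have Xa: "fst (\<rho> (x (n + 2 * j' + 1))) = (if n + 2 * j' + 1 = i' then 1 else 0)"
        and Xb: "fst (\<rho> (x (n + 2 * j' + 2))) = (if n + 2 * j' + 2 = i' then 1 else 0)" if "j' < k" for j'
        using fX that m by (simp_all add: X_def)
      have fa: "fst (\<rho> (?a j')) = (if n + 2 * j' + 1 = i' then \<beta> (2 * j' + 1) M mod int q else 0)"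
        and fb: "fst (\<rho> (?b j')) = (if n + 2 * j' + 2 = i' then \<beta> (2 * j' + 2) M mod int q else 0)" if "j' < k" for j'
        unfolding fst_pow[OF \<rho> xac[OF that] \<beta>c[OF \<beta>a[OF that]]] fst_pow[OF \<rho> xbc[OF that] \<beta>c[OF \<beta>b[OF that]]] Xa[OF that] Xb[OF that]
        by simp_all
      have per: "(\<Sum>l=1..n. snd (\<rho> (?u l)) (z + h)) = (\<Sum>l=1..n. snd (\<rho> (?u l)) z)" for z
        by (rule sum.cong[OF refl], rule hper[OF \<rho>]) (use fX m in \<open>auto simp: X_def\<close>)
      define C where "C = snd (commutator W (\<rho> (?a j)) (\<rho> (?b j)))"
      have sumC: "(\<Sum>j<k. snd (commutator W (\<rho> (?a j)) (\<rho> (?b j))) z) = C z" for z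
        unfolding C_def
      proof (rule sum_only)
        fix j' assume j': "j' \<in> {..<k}" "j' \<noteq> j"
        then have "n + 2 * j' + 1 \<noteq> i'" "n + 2 * j' + 2 \<noteq> i'"
          unfolding i'_def by (simp_all split: if_split; presburger)+
        then show "snd (commutator W (\<rho> (?a j')) (\<rho> (?b j'))) z = 0"
          using comm_zero[OF \<rho>(2), of j'] j'(1) fa[of j'] fb[of j'] by simp
      qed (use j in auto)
      \<comment> \<open>The remaining commutator inherits periodicity modulo r from the powers,
        since the total is 0.\<close>
      have C: "[C (z + h) = C z] (mod int r)" for z
        using cong_diff[OF van[rule_format, of "z + h"] van[rule_format, of z]] unfolding sumC per by (simp add: cong_iff_dvd_diff)
      define v where "v = snd (\<rho> (x i))"
      have vW: "\<rho> (x i) \<in> carrier (wreath q r)" using \<rho>(2) gens_closed[OF i(1)] by (simp add: W_def)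
      then have vq: "v (z + int (p ^ Suc N)) = v z" for z unfolding v_def q_def[symmetric] by (simp add: wreath_carrier)
      \<comment> \<open>Up to sign, b is the exponent on x_i, and c is the translation by the power
        of its partner. The terms in D of the partner cancel because x_i acts trivially. Reducing c
        modulo q = p^(N+1) preserves its non-divisibility by p^(N+1).\<close>
      have "\<exists>b c. \<not> int p ^ N dvd b \<and> \<not> int p ^ Suc N dvd c \<and> (\<forall>z. [C (z + c) = b * (v z - v (z + c))] (mod int r))"
      proof (cases "i = n + 2 * j + 1")
        case True
        then have i': "i' = n + 2 * j + 2" by (simp add: i'_def)
        let ?c = "\<beta> (2 * j + 2) M mod int q"
        have "[C (z + ?c) = \<beta> (2 * j + 1) M * (v z - v (z + ?c))] (mod int r)" for z
        proof -
          have sa: "snd (\<rho> (?a j)) z = (\<beta> (2 * j + 1) M * v z) mod int r" for z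
            unfolding v_def True by (rule snd_pow0[OF \<rho> xac[OF j] _ \<beta>c[OF \<beta>a[OF j]]]) (simp only: Xa[OF j] i', simp)
          show ?thesis using comm[OF \<rho>(2) j, of z] fa[OF j] fb[OF j] i' unfolding C_def[symmetric] sa
            by (simp add: cong_def mod_simps right_diff_distrib)
        qed
        moreover have "\<not> int p ^ Suc N dvd ?c"
          using ndvd_\<beta>[OF \<beta>b[OF j] _ MN] by (simp add: q_def dvd_mod_iff del: power_Suc)
        ultimately show ?thesis using ndvd_\<beta>[OF \<beta>a[OF j] le_refl] MN by (meson Suc_leD)
      next
        case False
        then have i2: "i = n + 2 * j + 2" and i': "i' = n + 2 * j + 1" using ij by (simp_all add: i'_def)
        let ?c = "\<beta> (2 * j + 1) M mod int q"
        have "[C (z + ?c) = - \<beta> (2 * j + 2) M * (v z - v (z + ?c))] (mod int r)" for z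
        proof -
          have sb: "snd (\<rho> (?b j)) z = (\<beta> (2 * j + 2) M * v z) mod int r" for z
            unfolding v_def i2 by (rule snd_pow0[OF \<rho> xbc[OF j] _ \<beta>c[OF \<beta>b[OF j]]]) (simp only: Xb[OF j] i', simp)
          show ?thesis using comm[OF \<rho>(2) j, of z] fa[OF j] fb[OF j] i' unfolding C_def[symmetric] sb
            by (simp add: cong_def mod_simps right_diff_distrib)
        qed
        moreover have "\<not> int p ^ Suc N dvd ?c"
          using ndvd_\<beta>[OF \<beta>a[OF j] _ MN] by (simp add: q_def dvd_mod_iff del: power_Suc)
        moreover have "\<not> int p ^ N dvd - \<beta> (2 * j + 2) M" using ndvd_\<beta>[OF \<beta>b[OF j] le_refl] MN by simp
        ultimately show ?thesis by blast
      qed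
      then obtain b c where bc: "\<not> int p ^ N dvd b" "\<not> int p ^ Suc N dvd c"
        and Cc: "\<And>z. [C (z + c) = b * (v z - v (z + c))] (mod int r)" by blast
      \<comment> \<open>Periodicity of C, rewritten with the formula for \<open>C (z + c)\<close>,
        is the hypothesis of \<open>shift_invariant_of_commutator\<close> with both of its levels
        equal to N.\<close>
      have "int p ^ Suc N dvd b * ((v (z + int (p ^ N)) - v z) - (v (z + int (p ^ N) + c) - v (z + c)))" for z
      proof -
        have "[b * (v (z + h) - v (z + h + c)) = C (z + h + c)] (mod int r)" by (rule cong_sym[OF Cc])
        also have "C (z + h + c) = C (z + c + h)" by (simp add: add_ac)
        also have "[C (z + c + h) = C (z + c)] (mod int r)" by (rule C)
        also have "[C (z + c) = b * (v z - v (z + c))] (mod int r)" by (rule Cc)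
        finally show ?thesis
          unfolding h_def[symmetric] by (simp add: cong_iff_dvd_diff r_def algebra_simps)
      qed
      from shift_invariant_of_commutator[OF prime_p vq bc(1) bc(2) this]
      have "int p dvd v (z + h) - v z" for z unfolding h_def .
      then show False using nd unfolding v_def by (rule finish)
    qed
  qed
  then show ?thesis using gc unfolding test_element_def by blast
qed

end

text \<open>Parts (a) and (b) are the cases n = 1, k = 0 and n = 0, k = 1 of part (c), up to the
  trailing factor one in \<open>list_mult\<close>.\<close>

theorem proposition5p13:
  fixes p :: nat
  assumes "prime p"
  shows
    "(\<forall>(G :: ('a, 'b) monoid_scheme) T x \<alpha>.
        free_pro_p_group p G T 1 x \<and>
        \<alpha> \<in> padic_multiples p p - padic_multiples p (p ^ 2) \<longrightarrow>
        almost_primitive_element G T (padic_pow G T (x 1) \<alpha>))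
   \<and> (\<forall>(G :: ('a, 'b) monoid_scheme) T x.
        free_pro_p_group p G T 2 x \<longrightarrow>
        almost_primitive_element G T (commutator G (x 1) (x 2)))
   \<and> (\<forall>(G :: ('a, 'b) monoid_scheme) T x n k \<alpha>.
        free_pro_p_group p G T (n + 2 * k) x \<and>
        (\<forall>i\<in>{1..n}. \<alpha> i \<in> padic_multiples p p - padic_multiples p (p ^ 2)) \<longrightarrow>
        almost_primitive_element G T
          (list_mult G
            (map (\<lambda>i. padic_pow G T (x i) (\<alpha> i)) [1..<n + 1] @
             map (\<lambda>j. commutator G (x (n + 2 * j + 1)) (x (n + 2 * j + 2))) [0..<k])))
   \<and> (\<forall>(G :: ('a, 'b) monoid_scheme) T x n k \<alpha> \<beta>.
        free_pro_p_group p G T (n + 2 * k) x \<and>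
        (\<forall>i\<in>{1..n}. \<alpha> i \<in> padic_multiples p p - {\<zero>\<^bsub>padic_ints p\<^esub>}) \<and>
        (\<forall>i\<in>{1..2 * k}. \<beta> i \<in> carrier (padic_ints p) - {\<zero>\<^bsub>padic_ints p\<^esub>}) \<longrightarrow>
        test_element G T
          (list_mult G
            (map (\<lambda>i. padic_pow G T (x i) (\<alpha> i)) [1..<n + 1] @
             map (\<lambda>j. commutator G
                        (padic_pow G T (x (n + 2 * j + 1)) (\<beta> (2 * j + 1)))
                        (padic_pow G T (x (n + 2 * j + 2)) (\<beta> (2 * j + 2)))) [0..<k])))"
proof (intro conjI allI impI; (elim conjE)?)
  fix G :: "('a, 'b) monoid_scheme" and T x
  show "almost_primitive_element G T (padic_pow G T (x 1) \<alpha>)"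
    if free: "free_pro_p_group p G T 1 x" and \<alpha>: "\<alpha> \<in> padic_multiples p p - padic_multiples p (p ^ 2)" for \<alpha>
  proof -
    interpret free_pro_p p G T 1 x
      using free by (simp add: free_pro_p_def free_pro_p_axioms_def free_pro_p_group_def)
    have "\<alpha> \<in> carrier (padic_ints p)" using \<alpha> padic_multiples_power[OF assms, of 1] by auto
    then have "padic_pow G T (x 1) \<alpha> \<in> carrier G" using padic_pow_closed gens_closed by simp
    then show ?thesis
      using almost_primitive_surface_word[of 1 0 "\<lambda>_. \<alpha>"] \<alpha> by (simp add: surface_word_def list_mult_def)
  qed
  show "almost_primitive_element G T (commutator G (x 1) (x 2))" if free: "free_pro_p_group p G T 2 x"
  proof -
    interpret free_pro_p p G T 2 x
      using free by (simp add: free_pro_p_def free_pro_p_axioms_def free_pro_p_group_def)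
    have "commutator G (x 1) (x 2) \<in> carrier G" using gens_closed by (simp add: commutator_closed)
    then show ?thesis
      using almost_primitive_surface_word[of 0 1] by (simp add: surface_word_def list_mult_def numeral_2_eq_2)
  qed
  fix n k \<alpha>
  assume free: "free_pro_p_group p G T (n + 2 * k) x"
  interpret free_pro_p p G T "n + 2 * k" x
    using free by (simp add: free_pro_p_def free_pro_p_axioms_def free_pro_p_group_def)
  show "almost_primitive_element G T (list_mult G
      (map (\<lambda>i. padic_pow G T (x i) (\<alpha> i)) [1..<n + 1] @
       map (\<lambda>j. commutator G (x (n + 2 * j + 1)) (x (n + 2 * j + 2))) [0..<k]))"
    if "\<forall>i\<in>{1..n}. \<alpha> i \<in> padic_multiples p p - padic_multiples p (p ^ 2)"
    using almost_primitive_surface_word[OF refl, of \<alpha>] that by (simp only: surface_word_def)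
  show "test_element G T (list_mult G
      (map (\<lambda>i. padic_pow G T (x i) (\<alpha> i)) [1..<n + 1] @
       map (\<lambda>j. commutator G (padic_pow G T (x (n + 2 * j + 1)) (\<beta> (2 * j + 1)))
         (padic_pow G T (x (n + 2 * j + 2)) (\<beta> (2 * j + 2)))) [0..<k]))"
    if "\<forall>i\<in>{1..n}. \<alpha> i \<in> padic_multiples p p - {\<zero>\<^bsub>padic_ints p\<^esub>}"
      "\<forall>i\<in>{1..2 * k}. \<beta> i \<in> carrier (padic_ints p) - {\<zero>\<^bsub>padic_ints p\<^esub>}" for \<beta>
    using surface_test_element[OF refl, of \<alpha> \<beta>] that by (simp only: surface_word_def)
qed

end
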